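(* Let $a>0$, let $U$ be a unitary $2\times2$ matrix, let $I$ be the $2\times 2$ identity matrix, let $\mathcal{L}_U$ be the corresponding self-adjoint prolate spheroid operator in $L^2([-a,a])$, and let $\mathscr{F}_{[-a,a]}$ be the truncated Fourier operator (see context). Then: (1) If $U=I$, then $\mathcal{L}_I$ commutes with $\mathscr{F}_{[-a,a]}$: $\mathscr{F}_{[-a,a]}\mathcal{L}_I x=\mathcal{L}_I\mathscr{F}_{[-a,a]}x$ for all $x\in\mathcal{D}_{\mathcal{L}_I}$ (in particular both sides are defined). (2) If $U\neq I$, then $\mathcal{L}_U$ does not commute with $\mathscr{F}_{[-a,a]}$; namely: (a) there exist $x\in\mathcal{D}_{\mathcal{L}_U}$ such that $\mathscr{F}_{[-a,a]}x\in\mathcal{D}_{\mathcal{L}_U}$ but $\mathscr{F}_{[-a,a]}\mathcal{L}_U x\neq\mathcal{L}_U\mathscr{F}_{[-a,a]}x$; (b) there exist $x\in\mathcal{D}_{\mathcal{L}_U}$ such that $\mathscr{F}_{[-a,a]}x\notin\mathcal{D}_{\mathcal{L}_U}$.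
   Context: Fix a real number $a>0$; the Hilbert space is $L^2([-a,a])$. The truncated Fourier operator $\mathscr{F}_{[-a,a]}:L^2([-a,a])\to L^2([-a,a])$ is $(\mathscr{F}_{[-a,a]}x)(t)=\frac{1}{\sqrt{2\pi}}\int_{-a}^a e^{it\xi}x(\xi)\,d\xi$, $t\in[-a,a]$. Let $\mathcal{A}$ be the set of complex-valued functions $x$ on $(-a,a)$ such that $x'(t)$ exists at every $t\in(-a,a)$ and $x'$ is absolutely continuous on every compact subinterval of $(-a,a)$. For $x\in\mathcal{A}$ put $(Mx)(t)=-\frac{d}{dt}\Big(\big(1-\frac{t^2}{a^2}\big)\frac{dx(t)}{dt}\Big)$ and $(Lx)(t)=(Mx)(t)+t^2x(t)$. The maximal operator $\mathcal{L}_{\max}$ has domain $\mathcal{D}_{\mathcal{L}_{\max}}=\{x\in L^2((-a,a))\cap\mathcal{A}: Mx\in L^2((-a,a))\}$ and acts by $\mathcal{L}_{\max}x=Lx$. For $x\in\mathcal{D}_{\mathcal{L}_{\max}}$ the following limits exist: $b_{-a}(x)=\lim_{t\to -a+0}(t+a)x'(t)$, $\; b_{a}(x)=\lim_{t\to a-0}(t-a)x'(t)$, $c_{-a}(x)=\lim_{t\to -a+0}\big((t+a)\ln(a+t)\,x'(t)-x(t)\big)$, $\; c_{a}(x)=\lim_{t\to a-0}\big((t-a)\ln(a-t)\,x'(t)-x(t)\big)$. For a $2\times2$ matrix $U=(u_{pq})$, the operator $\mathcal{L}_U$ is the restriction of $\mathcal{L}_{\max}$ to the set $\mathcal{D}_{\mathcal{L}_U}$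 of all $x\in\mathcal{D}_{\mathcal{L}_{\max}}$ satisfying $(1+u_{11})b_{-a}(x)-i(1-u_{11})c_{-a}(x)+u_{12}b_a(x)+iu_{12}c_a(x)=0$, $u_{21}b_{-a}(x)+iu_{21}c_{-a}(x)+(1+u_{22})b_a(x)-i(1-u_{22})c_a(x)=0$. *)

theory Defs
  imports "HOL-Analysis.Analysis"
begin

text \<open>
  Elements of $L^2([-a,a])$ are represented by functions on the whole real line, of which only the
  values on the open interval $(-a,a)$ matter; equality in $L^2$ is almost-everywhere equality with
  respect to \<open>lebesgue_on {-a..a}\<close>.
\<close>

definition L2 :: "real set \<Rightarrow> (real \<Rightarrow> complex) set" where
  "L2 S = {x. x \<in> borel_measurable (lebesgue_on S) \<and>
              integrable (lebesgue_on S) (\<lambda>t. (cmod (x t))\<^sup>2)}"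

definition eq_L2 :: "real set \<Rightarrow> (real \<Rightarrow> complex) \<Rightarrow> (real \<Rightarrow> complex) \<Rightarrow> bool" where
  "eq_L2 S x y \<longleftrightarrow> (AE t in lebesgue_on S. x t = y t)"

definition truncated_fourier :: "real \<Rightarrow> (real \<Rightarrow> complex) \<Rightarrow> real \<Rightarrow> complex" where
  "truncated_fourier a x t =
     complex_of_real (1 / sqrt (2 * pi)) *
     (LINT \<xi>:{-a..a}|lebesgue. exp (\<i> * complex_of_real (t * \<xi>)) * x \<xi>)"

text \<open>
  The finite families of non-overlapping intervals in the definition of absolute continuity are
  the divisions \<open>D\<close> of subsets \<open>T\<close> of the interval \<open>{c..d}\<close>; the members of a division are
  nonempty closed intervals \<open>K = {Inf K..Sup K}\<close>.
\<close>

definition absolutely_continuous_on_interval :: "real \<Rightarrow> real \<Rightarrow> (real \<Rightarrow> complex) \<Rightarrow> bool" where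
  "absolutely_continuous_on_interval c d f \<longleftrightarrow>
     (\<forall>\<epsilon>>0. \<exists>\<delta>>0. \<forall>D T. D division_of T \<and> T \<subseteq> {c..d} \<and> (\<Sum>K\<in>D. Sup K - Inf K) < \<delta>
        \<longrightarrow> (\<Sum>K\<in>D. cmod (f (Sup K) - f (Inf K))) < \<epsilon>)"

abbreviation derivative_at :: "(real \<Rightarrow> complex) \<Rightarrow> real \<Rightarrow> complex" where
  "derivative_at x t \<equiv> vector_derivative x (at t)"

definition class_A :: "real \<Rightarrow> (real \<Rightarrow> complex) set" where
  "class_A a = {x. (\<forall>t\<in>{-a<..<a}. x differentiable (at t)) \<and>
     (\<forall>c d. -a < c \<and> c \<le> d \<and> d < a \<longrightarrow> absolutely_continuous_on_interval c d (derivative_at x))}"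

text \<open>
  For \<open>x \<in> class_A a\<close> the outer derivative exists only almost everywhere; on the exceptional null
  set the value below is an unspecified constant.
\<close>

definition prolate_M :: "real \<Rightarrow> (real \<Rightarrow> complex) \<Rightarrow> real \<Rightarrow> complex" where
  "prolate_M a x t =
     - derivative_at (\<lambda>s. complex_of_real (1 - s\<^sup>2 / a\<^sup>2) * derivative_at x s) t"

definition prolate_L :: "real \<Rightarrow> (real \<Rightarrow> complex) \<Rightarrow> real \<Rightarrow> complex" where
  "prolate_L a x t = prolate_M a x t + complex_of_real (t\<^sup>2) * x t"

definition domain_max :: "real \<Rightarrow> (real \<Rightarrow> complex) set" where
  "domain_max a = {x. x \<in> L2 {-a<..<a} \<and> x \<in> class_A a \<and> prolate_M a x \<in> L2 {-a<..<a}}"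

definition b_left :: "real \<Rightarrow> (real \<Rightarrow> complex) \<Rightarrow> complex" where
  "b_left a x = Lim (at_right (-a)) (\<lambda>t. complex_of_real (t + a) * derivative_at x t)"

definition b_right :: "real \<Rightarrow> (real \<Rightarrow> complex) \<Rightarrow> complex" where
  "b_right a x = Lim (at_left a) (\<lambda>t. complex_of_real (t - a) * derivative_at x t)"

definition c_left :: "real \<Rightarrow> (real \<Rightarrow> complex) \<Rightarrow> complex" where
  "c_left a x =
     Lim (at_right (-a)) (\<lambda>t. complex_of_real ((t + a) * ln (a + t)) * derivative_at x t - x t)"

definition c_right :: "real \<Rightarrow> (real \<Rightarrow> complex) \<Rightarrow> complex" where
  "c_right a x =
     Lim (at_left a) (\<lambda>t. complex_of_real ((t - a) * ln (a - t)) * derivative_at x t - x t)"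

text \<open>The domain of the restriction $\mathcal{L}_U$ of the maximal operator; it acts by
  \<open>prolate_L a\<close> for every \<open>U\<close>.\<close>

definition domain_U :: "real \<Rightarrow> complex^2^2 \<Rightarrow> (real \<Rightarrow> complex) set" where
  "domain_U a U = {x \<in> domain_max a.
     (1 + U$1$1) * b_left a x - \<i> * (1 - U$1$1) * c_left a x
       + U$1$2 * b_right a x + \<i> * U$1$2 * c_right a x = 0 \<and>
     U$2$1 * b_left a x + \<i> * U$2$1 * c_left a x
       + (1 + U$2$2) * b_right a x - \<i> * (1 - U$2$2) * c_right a x = 0}"

definition unitary_matrix :: "complex^'n^'n \<Rightarrow> bool" where
  "unitary_matrix U \<longleftrightarrow>
     map_matrix cnj (transpose U) ** U = mat 1 \<and> U ** map_matrix cnj (transpose U) = mat 1"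

text \<open>The first two conjuncts say that both sides of the commutation relation are defined.\<close>

definition commutes_with_fourier :: "real \<Rightarrow> complex^2^2 \<Rightarrow> bool" where
  "commutes_with_fourier a U \<longleftrightarrow>
     (\<forall>x\<in>domain_U a U.
        prolate_L a x \<in> L2 {-a..a} \<and>
        truncated_fourier a x \<in> domain_U a U \<and>
        eq_L2 {-a..a} (truncated_fourier a (prolate_L a x)) (prolate_L a (truncated_fourier a x)))"

end

(* The Lagrange bracket of x with the kernel exp(i s xi) shows that F L x - L F x is a boundary term,
   a nonzero multiple of exp(i s a) b_a(x) + exp(-i s a) b_{-a}(x): the multiplier produced by letting
   L act on the kernel is symmetric in s and xi. For U = I the boundary conditions say that both
   b-values vanish. For U different from I they admit x with nonzero b-values, and adding a smooth
   function that vanishes at both end points makes F x vanish there, which puts F x in the domain of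
   L_U; with the values of F x at the end points chosen differently, F x leaves the domain.
   The analytic input is that an absolutely continuous function is differentiable almost everywhere
   and is the integral of its derivative; both are proved with the Vitali covering theorem and
   Henstock's definition of the integral, without decomposing into monotone functions. *)

theory Submission
  imports Defs "HOL-Real_Asymp.Real_Asymp"
begin

section \<open>Absolutely continuous functions\<close>

text \<open>Prescribing the boundary data of \<open>x\<close> and the end point values of its
  transform independently is what makes the two constructions for U different from I possible. For
  square-integrable \<open>x\<close> the formula for F x is twice continuously differentiable on the
  whole line, so F x has b-values 0 and c-values equal to minus its values at -a and a. Hence F x
  lies in the domain of L_U exactly when I - U annihilates the vector of these two values, a void
  condition for U = I. The b- and c-values of \<open>x\<close> come from a combination of ln (a +
  t), ln (a - t) and a linear function. The obstacle for a general \<open>x\<close> is twofold: (1 -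
  t^2/a^2) x' is only absolutely continuous on compact subintervals, so its derivative exists merely
  almost everywhere, and \<open>x\<close> may grow logarithmically at the ends. The bracket is
  therefore integrated over compact subintervals first; its end point limits are then found from the
  integrability of M x, and the part containing \<open>x\<close> itself is removed by comparing a
  logarithm with the vanishing weight.\<close>

definition abs_cont_on :: "real \<Rightarrow> real \<Rightarrow> (real \<Rightarrow> 'a::real_normed_vector) \<Rightarrow> bool" where
  "abs_cont_on c d f \<longleftrightarrow>
     (\<forall>\<epsilon>>0. \<exists>\<delta>>0. \<forall>D T. D division_of T \<and> T \<subseteq> {c..d} \<and> (\<Sum>K\<in>D. Sup K - Inf K) < \<delta>
        \<longrightarrow> (\<Sum>K\<in>D. norm (f (Sup K) - f (Inf K))) < \<epsilon>)"

lemma absolutely_continuous_on_interval_iff: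
  "absolutely_continuous_on_interval c d f \<longleftrightarrow> abs_cont_on c d f"
  by (simp add: absolutely_continuous_on_interval_def abs_cont_on_def)

section \<open>Divisions of intervals, Vitali coverings and outer measure\<close>

lemma division_of_realD:
  fixes D :: "real set set"
  assumes "D division_of T" "K \<in> D"
  shows "Inf K \<le> Sup K" "K = {Inf K..Sup K}" "Inf K \<in> T" "Sup K \<in> T"
proof -
  obtain u v where uv: "K = cbox u v" "K \<noteq> {}" "K \<subseteq> T"
    using cbox_division_memE[OF assms(2,1)] by blast
  then have "u \<le> v" by (simp add: box_real)
  with uv show "Inf K \<le> Sup K" "K = {Inf K..Sup K}" "Inf K \<in> T" "Sup K \<in> T"
    by auto
qed

lemma division_sum_lengths:
  fixes D :: "real set set"
  assumes "D division_of T"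
  shows "measure lebesgue T = (\<Sum>K\<in>D. Sup K - Inf K)"
proof -
  have "measure lebesgue T = sum (measure lebesgue) D"
    using content_division[OF assms] by simp
  also have "\<dots> = (\<Sum>K\<in>D. Sup K - Inf K)"
  proof (rule sum.cong)
    fix K assume "K \<in> D"
    from division_of_realD(1,2)[OF assms this] show "measure lebesgue K = Sup K - Inf K"
      by (metis content_real measure_completion sets_lborel atLeastAtMost_borel)
  qed simp
  finally show ?thesis .
qed

text \<open>Tagging every interval by its left end point makes \<open>D\<close> a tagged division,
  for which the telescoping sum is known.\<close>

lemma division_telescope:
  fixes f :: "real \<Rightarrow> 'a::real_normed_vector"
  assumes "D division_of {u..v}" "u \<le> v"
  shows "(\<Sum>K\<in>D. f (Sup K) - f (Inf K)) = f v - f u"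
proof -
  let ?p = "(\<lambda>K. (Inf K, K)) ` D"
  have "?p tagged_division_of {u..v}"
    unfolding tagged_division_of
  proof (intro conjI allI impI)
    have "{K. \<exists>x. (x, K) \<in> ?p} = D" by auto
    then show "\<Union>{K. \<exists>x. (x, K) \<in> ?p} = {u..v}" using division_ofD(6)[OF assms(1)] by simp
  next
    fix x K assume "(x, K) \<in> ?p"
    then have K: "K \<in> D" "x = Inf K" by auto
    with division_of_realD[OF assms(1)] show "x \<in> K"
      by (metis atLeastAtMost_iff order_refl)
    from K division_ofD[OF assms(1)] show "K \<subseteq> {u..v}" "\<exists>a b. K = cbox a b" by auto
  next
    fix x1 K1 x2 K2 assume "(x1, K1) \<in> ?p \<and> (x2, K2) \<in> ?p \<and> (x1, K1) \<noteq> (x2, K2)"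
    then show "interior K1 \<inter> interior K2 = {}"
      using division_ofD(5)[OF assms(1), of K1 K2] by auto
  qed (use division_ofD(1)[OF assms(1)] in auto)
  from additive_tagged_division_1[OF assms(2) this, of f]
  show ?thesis
    by (subst (asm) sum.reindex) (auto simp: inj_on_def o_def)
qed

text \<open>The set \<open>E\<close> is not assumed measurable, so its size enters only through
  \<open>m\<close>, a lower bound for the measure of its measurable supersets. A disjoint Vitali
  family covers \<open>E\<close> up to a null set and so has measure at least \<open>m\<close>; a
  finite subfamily loses less than \<open>e\<close>. Openness of \<open>W\<close> leaves room for
  small intervals inside \<open>W\<close> around each point of \<open>E\<close>.\<close>

lemma Vitali_finite_division:
  fixes E W :: "real set"
  assumes "open W" "W \<in> lmeasurable" "E \<subseteq> W" "0 < e"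
    and m: "\<And>X. X \<in> lmeasurable \<Longrightarrow> E \<subseteq> X \<Longrightarrow> m \<le> measure lebesgue X"
    and P: "\<And>t d. t \<in> E \<Longrightarrow> 0 < d \<Longrightarrow> \<exists>u v. u < v \<and> t \<in> {u..v} \<and> v - u < d \<and> P {u..v}"
  obtains D where "D division_of \<Union>D" "\<Union>D \<subseteq> W" "\<And>K. K \<in> D \<Longrightarrow> P K"
    "\<And>K L. K \<in> D \<Longrightarrow> L \<in> D \<Longrightarrow> K \<noteq> L \<Longrightarrow> K \<inter> L = {}"
    "m - e < (\<Sum>K\<in>D. Sup K - Inf K)"
proof -
  define \<K> where "\<K> = {K. \<exists>u v. u < v \<and> K = {u..v} \<and> K \<subseteq> W \<and> P K}"
  \<comment> \<open>The covering theorem is stated for balls; on the line a closed interval is the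
    closed ball around its midpoint.\<close>
  define mid where "mid = (\<lambda>K::real set. (Inf K + Sup K) / 2)"
  define rad where "rad = (\<lambda>K::real set. (Sup K - Inf K) / 2)"
  have cb: "cball (mid K) (rad K) = K" and rad: "rad K > 0" if "K \<in> \<K>" for K
    using that by (auto simp: \<K>_def mid_def rad_def cball_eq_atLeastAtMost field_simps)
  have *: "\<exists>i. i \<in> \<K> \<and> x \<in> cball (mid i) (rad i) \<and> rad i < d" if xd: "x \<in> E" "0 < d" for x d
  proof -
    obtain r where r: "r > 0" "ball x r \<subseteq> W"
      using \<open>open W\<close> \<open>E \<subseteq> W\<close> xd unfolding open_contains_ball by blast
    then obtain u v where uv: "u < v" "x \<in> {u..v}" "v - u < min r d" "P {u..v}"
      using P[OF xd(1), of "min r d"] xd(2) by auto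
    then have "{u..v} \<subseteq> ball x r" by (auto simp: dist_real_def)
    with r uv have "{u..v} \<in> \<K>" by (auto simp: \<K>_def)
    moreover have "rad {u..v} < d" using uv by (simp add: rad_def)
    ultimately show ?thesis using cb uv by blast
  qed
  obtain C where C: "countable C" "C \<subseteq> \<K>"
     "pairwise (\<lambda>i j. disjnt (cball (mid i) (rad i)) (cball (mid j) (rad j))) C"
     "negligible (E - (\<Union>i\<in>C. cball (mid i) (rad i)))"
    by (rule Vitali_covering_theorem_cballs[OF rad *])
  have UC: "(\<Union>i\<in>C. cball (mid i) (rad i)) = \<Union>C"
    using cb C(2) by auto
  have disj: "K \<inter> L = {}" if "K \<in> C" "L \<in> C" "K \<noteq> L" for K L
    using pairwiseD[OF C(3) that] cb[OF subsetD[OF C(2) that(1)]] cb[OF subsetD[OF C(2) that(2)]]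
    by (simp add: disjnt_def)
  have CW: "\<Union>C \<subseteq> W" using C(2) by (auto simp: \<K>_def)
  have lm: "K \<in> lmeasurable" if "K \<in> C" for K
    using that C(2) by (auto simp: \<K>_def)
  have le: "measure lebesgue (\<Union>D') \<le> measure lebesgue W" if "D' \<subseteq> C" "finite D'" for D'
    using that CW lm assms(2)
    by (intro measure_mono_fmeasurable) (auto intro!: fmeasurableD fmeasurable.finite_Union)
  obtain D where D: "D \<subseteq> C" "finite D" "measure lebesgue (\<Union>C) - e < measure lebesgue (\<Union>D)"
    by (rule measure_countable_Union_approachable[OF C(1) \<open>0 < e\<close> lm le])
  have UCm: "\<Union>C \<in> lmeasurable"
    using assms(2) CW C(1) lm by (intro fmeasurableI2[OF assms(2)]) (auto intro!: sets.countable_Union)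
  have neg: "negligible (E - \<Union>C)" using C(4) UC by simp
  \<comment> \<open>Adding the uncovered null set turns the union of the family into a measurable
    superset of \<open>E\<close> without changing its measure.\<close>
  have "m \<le> measure lebesgue (\<Union>C \<union> (E - \<Union>C))"
    by (rule m) (use fmeasurable.Un[OF UCm negligible_imp_measurable[OF neg]] in auto)
  also have "\<dots> = measure lebesgue (\<Union>C)"
    using UCm neg
    by (intro measure_Un_null_set) (auto simp: negligible_iff_null_sets fmeasurableD)
  finally have "m - e < measure lebesgue (\<Union>D)" using D(3) by simp
  moreover have div: "D division_of \<Union>D"
  proof (rule division_ofI)
    fix K L assume "K \<in> D" "L \<in> D" "K \<noteq> L"
    then have "K \<inter> L = {}" using disj D(1) by blast
    then show "interior K \<inter> interior L = {}" using interior_subset by blast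
  next
    fix K assume "K \<in> D"
    then have "K \<in> \<K>" using D C by auto
    then show "K \<noteq> {}" "\<exists>a b. K = cbox a b" by (auto simp: \<K>_def)
  qed (use D in auto)
  ultimately have "m - e < (\<Sum>K\<in>D. Sup K - Inf K)"
    using division_sum_lengths by metis
  then show ?thesis
    using that[OF div] D(1) C(2) CW disj by (auto simp: \<K>_def subset_iff)
qed

text \<open>Inside each \<open>L\<close> of \<open>D1\<close> the members of \<open>D2\<close> are
  completed to a division of \<open>L\<close>, over which increments telescope to that of
  \<open>L\<close>. Disjointness as sets, not only of interiors, keeps these divisions from sharing
  a member, so the double sum splits. The quantifier over \<open>h\<close> allows one refinement to
  serve both for the increments of a function and for lengths.\<close>

lemma division_common_refinement:
  fixes D1 D2 :: "real set set"
  assumes D1: "D1 division_of \<Union>D1" and D2: "D2 division_of \<Union>D2"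
    and disj: "\<And>K L. K \<in> D1 \<Longrightarrow> L \<in> D1 \<Longrightarrow> K \<noteq> L \<Longrightarrow> K \<inter> L = {}"
    and sub: "\<And>K. K \<in> D2 \<Longrightarrow> \<exists>L\<in>D1. K \<subseteq> L"
  obtains R where "R division_of \<Union>D1" "D2 \<subseteq> R"
    "\<forall>h. (\<Sum>K\<in>R. h (Sup K) - h (Inf K) :: real) = (\<Sum>K\<in>D1. h (Sup K) - h (Inf K))"
proof -
  have ex: "\<exists>Q. {K\<in>D2. K \<subseteq> L} \<subseteq> Q \<and> Q division_of L" if L: "L \<in> D1" for L
  proof -
    have "{K\<in>D2. K \<subseteq> L} division_of \<Union>{K\<in>D2. K \<subseteq> L}"
      by (rule division_of_subset[OF D2]) auto
    moreover have "\<Union>{K\<in>D2. K \<subseteq> L} \<subseteq> cbox (Inf L) (Sup L)"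
      using division_of_realD(2)[OF D1 L] by auto
    ultimately obtain Q where "{K\<in>D2. K \<subseteq> L} \<subseteq> Q" "Q division_of cbox (Inf L) (Sup L)"
      by (rule partial_division_extend_interval)
    then show ?thesis using division_of_realD(2)[OF D1 L] by (metis box_real(2))
  qed
  then obtain Q where Q: "\<And>L. L \<in> D1 \<Longrightarrow> {K\<in>D2. K \<subseteq> L} \<subseteq> Q L"
    "\<And>L. L \<in> D1 \<Longrightarrow> Q L division_of L" by metis
  have disjQ: "Q L \<inter> Q L' = {}" if "L \<in> D1" "L' \<in> D1" "L \<noteq> L'" for L L'
    using disj[OF that] division_ofD(2,3)[OF Q(2)[OF that(1)]] division_ofD(2)[OF Q(2)[OF that(2)]]
    by (metis disjoint_iff le_inf_iff subset_empty)
  have "(\<Union>L\<in>D1. Q L) division_of \<Union>D1"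
  proof (rule division_ofI)
    show "finite (\<Union>L\<in>D1. Q L)" using D1 Q(2) by (auto dest: division_of_finite)
    fix K assume "K \<in> (\<Union>L\<in>D1. Q L)"
    then obtain L where L: "L \<in> D1" "K \<in> Q L" by auto
    with division_ofD(2,3,4)[OF Q(2)[OF L(1)] L(2)]
    show "K \<subseteq> \<Union>D1" "K \<noteq> {}" "\<exists>a b. K = cbox a b" by auto
    fix K' assume "K' \<in> (\<Union>L\<in>D1. Q L)" "K \<noteq> K'"
    then obtain L' where L': "L' \<in> D1" "K' \<in> Q L'" by auto
    show "interior K \<inter> interior K' = {}"
    proof (cases "L = L'")
      case True
      then show ?thesis using division_ofD(5)[OF Q(2)[OF L(1)] L(2)] L' \<open>K \<noteq> K'\<close> by auto
    next
      case False
      then have "K \<inter> K' = {}"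
        using disj[OF L(1) L'(1)] division_ofD(2)[OF Q(2)[OF L(1)] L(2)]
          division_ofD(2)[OF Q(2)[OF L'(1)] L'(2)] by blast
      then show ?thesis using interior_subset by blast
    qed
  next
    have "\<Union>(Q L) = L" if "L \<in> D1" for L using division_ofD(6)[OF Q(2)[OF that]] .
    then show "\<Union>(\<Union>L\<in>D1. Q L) = \<Union>D1" by blast
  qed
  moreover have "D2 \<subseteq> (\<Union>L\<in>D1. Q L)"
    using sub Q(1) by blast
  moreover have "(\<Sum>K\<in>(\<Union>L\<in>D1. Q L). h (Sup K) - h (Inf K)) = (\<Sum>K\<in>D1. h (Sup K) - h (Inf K))"
    for h :: "real \<Rightarrow> real"
  proof -
    have "(\<Sum>K\<in>(\<Union>L\<in>D1. Q L). h (Sup K) - h (Inf K))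
        = (\<Sum>L\<in>D1. \<Sum>K\<in>Q L. h (Sup K) - h (Inf K))"
      using D1 Q(2) disjQ by (intro sum.UNION_disjoint) (auto dest: division_of_finite)
    also have "\<dots> = (\<Sum>K\<in>D1. h (Sup K) - h (Inf K))"
    proof (rule sum.cong)
      fix L assume L: "L \<in> D1"
      note dr = division_of_realD(1,2)[OF D1 L]
      have "Q L division_of {Inf L..Sup L}" using Q(2)[OF L] dr by simp
      from division_telescope[OF this dr(1)]
      show "(\<Sum>K\<in>Q L. h (Sup K) - h (Inf K)) = h (Sup L) - h (Inf L)" .
    qed simp
    finally show ?thesis .
  qed
  ultimately show ?thesis using that by blast
qed

text \<open>The number \<open>m\<close> is the outer Lebesgue measure of \<open>E\<close>, taken as
  an infimum over measurable supersets. Positivity is the negation of negligibility, and outer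
  regularity lets an open set compete for the infimum.\<close>

lemma outer_measure_open_approx:
  fixes E :: "real set"
  assumes "E \<subseteq> {c<..<d}" "\<not> negligible E"
  obtains m where "0 < m" "\<And>X. X \<in> lmeasurable \<Longrightarrow> E \<subseteq> X \<Longrightarrow> m \<le> measure lebesgue X"
    "\<And>e. 0 < e \<Longrightarrow> \<exists>U. open U \<and> U \<in> lmeasurable \<and> E \<subseteq> U \<and> U \<subseteq> {c<..<d} \<and> measure lebesgue U < m + e"
proof -
  define M where "M = measure lebesgue ` {X \<in> lmeasurable. E \<subseteq> X}"
  have ne: "M \<noteq> {}"
    using assms(1) by (auto simp: M_def intro!: exI[of _ "{c<..<d}"])
  have bdd: "bdd_below M" by (auto simp: M_def intro!: bdd_belowI[of _ 0])
  have low: "Inf M \<le> measure lebesgue X" if "X \<in> lmeasurable" "E \<subseteq> X" for X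
    using that by (intro cInf_lower bdd) (auto simp: M_def)
  have approx: "\<exists>X \<in> lmeasurable. E \<subseteq> X \<and> measure lebesgue X < Inf M + e" if "0 < e" for e
    using cInf_lessD[OF ne, of "Inf M + e"] that by (auto simp: M_def)
  have "Inf M \<ge> 0" using ne by (intro cInf_greatest) (auto simp: M_def)
  moreover have "Inf M \<noteq> 0"
    using approx assms(2) unfolding negligible_outer by fastforce
  ultimately have "0 < Inf M" by simp
  moreover have "\<exists>U. open U \<and> U \<in> lmeasurable \<and> E \<subseteq> U \<and> U \<subseteq> {c<..<d} \<and> measure lebesgue U < Inf M + e"
    if e: "0 < e" for e
  proof -
    obtain X where X: "X \<in> lmeasurable" "E \<subseteq> X" "measure lebesgue X < Inf M + e / 2"
      using approx[of "e/2"] e by auto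
    obtain T where T: "open T" "X \<subseteq> T" "T - X \<in> lmeasurable" "emeasure lebesgue (T - X) < ennreal (e / 2)"
      using sets_lebesgue_outer_open[of X "e/2"] X(1) e by (auto simp: fmeasurableD)
    have "measure lebesgue (T - X) < e / 2"
      using T(3,4) e by (simp add: emeasure_eq_measure2 ennreal_less_iff)
    moreover have Tm: "T \<in> lmeasurable"
      using fmeasurable.Un[OF X(1) T(3)] T(2) by (simp add: Un_absorb1)
    moreover have "measure lebesgue T \<le> measure lebesgue X + measure lebesgue (T - X)"
      using measure_Un_le[of X lebesgue "T - X"] X(1) T(2,3) by (simp add: Un_absorb1 fmeasurableD)
    moreover have Im: "T \<inter> {c<..<d} \<in> lmeasurable"
      using Tm by (auto intro: fmeasurable.Int)
    moreover have "measure lebesgue (T \<inter> {c<..<d}) \<le> measure lebesgue T"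
      using Tm Im by (intro measure_mono_fmeasurable) (auto simp: fmeasurableD)
    ultimately have "measure lebesgue (T \<inter> {c<..<d}) < Inf M + e" using X(3) by linarith
    with Im T(1,2) X(2) assms(1) show ?thesis
      by (intro exI[of _ "T \<inter> {c<..<d}"]) auto
  qed
  ultimately show ?thesis using that low by blast
qed

section \<open>Almost everywhere differentiability\<close>

lemma abs_cont_onE:
  assumes "abs_cont_on c d f" "0 < e"
  obtains \<delta> where "0 < \<delta>" "\<And>D. D division_of \<Union>D \<Longrightarrow> \<Union>D \<subseteq> {c..d} \<Longrightarrow>
     (\<Sum>K\<in>D. Sup K - Inf K) < \<delta> \<Longrightarrow> (\<Sum>K\<in>D. norm (f (Sup K) - f (Inf K))) < e"
  using assms unfolding abs_cont_on_def by meson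

text \<open>Steep intervals of fixed total length would have a large total increment. Absolute
  continuity controls only families of total length below \<delta>, so the claim is proved locally,
  within balls of radius \<delta> / 4, whose subfamilies are automatically short enough; local
  negligibility then suffices.\<close>

lemma negligible_infinite_derivate:
  fixes f :: "real \<Rightarrow> real"
  assumes ac: "abs_cont_on c d f" and E: "E \<subseteq> {c<..<d}"
    and big: "\<And>t r N. t \<in> E \<Longrightarrow> 0 < r \<Longrightarrow>
      \<exists>u v. u < v \<and> t \<in> {u..v} \<and> v - u < r \<and> N * (v - u) \<le> \<bar>f v - f u\<bar>"
  shows "negligible E"
proof -
  obtain \<delta> where \<delta>: "0 < \<delta>" "\<And>D. D division_of \<Union>D \<Longrightarrow> \<Union>D \<subseteq> {c..d} \<Longrightarrow>
     (\<Sum>K\<in>D. Sup K - Inf K) < \<delta> \<Longrightarrow> (\<Sum>K\<in>D. norm (f (Sup K) - f (Inf K))) < 1"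
    by (rule abs_cont_onE[OF ac zero_less_one]) blast
  have local: "negligible (E \<inter> ball x (\<delta> / 4))" for x
  proof (rule ccontr)
    assume neg: "\<not> negligible (E \<inter> ball x (\<delta> / 4))"
    define c' where "c' = max c (x - \<delta> / 4)"
    define d' where "d' = min d (x + \<delta> / 4)"
    have sub: "E \<inter> ball x (\<delta> / 4) \<subseteq> {c'<..<d'}"
    proof
      fix y assume y: "y \<in> E \<inter> ball x (\<delta> / 4)"
      then have "c < y" "y < d" using E by auto
      moreover have "\<bar>x - y\<bar> < \<delta> / 4" using y by (simp add: dist_real_def)
      then have "x - \<delta> / 4 < y" "y < x + \<delta> / 4" by linarith+
      ultimately show "y \<in> {c'<..<d'}" by (simp add: c'_def d'_def)
    qed
    obtain m where m: "0 < m" "\<And>X. X \<in> lmeasurable \<Longrightarrow> E \<inter> ball x (\<delta> / 4) \<subseteq> X \<Longrightarrow> m \<le> measure lebesgue X"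
      by (rule outer_measure_open_approx[OF sub neg]) blast
    \<comment> \<open>The Vitali family will have total length above m / 2, so slope 2 / m forces a
      total increment above 1, the bound used for \<delta>.\<close>
    define P where "P K \<longleftrightarrow> 2 / m * (Sup K - Inf K) \<le> \<bar>f (Sup K) - f (Inf K)\<bar>" for K
    have 1: "open {c'<..<d'}" "{c'<..<d'} \<in> lmeasurable" "0 < m / 2" using m(1) by auto
    have 2: "\<exists>u v. u < v \<and> t \<in> {u..v} \<and> v - u < r \<and> P {u..v}"
      if t: "t \<in> E \<inter> ball x (\<delta> / 4)" and r: "0 < r" for t r
    proof -
      obtain u v where "u < v" "t \<in> {u..v}" "v - u < r" "2 / m * (v - u) \<le> \<bar>f v - f u\<bar>"
        using big[of t r "2 / m"] t r by auto
      then show ?thesis by (intro exI[of _ u] exI[of _ v]) (auto simp: P_def)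
    qed
    obtain D where D: "D division_of \<Union>D" "\<Union>D \<subseteq> {c'<..<d'}" "\<And>K. K \<in> D \<Longrightarrow> P K"
      "m - m / 2 < (\<Sum>K\<in>D. Sup K - Inf K)"
      by (rule Vitali_finite_division[OF 1(1,2) sub 1(3) m(2) 2]; (assumption | (rule that; blast)))
    have "(\<Sum>K\<in>D. Sup K - Inf K) = measure lebesgue (\<Union>D)"
      using division_sum_lengths[OF D(1)] by simp
    also have "\<dots> \<le> measure lebesgue {c'<..<d'}"
      using D(1,2) lmeasurable_division[OF D(1)] by (intro measure_mono_fmeasurable) (auto simp: fmeasurableD)
    also have "\<dots> < \<delta>"
      using \<delta>(1) by (cases "c' \<le> d'") (auto simp: c'_def d'_def)
    finally have "(\<Sum>K\<in>D. norm (f (Sup K) - f (Inf K))) < 1"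
      using D(2) by (intro \<delta>(2)[OF D(1)]) (auto simp: subset_iff c'_def d'_def)
    moreover have "(\<Sum>K\<in>D. norm (f (Sup K) - f (Inf K))) \<ge> (\<Sum>K\<in>D. 2 / m * (Sup K - Inf K))"
      using D(3) by (intro sum_mono) (auto simp: P_def)
    moreover have "(\<Sum>K\<in>D. 2 / m * (Sup K - Inf K)) = 2 / m * (\<Sum>K\<in>D. Sup K - Inf K)"
      by (simp add: sum_distrib_left)
    moreover have "2 / m * (\<Sum>K\<in>D. Sup K - Inf K) > 2 / m * (m - m / 2)"
      using D(4) m(1) by (intro mult_strict_left_mono) auto
    moreover have "2 / m * (m - m / 2) = 1" using m(1) by (simp add: field_simps)
    ultimately show False by linarith
  qed
  show ?thesis
  proof (subst locally_negligible_alt, intro ballI)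
    fix x assume "x \<in> E"
    then show "\<exists>U. openin (top_of_set E) U \<and> x \<in> U \<and> negligible U"
      using local[of x] \<delta>(1)
      by (intro exI[of _ "E \<inter> ball x (\<delta> / 4)"]) (auto simp: openin_open_Int)
  qed
qed

text \<open>Cover \<open>E\<close> up to small measure by disjoint intervals with slope at most \<open>p\<close>, and then,
  inside these, by disjoint intervals with slope at least \<open>q\<close>. The gaps between the two families
  have small total length, so absolute continuity makes the two total increments almost equal.\<close>

lemma negligible_derivate_gap:
  fixes f :: "real \<Rightarrow> real"
  assumes ac: "abs_cont_on c d f" and E: "E \<subseteq> {c<..<d}" and "p < q"
    and lo: "\<And>t r. t \<in> E \<Longrightarrow> 0 < r \<Longrightarrow>
      \<exists>u v. u < v \<and> t \<in> {u..v} \<and> v - u < r \<and> f v - f u \<le> p * (v - u)"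
    and hi: "\<And>t r. t \<in> E \<Longrightarrow> 0 < r \<Longrightarrow>
      \<exists>u v. u < v \<and> t \<in> {u..v} \<and> v - u < r \<and> q * (v - u) \<le> f v - f u"
  shows "negligible E"
proof (rule ccontr)
  assume neg: "\<not> negligible E"
  obtain m where m: "0 < m" "\<And>X. X \<in> lmeasurable \<Longrightarrow> E \<subseteq> X \<Longrightarrow> m \<le> measure lebesgue X"
    "\<And>e. 0 < e \<Longrightarrow> \<exists>U. open U \<and> U \<in> lmeasurable \<and> E \<subseteq> U \<and> U \<subseteq> {c<..<d} \<and> measure lebesgue U < m + e"
    by (rule outer_measure_open_approx[OF E neg]) blast
  define h where "h K = f (Sup K) - f (Inf K)" for K
  define len where "len K = Sup K - Inf K" for K :: "real set"
  have qpm: "(q - p) * m > 0" using \<open>p < q\<close> m(1) by simp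
  then have "0 < (q - p) * m / 3" by simp
  then obtain \<delta>0 where \<delta>0: "0 < \<delta>0" "\<And>D. D division_of \<Union>D \<Longrightarrow> \<Union>D \<subseteq> {c..d} \<Longrightarrow>
     (\<Sum>K\<in>D. Sup K - Inf K) < \<delta>0 \<Longrightarrow> (\<Sum>K\<in>D. norm (f (Sup K) - f (Inf K))) < (q - p) * m / 3"
    by (rule abs_cont_onE[OF ac]) blast
  \<comment> \<open>The gaps will have total length below 4 * \<delta>, which must stay under
    \<delta>0. Replacing the two total lengths by \<open>m\<close> costs at most \<bar>p\<bar> *
    \<delta> and \<bar>q\<bar> * (3 * \<delta>); the second bound keeps the sum within a third of (q
    - p) * m. The summand 1 keeps the denominator positive.\<close>
  define \<delta> where "\<delta> = min (\<delta>0 / 5) ((q - p) * m / (9 * (\<bar>p\<bar> + \<bar>q\<bar> + 1)))"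
  have \<delta>: "0 < \<delta>" "4 * \<delta> < \<delta>0" using \<delta>0(1) qpm by (auto simp: \<delta>_def intro!: divide_pos_pos)
  have "\<delta> \<le> (q - p) * m / (9 * (\<bar>p\<bar> + \<bar>q\<bar> + 1))" by (simp add: \<delta>_def)
  then have \<delta>3: "3 * \<delta> * (\<bar>p\<bar> + \<bar>q\<bar> + 1) \<le> (q - p) * m / 3"
    by (subst (asm) pos_le_divide_eq) (auto simp: algebra_simps)
  obtain U where U: "open U" "U \<in> lmeasurable" "E \<subseteq> U" "U \<subseteq> {c<..<d}" "measure lebesgue U < m + \<delta>"
    using m(3)[OF \<delta>(1)] by blast
  have lo': "\<exists>u v. u < v \<and> t \<in> {u..v} \<and> v - u < r \<and> h {u..v} \<le> p * len {u..v}"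
    if t: "t \<in> E" and r: "0 < r" for t r
  proof -
    obtain u v where "u < v" "t \<in> {u..v}" "v - u < r" "f v - f u \<le> p * (v - u)"
      using lo[OF t r] by auto
    then show ?thesis by (intro exI[of _ u] exI[of _ v]) (auto simp: h_def len_def)
  qed
  obtain D1 where D1: "D1 division_of \<Union>D1" "\<Union>D1 \<subseteq> U" "\<And>K. K \<in> D1 \<Longrightarrow> h K \<le> p * len K"
    "\<And>K L. K \<in> D1 \<Longrightarrow> L \<in> D1 \<Longrightarrow> K \<noteq> L \<Longrightarrow> K \<inter> L = {}" "m - \<delta> < (\<Sum>K\<in>D1. Sup K - Inf K)"
    by (rule Vitali_finite_division[OF U(1,2,3) \<delta>(1) m(2) lo']; (assumption | (rule that; blast)))
  \<comment> \<open>Passing to interiors drops only finitely many points and gives every remaining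
    point of \<open>E\<close> room for steep intervals inside a single member of
    \<open>D1\<close>.\<close>
  define W where "W = (\<Union>L\<in>D1. interior L)"
  have finD1: "finite D1" using D1(1) by auto
  have WU: "W \<subseteq> U" using D1(2) interior_subset by (auto simp: W_def)
  have "open W" unfolding W_def by blast
  then have W: "open W" "W \<in> lmeasurable"
    using fmeasurableI2[OF U(2) WU] borel_open[of W] by (auto intro: sets_completionI_sets)
  have D1W: "\<Union>D1 \<subseteq> W \<union> (Inf ` D1 \<union> Sup ` D1)"
  proof
    fix x assume "x \<in> \<Union>D1"
    then obtain L where L: "L \<in> D1" "x \<in> L" by auto
    then show "x \<in> W \<union> (Inf ` D1 \<union> Sup ` D1)"
      using division_of_realD(2)[OF D1(1) L(1)]
      by (metis (no_types, lifting) UN_I UnCI W_def atLeastAtMost_iff greaterThanLessThan_iff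
          image_eqI interior_atLeastAtMost_real order_le_imp_less_or_eq)
  qed
  have nul: "Inf ` D1 \<union> Sup ` D1 \<in> null_sets lebesgue"
    using finD1 by (metis finite_Un finite_imageI negligible_finite negligible_iff_null_sets)
  have "measure lebesgue (\<Union>D1) \<le> measure lebesgue (W \<union> (Inf ` D1 \<union> Sup ` D1))"
    using lmeasurable_division[OF D1(1)] W(2) nul
    by (intro measure_mono_fmeasurable D1W)
       (auto intro!: fmeasurable.Un[OF _ fmeasurableI_null_sets[OF nul]] simp: fmeasurableD)
  also have "\<dots> = measure lebesgue W"
    using W(2) nul by (intro measure_Un_null_set) (auto simp: fmeasurableD)
  finally have mW: "m - \<delta> < measure lebesgue W"
    using D1(5) division_sum_lengths[OF D1(1)] by simp
  \<comment> \<open>\<open>E \<inter> W\<close> is still large: any measurable cover of it becomes a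
    cover of \<open>E\<close> after adding \<open>U - W\<close>, which has measure below 2 *
    \<delta>.\<close>
  have low: "m - 2 * \<delta> \<le> measure lebesgue X" if X: "X \<in> lmeasurable" "E \<inter> W \<subseteq> X" for X
  proof -
    have UW: "U - W \<in> lmeasurable" using U(2) W(2) by (auto intro: fmeasurable_Diff fmeasurableD)
    have "m \<le> measure lebesgue (X \<union> (U - W))"
      using X U(3) UW by (intro m(2)) (auto intro!: fmeasurable.Un)
    also have "\<dots> \<le> measure lebesgue X + measure lebesgue (U - W)"
      using X UW by (intro measure_Un_le) (auto simp: fmeasurableD)
    also have "measure lebesgue (U - W) = measure lebesgue U - measure lebesgue W"
      using U(2) W(2) WU by (intro measurable_measure_Diff) (auto simp: fmeasurableD)
    finally show ?thesis using U(5) mW by linarith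
  qed
  define P where "P K \<longleftrightarrow> (\<exists>L\<in>D1. K \<subseteq> L) \<and> q * len K \<le> h K" for K
  have hi': "\<exists>u v. u < v \<and> t \<in> {u..v} \<and> v - u < r \<and> P {u..v}"
    if t: "t \<in> E \<inter> W" and r: "0 < r" for t r
  proof -
    obtain L where L: "L \<in> D1" "t \<in> interior L" using t by (auto simp: W_def)
    then obtain s where s: "s > 0" "ball t s \<subseteq> L"
      by (meson mem_interior)
    obtain u v where uv: "u < v" "t \<in> {u..v}" "v - u < min r s" "q * (v - u) \<le> f v - f u"
      using hi[of t "min r s"] t r s by auto
    then have "{u..v} \<subseteq> ball t s" by (auto simp: dist_real_def)
    with uv s L show ?thesis
      by (intro exI[of _ u] exI[of _ v]) (auto simp: P_def h_def len_def)
  qed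
  obtain D2 where D2: "D2 division_of \<Union>D2" "\<And>K. K \<in> D2 \<Longrightarrow> P K"
    "m - 2 * \<delta> - \<delta> < (\<Sum>K\<in>D2. Sup K - Inf K)"
    by (rule Vitali_finite_division[OF W Int_lower2 \<delta>(1) low hi']; (assumption | (rule that; blast)))
  have sub: "\<exists>L\<in>D1. K \<subseteq> L" if "K \<in> D2" for K
    using D2(2)[OF that] by (simp add: P_def)
  obtain R where R: "R division_of \<Union>D1" "D2 \<subseteq> R"
    "\<forall>h. (\<Sum>K\<in>R. h (Sup K) - h (Inf K) :: real) = (\<Sum>K\<in>D1. h (Sup K) - h (Inf K))"
    by (rule division_common_refinement[OF D1(1) D2(1) D1(4) sub]; (assumption | (rule that; assumption)))
  have finR: "finite R" using R(1) by auto
  have "R division_of \<Union>R" using R(1) division_ofD(6)[OF R(1)] by simp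
  then have divG: "R - D2 division_of \<Union>(R - D2)"
    by (rule division_of_subset) blast
  have "\<Union>(R - D2) \<subseteq> {c..d}"
  proof -
    have "\<Union>(R - D2) \<subseteq> \<Union>R" by blast
    also have "\<dots> \<subseteq> {c<..<d}" using division_ofD(6)[OF R(1)] D1(2) U(4) by simp
    finally show ?thesis by fastforce
  qed
  note AC = \<delta>0(2)[OF divG this]
  \<comment> \<open>The refinement has the same total increment as \<open>D1\<close>, so the
    discrepancy between the families is carried entirely by \<open>R - D2\<close>.\<close>
  have hsum: "sum h (R - D2) = sum h D1 - sum h D2"
    using R(2) R(3)[rule_format, of f] finR by (simp add: sum_diff h_def finite_subset)
  have lsum: "sum len (R - D2) = sum len D1 - sum len D2"
    using R(2) R(3)[rule_format, of "\<lambda>x. x"] finR by (simp add: sum_diff len_def finite_subset)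
  have S1: "m - \<delta> < sum len D1" "sum len D1 < m + \<delta>"
  proof -
    show "m - \<delta> < sum len D1" using D1(5) by (simp add: len_def)
    have "measure lebesgue (\<Union>D1) \<le> measure lebesgue U"
      using lmeasurable_division[OF D1(1)] U(2) D1(2)
      by (intro measure_mono_fmeasurable) (auto simp: fmeasurableD)
    then show "sum len D1 < m + \<delta>"
      using division_sum_lengths[OF D1(1)] U(5) by (simp add: len_def)
  qed
  have "sum len (R - D2) \<ge> 0"
    using division_of_realD(1)[OF divG] by (intro sum_nonneg) (simp add: len_def)
  then have S2: "m - 3 * \<delta> < sum len D2" "sum len D2 < m + \<delta>"
    using D2(3) S1 lsum by (auto simp: len_def)
  have "sum len (R - D2) < \<delta>0" using lsum S1 S2 \<delta> by linarith
  then have "(\<Sum>K\<in>R - D2. \<bar>h K\<bar>) < (q - p) * m / 3"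
    using AC by (simp add: len_def h_def)
  then have "\<bar>sum h (R - D2)\<bar> < (q - p) * m / 3"
    using sum_abs[of h "R - D2"] by linarith
  then have "sum h D2 - sum h D1 < (q - p) * m / 3" using hsum by linarith
  moreover have "sum h D1 \<le> p * sum len D1"
    using D1(3) by (auto simp: sum_distrib_left intro!: sum_mono)
  moreover have "q * sum len D2 \<le> sum h D2"
    using D2(2) by (auto simp: sum_distrib_left P_def intro!: sum_mono)
  moreover have "p * sum len D1 \<le> p * m + \<bar>p\<bar> * \<delta>"
  proof -
    have "p * (sum len D1 - m) \<le> \<bar>p\<bar> * \<bar>sum len D1 - m\<bar>" by (metis abs_ge_self abs_mult)
    also have "\<dots> \<le> \<bar>p\<bar> * \<delta>" using S1 by (intro mult_left_mono) auto
    finally show ?thesis by (simp add: algebra_simps)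
  qed
  moreover have "q * m - \<bar>q\<bar> * (3 * \<delta>) \<le> q * sum len D2"
  proof -
    have "q * (m - sum len D2) \<le> \<bar>q\<bar> * \<bar>m - sum len D2\<bar>" by (metis abs_ge_self abs_mult)
    also have "\<dots> \<le> \<bar>q\<bar> * (3 * \<delta>)" using S2 \<delta>(1) by (intro mult_left_mono) auto
    finally show ?thesis by (simp add: algebra_simps)
  qed
  ultimately have "q * m - p * m < (q - p) * m / 3 + \<bar>p\<bar> * \<delta> + \<bar>q\<bar> * (3 * \<delta>)" by linarith
  also have "\<dots> \<le> (q - p) * m / 3 + 3 * \<delta> * (\<bar>p\<bar> + \<bar>q\<bar> + 1)"
    using \<delta>(1) mult_nonneg_nonneg[of "\<bar>p\<bar>" \<delta>] by (simp add: distrib_left)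
  also have "\<dots> \<le> 2 / 3 * ((q - p) * m)" using \<delta>3 by linarith
  also have "\<dots> < (q - p) * m" using qpm by linarith
  finally show False by (simp add: algebra_simps)
qed

text \<open>At a point without derivative either the slopes of small intervals around it are
  unbounded, or the lower and upper limits of the difference quotient are separated by two
  rationals. The first set is negligible, and the second is a countable union of negligible
  sets.\<close>

lemma abs_cont_on_real_ae_differentiable:
  fixes f :: "real \<Rightarrow> real"
  assumes ac: "abs_cont_on c d f"
  shows "negligible {t \<in> {c<..<d}. \<not> f differentiable (at t)}"
proof -
  define Lo where "Lo t p \<longleftrightarrow> (\<forall>r>0. \<exists>u v. u < v \<and> t \<in> {u..v} \<and> v - u < r \<and> f v - f u \<le> p * (v - u))" for t p
  define Hi where "Hi t q \<longleftrightarrow> (\<forall>r>0. \<exists>u v. u < v \<and> t \<in> {u..v} \<and> v - u < r \<and> q * (v - u) \<le> f v - f u)" for t q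
  define Einf where "Einf = {t \<in> {c<..<d}. \<forall>r>0. \<forall>N. \<exists>u v. u < v \<and> t \<in> {u..v} \<and> v - u < r \<and>
     N * (v - u) \<le> \<bar>f v - f u\<bar>}"
  define E where "E p q = {t \<in> {c<..<d}. Lo t p \<and> Hi t q}" for p q
  have "negligible Einf"
    by (rule negligible_infinite_derivate[OF ac]) (auto simp: Einf_def)
  moreover have "negligible (E p q)" if "p < q" for p q
    by (rule negligible_derivate_gap[OF ac _ that]) (auto simp: E_def Lo_def Hi_def)
  then have "negligible (\<Union>(p, q)\<in>{(p, q). p \<in> \<rat> \<and> q \<in> \<rat> \<and> p < q}. E p q)"
  proof (intro negligible_countable_Union)
    have "countable {(p::real, q::real). p \<in> \<rat> \<and> q \<in> \<rat> \<and> p < q}"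
      by (rule countable_subset[of _ "\<rat> \<times> \<rat>"]) (auto intro: countable_rat)
    then show "countable ((\<lambda>(p, q). E p q) ` {(p, q). p \<in> \<rat> \<and> q \<in> \<rat> \<and> p < q})"
      by (rule countable_image)
  qed auto
  moreover have "{t \<in> {c<..<d}. \<not> f differentiable (at t)} \<subseteq>
      Einf \<union> (\<Union>(p, q)\<in>{(p, q). p \<in> \<rat> \<and> q \<in> \<rat> \<and> p < q}. E p q)"
  proof (rule subsetI, rule ccontr)
    fix t assume t: "t \<in> {t \<in> {c<..<d}. \<not> f differentiable (at t)}"
      and nt: "t \<notin> Einf \<union> (\<Union>(p, q)\<in>{(p, q). p \<in> \<rat> \<and> q \<in> \<rat> \<and> p < q}. E p q)"
    define Q where "Q h = (f (t + h) - f t) / h" for h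
    \<comment> \<open>The increment \<open>h\<close> may have either sign, so \<open>t\<close>
      becomes the left or the right end of the interval; this is why \<open>Lo\<close> and
      \<open>Hi\<close> admit all intervals containing \<open>t\<close>.\<close>
    have LoI: "Lo t p" if fr: "\<not> eventually (\<lambda>h. p \<le> Q h) (at 0)" for p
      unfolding Lo_def
    proof (intro allI impI)
      fix r :: real assume "0 < r"
      then obtain h where h: "h \<noteq> 0" "\<bar>h\<bar> < r" "Q h < p"
        using fr by (force simp: eventually_at dist_real_def not_le)
      show "\<exists>u v. u < v \<and> t \<in> {u..v} \<and> v - u < r \<and> f v - f u \<le> p * (v - u)"
      proof (cases "h > 0")
        case True
        with h show ?thesis by (intro exI[of _ t] exI[of _ "t + h"]) (auto simp: Q_def field_simps)
      next
        case False
        with h show ?thesis by (intro exI[of _ "t + h"] exI[of _ t]) (auto simp: Q_def field_simps)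
      qed
    qed
    have HiI: "Hi t q" if fr: "\<not> eventually (\<lambda>h. Q h \<le> q) (at 0)" for q
      unfolding Hi_def
    proof (intro allI impI)
      fix r :: real assume "0 < r"
      then obtain h where h: "h \<noteq> 0" "\<bar>h\<bar> < r" "Q h > q"
        using fr by (force simp: eventually_at dist_real_def not_le)
      show "\<exists>u v. u < v \<and> t \<in> {u..v} \<and> v - u < r \<and> q * (v - u) \<le> f v - f u"
      proof (cases "h > 0")
        case True
        with h show ?thesis by (intro exI[of _ t] exI[of _ "t + h"]) (auto simp: Q_def field_simps)
      next
        case False
        with h show ?thesis by (intro exI[of _ "t + h"] exI[of _ t]) (auto simp: Q_def field_simps)
      qed
    qed
    \<comment> \<open>Extended real limits always exist; their equality is shown first, and their
      finiteness separately from the bound on slopes outside \<open>Einf\<close>.\<close>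
    let ?l = "Liminf (at 0) (\<lambda>h. ereal (Q h))" and ?u = "Limsup (at 0) (\<lambda>h. ereal (Q h))"
    have "?u \<le> ?l"
    proof (rule ccontr)
      assume "\<not> ?u \<le> ?l"
      then have "?l < ?u" by simp
      then obtain p' where p': "?l < ereal p'" "ereal p' < ?u" using ereal_dense2 by blast
      then obtain q' where q': "ereal p' < ereal q'" "ereal q' < ?u" using ereal_dense2 by blast
      then obtain p where p: "p \<in> \<rat>" "p' < p" "p < q'" using Rats_dense_in_real by auto
      then obtain q where q: "q \<in> \<rat>" "p < q" "q < q'" using Rats_dense_in_real by auto
      have "\<not> eventually (\<lambda>h. p \<le> Q h) (at 0)"
      proof
        assume "eventually (\<lambda>h. p \<le> Q h) (at 0)"
        then have "ereal p \<le> ?l" by (intro Liminf_bounded) simp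
        then show False using p' p by (meson ereal_less_le less_ereal.simps(1) not_le order_less_trans)
      qed
      moreover have "\<not> eventually (\<lambda>h. Q h \<le> q) (at 0)"
      proof
        assume "eventually (\<lambda>h. Q h \<le> q) (at 0)"
        then have "?u \<le> ereal q" by (intro Limsup_bounded) simp
        then show False using q' q by (meson ereal_less_le less_ereal.simps(1) not_le order_less_trans)
      qed
      ultimately have "t \<in> E p q" using t LoI HiI by (auto simp: E_def)
      with nt p q show False by auto
    qed
    then have lu: "?l = ?u" using Liminf_le_Limsup[of "at (0::real)" "\<lambda>h. ereal (Q h)"] by simp
    obtain r N where r: "r > 0" and nex: "\<not> (\<exists>u v. u < v \<and> t \<in> {u..v} \<and> v - u < r \<and> N * (v - u) \<le> \<bar>f v - f u\<bar>)"
      using nt t unfolding Einf_def by blast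
    have rN: "r > 0" "\<And>u v. u < v \<Longrightarrow> t \<in> {u..v} \<Longrightarrow> v - u < r \<Longrightarrow> \<bar>f v - f u\<bar> < N * (v - u)"
      using r nex by (meson not_le)+
    have QN: "\<bar>Q h\<bar> \<le> N" if "h \<noteq> 0" "\<bar>h\<bar> < r" for h
    proof (cases "h > 0")
      case True
      with rN(2)[of t "t + h"] that show ?thesis by (auto simp: Q_def abs_divide field_simps)
    next
      case False
      with rN(2)[of "t + h" t] that show ?thesis by (auto simp: Q_def abs_divide field_simps abs_minus_commute)
    qed
    have ev: "eventually (\<lambda>h. \<bar>Q h\<bar> \<le> N) (at 0)"
      using rN(1) QN by (auto simp: eventually_at dist_real_def intro!: exI[of _ r])
    have "?u \<le> ereal N" using ev by (intro Limsup_bounded) (auto elim: eventually_mono)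
    moreover have "ereal (- N) \<le> ?l" using ev by (intro Liminf_bounded) (auto elim: eventually_mono)
    ultimately obtain L where L: "?u = ereal L" using lu by (cases ?u) auto
    then have "((\<lambda>h. ereal (Q h)) \<longlongrightarrow> ereal L) (at 0)"
      using lu by (subst tendsto_iff_Liminf_eq_Limsup) auto
    then have "(Q \<longlongrightarrow> L) (at 0)" by simp
    then have "(f has_real_derivative L) (at t)" by (simp add: DERIV_def Q_def[abs_def])
    then have "f differentiable (at t)"
      by (meson differentiable_def has_field_derivative_def)
    with t show False by auto
  qed
  ultimately show ?thesis by (meson negligible_Un negligible_subset)
qed

text \<open>One estimate covers all later closure properties: real and imaginary parts, products,
  differences and Lipschitz functions are obtained by suitable choices of \<open>f\<close>,
  \<open>g\<close> and \<open>B\<close>. Dividing by B + 1 instead of \<open>B\<close> admits B =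
  0.\<close>

lemma abs_cont_on_dominated:
  assumes f: "abs_cont_on c d f" and g: "abs_cont_on c d g" and "0 \<le> B"
    and le: "\<And>u v. u \<in> {c..d} \<Longrightarrow> v \<in> {c..d} \<Longrightarrow>
      norm (h u - h v) \<le> B * (norm (f u - f v) + norm (g u - g v))"
  shows "abs_cont_on c d h"
  unfolding abs_cont_on_def
proof (intro allI impI)
  fix e :: real assume "0 < e"
  then have e: "0 < e / (2 * (B + 1))" using \<open>0 \<le> B\<close> by simp
  obtain \<delta>1 where \<delta>1: "\<delta>1 > 0" "\<And>D. D division_of \<Union>D \<Longrightarrow> \<Union>D \<subseteq> {c..d} \<Longrightarrow> (\<Sum>K\<in>D. Sup K - Inf K) < \<delta>1
        \<Longrightarrow> (\<Sum>K\<in>D. norm (f (Sup K) - f (Inf K))) < e / (2 * (B + 1))"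
    by (rule abs_cont_onE[OF f e]) blast
  obtain \<delta>2 where \<delta>2: "\<delta>2 > 0" "\<And>D. D division_of \<Union>D \<Longrightarrow> \<Union>D \<subseteq> {c..d} \<Longrightarrow> (\<Sum>K\<in>D. Sup K - Inf K) < \<delta>2
        \<Longrightarrow> (\<Sum>K\<in>D. norm (g (Sup K) - g (Inf K))) < e / (2 * (B + 1))"
    by (rule abs_cont_onE[OF g e]) blast
  have "(\<Sum>K\<in>D. norm (h (Sup K) - h (Inf K))) < e"
    if D: "D division_of T" "T \<subseteq> {c..d}" "(\<Sum>K\<in>D. Sup K - Inf K) < min \<delta>1 \<delta>2" for D T
  proof -
    have T: "T = \<Union>D" using division_ofD(6)[OF D(1)] by simp
    let ?S = "(\<Sum>K\<in>D. norm (f (Sup K) - f (Inf K))) + (\<Sum>K\<in>D. norm (g (Sup K) - g (Inf K)))"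
    have "?S < e / (2 * (B + 1)) + e / (2 * (B + 1))"
      using D by (intro add_strict_mono \<delta>1(2) \<delta>2(2)) (auto simp: T)
    then have "(B + 1) * ?S < (B + 1) * (e / (2 * (B + 1)) + e / (2 * (B + 1)))"
      using \<open>0 \<le> B\<close> by (intro mult_strict_left_mono) auto
    moreover have "b * (e / (2 * b) + e / (2 * b)) = e" if "0 < b" for b :: real
      using that by simp
    from this[of "B + 1"] have "(B + 1) * (e / (2 * (B + 1)) + e / (2 * (B + 1))) = e"
      using \<open>0 \<le> B\<close> by simp
    moreover have "B * ?S \<le> (B + 1) * ?S"
      by (intro mult_right_mono add_nonneg_nonneg sum_nonneg) auto
    moreover have "(\<Sum>K\<in>D. norm (h (Sup K) - h (Inf K)))
        \<le> (\<Sum>K\<in>D. B * (norm (f (Sup K) - f (Inf K)) + norm (g (Sup K) - g (Inf K))))"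
      using division_of_realD(3,4)[OF D(1)] D(2) by (intro sum_mono le) blast+
    moreover have "\<dots> = B * ?S" by (simp only: sum.distrib[symmetric] sum_distrib_left)
    ultimately show ?thesis by linarith
  qed
  then show "\<exists>\<delta>>0. \<forall>D T. D division_of T \<and> T \<subseteq> {c..d} \<and> (\<Sum>K\<in>D. Sup K - Inf K) < \<delta>
        \<longrightarrow> (\<Sum>K\<in>D. norm (h (Sup K) - h (Inf K))) < e"
    using \<delta>1(1) \<delta>2(1) by (intro exI[of _ "min \<delta>1 \<delta>2"]) auto
qed

lemma abs_cont_on_ae_differentiable:
  fixes f :: "real \<Rightarrow> complex"
  assumes ac: "abs_cont_on c d f"
  shows "negligible {t \<in> {c<..<d}. \<not> f differentiable (at t)}"
proof (rule negligible_subset)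
  let ?N = "\<lambda>g :: real \<Rightarrow> real. {t \<in> {c<..<d}. \<not> g differentiable (at t)}"
  show "negligible (?N (\<lambda>t. Re (f t)) \<union> ?N (\<lambda>t. Im (f t)))"
  proof (rule negligible_Un; rule abs_cont_on_real_ae_differentiable; rule abs_cont_on_dominated[OF ac ac zero_le_one])
    show "norm (Re (f u) - Re (f v)) \<le> 1 * (norm (f u - f v) + norm (f u - f v))" for u v
      using abs_Re_le_cmod[of "f u - f v"] by simp
    show "norm (Im (f u) - Im (f v)) \<le> 1 * (norm (f u - f v) + norm (f u - f v))" for u v
      using abs_Im_le_cmod[of "f u - f v"] by simp
  qed
  have "f differentiable (at t)"
    if RI: "(\<lambda>t. Re (f t)) differentiable (at t)" "(\<lambda>t. Im (f t)) differentiable (at t)" for t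
  proof -
    have *: "f = (\<lambda>t. complex_of_real (Re (f t)) + \<i> * complex_of_real (Im (f t)))"
      by (simp add: complex_eq fun_eq_iff)
    obtain A where A: "((\<lambda>t. Re (f t)) has_vector_derivative A) (at t)"
      using RI(1) vector_derivative_works by blast
    obtain B where B: "((\<lambda>t. Im (f t)) has_vector_derivative B) (at t)"
      using RI(2) vector_derivative_works by blast
    have "((\<lambda>t. complex_of_real (Re (f t)) + \<i> * complex_of_real (Im (f t)))
        has_vector_derivative (complex_of_real A + \<i> * complex_of_real B)) (at t)"
      using A B by (auto intro!: derivative_intros has_vector_derivative_of_real
          simp: has_real_derivative_iff_has_vector_derivative)
    then show ?thesis using * by (metis differentiableI_vector)
  qed
  then show "{t \<in> {c<..<d}. \<not> f differentiable (at t)} \<subseteq> ?N (\<lambda>t. Re (f t)) \<union> ?N (\<lambda>t. Im (f t))"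
    by auto
qed

section \<open>The fundamental theorem of calculus and closure properties\<close>

text \<open>The gauge treats two kinds of tags. At a tag with a derivative it makes the
  linearization error at most \<epsilon> times the length. At an exceptional tag it keeps the
  interval inside an open set of measure below \<delta>, so absolute continuity bounds the sum of
  these increments. Both contributions stay below e / 2.\<close>

lemma abs_cont_on_FTC:
  fixes f :: "real \<Rightarrow> 'a::real_normed_vector"
  assumes ac: "abs_cont_on c d f" and "c \<le> d" and N: "negligible N"
    and der: "\<And>t. t \<in> {c<..<d} - N \<Longrightarrow> (f has_vector_derivative f' t) (at t)"
  shows "(f' has_integral (f d - f c)) {c..d}"
proof -
  \<comment> \<open>The end points join the exceptional set because the derivative is assumed only
    inside; on this set \<open>g\<close> is 0, so these tags contribute nothing to the Riemann
    sum.\<close>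
  define N' where "N' = N \<union> {c, d}"
  have N': "negligible N'" using N by (simp add: N'_def)
  define g where "g t = (if t \<in> N' then 0 else f' t)" for t
  have "(g has_integral (f d - f c)) {c..d}"
    unfolding has_integral_real
  proof (intro allI impI)
    fix e :: real assume e: "0 < e"
    then have "0 < e / 2" by simp
    then obtain \<delta> where \<delta>: "0 < \<delta>" "\<And>D. D division_of \<Union>D \<Longrightarrow> \<Union>D \<subseteq> {c..d} \<Longrightarrow>
       (\<Sum>K\<in>D. Sup K - Inf K) < \<delta> \<Longrightarrow> (\<Sum>K\<in>D. norm (f (Sup K) - f (Inf K))) < e / 2"
      by (rule abs_cont_onE[OF ac]) blast
    obtain U where U: "open U" "N' \<subseteq> U" "U - N' \<in> lmeasurable" "emeasure lebesgue (U - N') < ennreal \<delta>"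
      using sets_lebesgue_outer_open[OF negligible_imp_sets[OF N'] \<delta>(1)] by metis
    have mUN: "measure lebesgue (U - N') < \<delta>"
      using U(3,4) \<delta>(1) by (simp add: emeasure_eq_measure2 ennreal_less_iff)
    have UU: "U = (U - N') \<union> N'" using U(2) by auto
    have Um: "U \<in> lmeasurable"
      by (subst UU) (intro fmeasurable.Un U(3) negligible_imp_measurable N')
    have mU: "measure lebesgue U < \<delta>"
      using mUN by (subst UU, subst measure_Un_null_set)
        (use U(3) N' in \<open>auto simp: negligible_iff_null_sets fmeasurableD\<close>)
    define \<epsilon> where "\<epsilon> = e / (2 * (d - c + 1))"
    have \<epsilon>: "0 < \<epsilon>" using e \<open>c \<le> d\<close> by (auto simp: \<epsilon>_def intro!: divide_pos_pos)
    have "\<epsilon> * (d - c) < e / 2"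
      using e \<open>c \<le> d\<close> by (simp add: \<epsilon>_def field_simps)
    have ex1: "\<exists>r>0. \<forall>s. \<bar>s - t\<bar> < r \<longrightarrow> norm (f s - f t - (s - t) *\<^sub>R f' t) \<le> \<epsilon> * \<bar>s - t\<bar>"
      if "t \<in> {c..d} - N'" for t
    proof -
      have "(f has_derivative (\<lambda>h. h *\<^sub>R f' t)) (at t)"
        using der[of t] that by (auto simp: N'_def has_vector_derivative_def)
      then show ?thesis
        using \<epsilon> unfolding has_derivative_at_alt by auto
    qed
    have ex2: "\<exists>r>0. ball t r \<subseteq> U" if "t \<in> N'" for t
      using U(1,2) that by (meson open_contains_ball subsetD)
    have "\<exists>r>0. (t \<in> N' \<longrightarrow> ball t r \<subseteq> U) \<and> (t \<in> {c..d} - N' \<longrightarrow>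
        (\<forall>s. \<bar>s - t\<bar> < r \<longrightarrow> norm (f s - f t - (s - t) *\<^sub>R f' t) \<le> \<epsilon> * \<bar>s - t\<bar>))" for t
      using ex1[of t] ex2[of t] by (cases "t \<in> N'"; cases "t \<in> {c..d}") (auto intro: zero_less_one)
    then obtain r where r: "\<And>t. r t > 0" "\<And>t. t \<in> N' \<Longrightarrow> ball t (r t) \<subseteq> U"
      "\<And>t s. t \<in> {c..d} - N' \<Longrightarrow> \<bar>s - t\<bar> < r t \<Longrightarrow> norm (f s - f t - (s - t) *\<^sub>R f' t) \<le> \<epsilon> * \<bar>s - t\<bar>"
      by metis
    show "\<exists>\<gamma>. gauge \<gamma> \<and> (\<forall>D. D tagged_division_of {c..d} \<and> \<gamma> fine D \<longrightarrow>
       norm ((\<Sum>(x, K)\<in>D. measure lborel K *\<^sub>R g x) - (f d - f c)) < e)"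
    proof (intro exI conjI allI impI; (elim conjE)?)
      show "gauge (\<lambda>t. ball t (r t))" using r(1) by (simp add: gauge_def)
      fix D assume D: "D tagged_division_of {c..d}" and fine: "(\<lambda>t. ball t (r t)) fine D"
      have finD: "finite D" using D by auto
      have KD: "K = {Inf K..Sup K}" "Inf K \<le> x" "x \<le> Sup K" "measure lborel K = Sup K - Inf K"
        "x \<in> {c..d}" "Sup K \<in> ball x (r x)" "Inf K \<in> ball x (r x)" "K \<subseteq> {c..d}" "K \<subseteq> ball x (r x)" "x \<in> K"
        if xK: "(x, K) \<in> D" for x K
      proof -
        obtain u v where uv: "K = cbox u v" using tagged_division_ofD(4)[OF D xK] by blast
        show x: "x \<in> K" "K \<subseteq> {c..d}" using tagged_division_ofD(2,3)[OF D xK] by auto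
        with uv show "K = {Inf K..Sup K}" "Inf K \<le> x" "x \<le> Sup K" "measure lborel K = Sup K - Inf K"
            "x \<in> {c..d}" by auto
        show "K \<subseteq> ball x (r x)" using fine xK by (auto simp: fine_def)
        moreover have "Sup K \<in> K" "Inf K \<in> K" using uv x by auto
        ultimately show "Sup K \<in> ball x (r x)" "Inf K \<in> ball x (r x)" by blast+
      qed
      define D1 where "D1 = {p \<in> D. fst p \<notin> N'}"
      define D2 where "D2 = {p \<in> D. fst p \<in> N'}"
      have D12: "D = D1 \<union> D2" "D1 \<inter> D2 = {}" "finite D1" "finite D2"
        using finD by (auto simp: D1_def D2_def)
      let ?h = "\<lambda>(x, K). measure lborel K *\<^sub>R g x - (f (Sup K) - f (Inf K))"
      have "(\<Sum>(x, K)\<in>D. measure lborel K *\<^sub>R g x) - (f d - f c) = sum ?h D"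
        by (subst additive_tagged_division_1[OF \<open>c \<le> d\<close> D, of f, symmetric])
           (simp add: sum_subtractf[symmetric] split_def)
      also have "\<dots> = sum ?h D1 + sum ?h D2"
        using D12 by (simp add: sum.union_disjoint)
      finally have eq: "(\<Sum>(x, K)\<in>D. measure lborel K *\<^sub>R g x) - (f d - f c) = sum ?h D1 + sum ?h D2" .
      have "norm (sum ?h D1) \<le> (\<Sum>(x, K)\<in>D1. \<epsilon> * (Sup K - Inf K))"
      proof (rule sum_norm_le, clarsimp)
        fix x K assume "(x, K) \<in> D1"
        then have xK: "(x, K) \<in> D" "x \<notin> N'" by (auto simp: D1_def)
        note k = KD[OF xK(1)]
        have 1: "norm (f (Sup K) - f x - (Sup K - x) *\<^sub>R f' x) \<le> \<epsilon> * (Sup K - x)"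
          using r(3)[of x "Sup K"] xK k by (auto simp: dist_real_def)
        have 2: "norm (f (Inf K) - f x - (Inf K - x) *\<^sub>R f' x) \<le> \<epsilon> * (x - Inf K)"
          using r(3)[of x "Inf K"] xK k by (auto simp: dist_real_def)
        have "measure lborel K *\<^sub>R g x - (f (Sup K) - f (Inf K)) =
           (f (Inf K) - f x - (Inf K - x) *\<^sub>R f' x) - (f (Sup K) - f x - (Sup K - x) *\<^sub>R f' x)"
          using xK by (simp add: g_def k(4) scaleR_diff_left)
        then have "norm (measure lborel K *\<^sub>R g x - (f (Sup K) - f (Inf K))) \<le>
            \<epsilon> * (x - Inf K) + \<epsilon> * (Sup K - x)"
          using 1 2 norm_triangle_ineq4 by (smt (verit))
        then show "norm (measure lborel K *\<^sub>R g x - (f (Sup K) - f (Inf K))) \<le> \<epsilon> * (Sup K - Inf K)"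
          by (simp add: algebra_simps)
      qed
      also have "\<dots> \<le> (\<Sum>(x, K)\<in>D. \<epsilon> * (Sup K - Inf K))"
      proof (rule sum_mono2[OF finD])
        show "D1 \<subseteq> D" by (auto simp: D1_def)
        fix p assume "p \<in> D - D1"
        then obtain x K where "p = (x, K)" "(x, K) \<in> D" by (cases p) auto
        then show "0 \<le> (case p of (x, K) \<Rightarrow> \<epsilon> * (Sup K - Inf K))" using \<epsilon> KD(2,3)[of x K] by simp
      qed
      also have "\<dots> = \<epsilon> * (d - c)"
        using additive_tagged_division_1[OF \<open>c \<le> d\<close> D, of "\<lambda>x. x"]
        by (simp add: sum_distrib_left[symmetric] split_def)
      also have "\<dots> < e / 2" by fact
      finally have first: "norm (sum ?h D1) < e / 2" .
      have "D tagged_partial_division_of {c..d}"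
        using D unfolding tagged_division_of_def by blast
      then have "D2 tagged_partial_division_of {c..d}"
        by (rule tagged_partial_division_subset) (auto simp: D2_def)
      then have D2u: "D2 tagged_division_of \<Union>(snd ` D2)" by (rule tagged_partial_division_of_Union_self)
      then have D2d: "snd ` D2 division_of \<Union>(snd ` D2)" by (rule division_of_tagged_division)
      \<comment> \<open>Passing from tagged pairs to intervals requires a function that vanishes on
        every closed interval with empty interior, the empty set included, where \<open>Sup\<close>
        and \<open>Inf\<close> carry no information.\<close>
      define \<nu> where "\<nu> K = (if K = {} then 0 else norm (f (Sup K) - f (Inf K)))" for K
      have ne: "K \<noteq> {}" if "(x, K) \<in> D" for x K using KD(10)[OF that] by auto
      have "norm (sum ?h D2) \<le> (\<Sum>(x, K)\<in>D2. \<nu> K)"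
        using ne by (intro sum_norm_le) (auto simp: D2_def g_def \<nu>_def norm_minus_commute)
      also have "\<dots> = sum \<nu> (snd ` D2)"
        by (rule sum.over_tagged_division_lemma[OF D2u]) (auto simp: \<nu>_def)
      also have "\<dots> = (\<Sum>K\<in>snd ` D2. norm (f (Sup K) - f (Inf K)))"
        using ne by (intro sum.cong) (auto simp: \<nu>_def D2_def)
      also have "\<dots> < e / 2"
      proof (rule \<delta>(2)[OF D2d])
        have "K \<subseteq> {c..d} \<inter> U" if K: "K \<in> snd ` D2" for K
        proof -
          obtain x where "(x, K) \<in> D" "x \<in> N'" using K by (auto simp: D2_def)
          then show ?thesis using KD(8,9)[of x K] r(2)[of x] by blast
        qed
        then have sub: "\<Union>(snd ` D2) \<subseteq> {c..d}" "\<Union>(snd ` D2) \<subseteq> U" by blast+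
        show "\<Union>(snd ` D2) \<subseteq> {c..d}" by fact
        have "(\<Sum>K\<in>snd ` D2. Sup K - Inf K) = measure lebesgue (\<Union>(snd ` D2))"
          using division_sum_lengths[OF D2d] by simp
        also have "\<dots> \<le> measure lebesgue U"
          using lmeasurable_division[OF D2d] Um sub by (intro measure_mono_fmeasurable) (auto simp: fmeasurableD)
        finally show "(\<Sum>K\<in>snd ` D2. Sup K - Inf K) < \<delta>" using mU by linarith
      qed
      finally have "norm (sum ?h D2) < e / 2" .
      with first eq show "norm ((\<Sum>(x, K)\<in>D. measure lborel K *\<^sub>R g x) - (f d - f c)) < e"
        using norm_triangle_ineq[of "sum ?h D1" "sum ?h D2"] by simp
    qed
  qed
  then show ?thesis
    by (rule has_integral_spike[OF N', rotated]) (auto simp: g_def)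
qed

lemma abs_cont_on_imp_continuous_on:
  fixes f :: "real \<Rightarrow> 'a::real_normed_vector"
  assumes "abs_cont_on c d f"
  shows "continuous_on {c..d} f"
  unfolding continuous_on_iff
proof (intro ballI allI impI)
  fix t e :: real assume t: "t \<in> {c..d}" and e: "0 < e"
  obtain \<delta> where \<delta>: "0 < \<delta>" "\<And>D. D division_of \<Union>D \<Longrightarrow> \<Union>D \<subseteq> {c..d} \<Longrightarrow>
     (\<Sum>K\<in>D. Sup K - Inf K) < \<delta> \<Longrightarrow> (\<Sum>K\<in>D. norm (f (Sup K) - f (Inf K))) < e"
    by (rule abs_cont_onE[OF assms e]) blast
  have *: "norm (f v - f u) < e" if "u \<in> {c..d}" "v \<in> {c..d}" "u \<le> v" "v - u < \<delta>" for u v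
  proof -
    have "{{u..v}} division_of \<Union>{{u..v}}"
      using division_of_self[of u v] that by simp
    from \<delta>(2)[OF this] that show ?thesis by auto
  qed
  show "\<exists>\<delta>>0. \<forall>s\<in>{c..d}. dist s t < \<delta> \<longrightarrow> dist (f s) (f t) < e"
  proof (intro exI[of _ \<delta>] conjI ballI impI \<delta>(1))
    fix s assume s: "s \<in> {c..d}" "dist s t < \<delta>"
    show "dist (f s) (f t) < e"
      using *[of s t] *[of t s] s t by (cases "s \<le> t") (auto simp: dist_norm norm_minus_commute)
  qed
qed

lemma abs_cont_on_Lipschitz:
  fixes f :: "real \<Rightarrow> 'a::real_normed_vector"
  assumes "\<And>u v. u \<in> {c..d} \<Longrightarrow> v \<in> {c..d} \<Longrightarrow> norm (f u - f v) \<le> B * \<bar>u - v\<bar>" "0 \<le> B"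
  shows "abs_cont_on c d f"
proof -
  have id: "abs_cont_on c d (\<lambda>x::real. x)"
    unfolding abs_cont_on_def
  proof (intro allI impI)
    fix e :: real assume "0 < e"
    then show "\<exists>\<delta>>0. \<forall>D T. D division_of T \<and> T \<subseteq> {c..d} \<and> (\<Sum>K\<in>D. Sup K - Inf K) < \<delta>
        \<longrightarrow> (\<Sum>K\<in>D. norm (Sup K - Inf K)) < e"
      by (intro exI[of _ e]) (auto simp: abs_of_nonneg division_of_realD(1) cong: sum.cong)
  qed
  have "norm (f u - f v) \<le> B * (norm (u - v) + norm (u - v))" if "u \<in> {c..d}" "v \<in> {c..d}" for u v
  proof -
    have "B * \<bar>u - v\<bar> \<le> B * (norm (u - v) + norm (u - v))"
      using assms(2) by (intro mult_left_mono) auto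
    with assms(1)[OF that] show ?thesis by linarith
  qed
  then show ?thesis by (rule abs_cont_on_dominated[OF id id assms(2)])
qed

lemma abs_cont_on_bounded_derivative:
  fixes f :: "real \<Rightarrow> 'a::real_normed_vector"
  assumes "\<And>t. t \<in> {c..d} \<Longrightarrow> (f has_vector_derivative f' t) (at t within {c..d})"
    and "continuous_on {c..d} f'"
  shows "abs_cont_on c d f"
proof -
  have "bounded (f' ` {c..d})"
    using assms(2) by (intro compact_imp_bounded compact_continuous_image) auto
  then obtain B where B: "0 < B" "\<And>t. t \<in> {c..d} \<Longrightarrow> norm (f' t) \<le> B"
    by (auto simp: bounded_pos)
  have "norm (f u - f v) \<le> B * norm (u - v)" if "u \<in> {c..d}" "v \<in> {c..d}" for u v
  proof (rule differentiable_bound[OF _ _ _ that])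
    show "(f has_derivative (\<lambda>h. h *\<^sub>R f' t)) (at t within {c..d})" if "t \<in> {c..d}" for t
      using assms(1)[OF that] by (simp add: has_vector_derivative_def)
    show "onorm (\<lambda>h. h *\<^sub>R f' t) \<le> B" if "t \<in> {c..d}" for t
      using B(2)[OF that] B(1) by (intro onorm_bound) (auto intro: mult_left_mono simp: mult.commute[of B])
  qed simp
  then show ?thesis using B(1) by (intro abs_cont_on_Lipschitz[of c d f B]) auto
qed

lemma abs_cont_on_mult:
  fixes f g :: "real \<Rightarrow> 'a::real_normed_algebra"
  assumes f: "abs_cont_on c d f" and g: "abs_cont_on c d g"
  shows "abs_cont_on c d (\<lambda>t. f t * g t)"
proof -
  have bdd: "bounded (f ` {c..d})" "bounded (g ` {c..d})"
    using abs_cont_on_imp_continuous_on[OF f] abs_cont_on_imp_continuous_on[OF g]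
    by (auto intro!: compact_imp_bounded compact_continuous_image)
  obtain B1 B2 where B: "0 < B1" "\<And>t. t \<in> {c..d} \<Longrightarrow> norm (f t) \<le> B1"
    "0 < B2" "\<And>t. t \<in> {c..d} \<Longrightarrow> norm (g t) \<le> B2"
    using bdd by (auto simp: bounded_pos)
  show ?thesis
  proof (rule abs_cont_on_dominated[OF f g, of "B1 + B2"])
    fix u v assume uv: "u \<in> {c..d}" "v \<in> {c..d}"
    have "f u * g u - f v * g v = f u * (g u - g v) + (f u - f v) * g v"
      by (simp add: algebra_simps)
    then have "norm (f u * g u - f v * g v) \<le> norm (f u) * norm (g u - g v) + norm (f u - f v) * norm (g v)"
      by (metis norm_triangle_le add_mono norm_mult_ineq)
    also have "\<dots> \<le> B1 * norm (g u - g v) + norm (f u - f v) * B2"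
      using B uv by (intro add_mono mult_mono) auto
    also have "\<dots> \<le> (B1 + B2) * (norm (f u - f v) + norm (g u - g v))"
      using B by (simp add: algebra_simps)
    finally show "norm (f u * g u - f v * g v) \<le> (B1 + B2) * (norm (f u - f v) + norm (g u - g v))" .
  qed (use B in auto)
qed

lemma abs_cont_on_diff:
  assumes "abs_cont_on c d f" "abs_cont_on c d g"
  shows "abs_cont_on c d (\<lambda>t. f t - g t)"
proof (rule abs_cont_on_dominated[OF assms zero_le_one])
  show "norm (f u - g u - (f v - g v)) \<le> 1 * (norm (f u - f v) + norm (g u - g v))" for u v
    using norm_triangle_ineq4[of "f u - f v" "g u - g v"] by (simp add: algebra_simps)
qed

text \<open>On a set of finite measure \<bar>z\<bar> \<le> 1 + \<bar>z\<bar>^2 bounds the function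
  by an integrable one.\<close>

lemma L2_absolutely_integrable:
  assumes "x \<in> L2 S" "S \<in> lmeasurable"
  shows "x absolutely_integrable_on S"
proof -
  have S: "S \<in> sets lebesgue" using assms(2) by (rule fmeasurableD)
  have x: "x \<in> borel_measurable (lebesgue_on S)" "integrable (lebesgue_on S) (\<lambda>t. (cmod (x t))\<^sup>2)"
    using assms(1) by (auto simp: L2_def)
  interpret finite_measure "lebesgue_on S" using assms(2) by (rule finite_measure_lebesgue_on)
  have "integrable (lebesgue_on S) (\<lambda>t. 1 + (cmod (x t))\<^sup>2)"
    using x(2) by (intro Bochner_Integration.integrable_add) auto
  then have "integrable (lebesgue_on S) x"
  proof (rule Bochner_Integration.integrable_bound)
    have "cmod z \<le> 1 + (cmod z)\<^sup>2" for z
      using sum_squares_ge_zero[of "cmod z - 1" 0] by (cases "cmod z \<le> 1") (auto simp: power2_eq_square algebra_simps intro: add_increasing2 mult_left_le_one_le)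
    then show "AE t in lebesgue_on S. norm (x t) \<le> norm (1 + (cmod (x t))\<^sup>2)"
      by (auto simp: abs_of_nonneg)
  qed (use x in auto)
  then show ?thesis
    using S by (simp add: integrable_restrict_space set_integrable_def)
qed

lemma L2_cong:
  assumes "\<And>t. t \<in> S \<Longrightarrow> x t = y t"
  shows "x \<in> L2 S \<longleftrightarrow> y \<in> L2 S"
proof -
  have "x \<in> borel_measurable (lebesgue_on S) \<longleftrightarrow> y \<in> borel_measurable (lebesgue_on S)"
    using assms by (intro measurable_cong) simp
  moreover have "integrable (lebesgue_on S) (\<lambda>t. (cmod (x t))\<^sup>2) \<longleftrightarrow>
      integrable (lebesgue_on S) (\<lambda>t. (cmod (y t))\<^sup>2)"
    using assms by (intro Bochner_Integration.integrable_cong) auto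
  ultimately show ?thesis by (simp add: L2_def)
qed

lemma L2I_bound:
  assumes "x \<in> borel_measurable (lebesgue_on S)" "S \<in> sets lebesgue"
    and "g integrable_on S" "\<And>t. t \<in> S \<Longrightarrow> (cmod (x t))\<^sup>2 \<le> g t"
  shows "x \<in> L2 S"
proof -
  have "(\<lambda>t. (cmod (x t))\<^sup>2) absolutely_integrable_on S"
    using assms by (intro measurable_bounded_by_integrable_imp_absolutely_integrable) auto
  then show ?thesis
    using assms(1,2) by (simp add: L2_def integrable_restrict_space set_integrable_def)
qed

lemma continuous_on_imp_L2:
  assumes "continuous_on {c..d} x"
  shows "x \<in> L2 {c<..<d}" "x \<in> L2 {c..d}"
proof -
  have int: "(\<lambda>t. (cmod (x t))\<^sup>2) integrable_on {c..d}"
    using assms by (intro integrable_continuous_real continuous_intros)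
  then show "x \<in> L2 {c..d}"
    using assms by (intro L2I_bound[of _ _ "\<lambda>t. (cmod (x t))\<^sup>2"] continuous_imp_measurable_on_sets_lebesgue) auto
  have "(\<lambda>t. (cmod (x t))\<^sup>2) integrable_on {c<..<d}"
    using int by (simp add: integrable_on_open_interval_real)
  moreover have "continuous_on {c<..<d} x"
    by (rule continuous_on_subset[OF assms]) auto
  ultimately show "x \<in> L2 {c<..<d}"
    by (intro L2I_bound[of _ _ "\<lambda>t. (cmod (x t))\<^sup>2"] continuous_imp_measurable_on_sets_lebesgue) auto
qed

section \<open>Limits at the end points\<close>

text \<open>The indefinite integral of \<open>H\<close> is continuous up to the end points, and
  \<open>W\<close> differs from it by a constant inside. The conclusion speaks of limits, not of
  values of \<open>W\<close>: \<open>flux\<close>, for instance, takes the value 0 at both ends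
  whatever its limits are.\<close>

lemma primitive_endpoint_limits:
  fixes W H :: "real \<Rightarrow> complex"
  assumes H: "H integrable_on {-a..a}" and a: "0 < a"
    and W: "\<And>c d. -a < c \<Longrightarrow> c \<le> d \<Longrightarrow> d < a \<Longrightarrow> (H has_integral W d - W c) {c..d}"
  obtains l r where "(W \<longlongrightarrow> l) (at_right (-a))" "(W \<longlongrightarrow> r) (at_left a)"
    "integral {-a..a} H = r - l"
proof -
  define I where "I u = integral {-a..u} H" for u
  have cont: "continuous_on {-a..a} I"
    unfolding I_def by (rule indefinite_integral_continuous_1[OF H])
  have key: "W d = I d + (W 0 - I 0)" if d: "d \<in> {-a<..<a}" for d
  proof -
    have split: "I v - I u = integral {u..v} H" if "-a < u" "u \<le> v" "v < a" for u v
    proof -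
      have "H integrable_on {-a..v}" using H that by (intro integrable_on_subinterval[OF H]) auto
      from Henstock_Kurzweil_Integration.integral_combine[OF _ that(2) this] that
      show ?thesis by (simp add: I_def algebra_simps)
    qed
    show ?thesis
    proof (cases "0 \<le> d")
      case True
      then show ?thesis using split[of 0 d] W[of 0 d] d a by (simp add: integral_unique algebra_simps)
    next
      case False
      then show ?thesis using split[of d 0] W[of d 0] d a by (simp add: integral_unique algebra_simps)
    qed
  qed
  have "(I \<longlongrightarrow> I (-a)) (at (-a) within {-a..a})"
    using cont a by (simp add: continuous_on_def)
  then have "(I \<longlongrightarrow> I (-a)) (at_right (-a))"
    using at_within_Icc_at_right[of "-a" a] a by simp
  then have "((\<lambda>d. I d + (W 0 - I 0)) \<longlongrightarrow> I (-a) + (W 0 - I 0)) (at_right (-a))"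
    by (intro tendsto_intros)
  moreover have "eventually (\<lambda>d. W d = I d + (W 0 - I 0)) (at_right (-a))"
    using eventually_at_right_real[of "-a" a] a by (auto elim!: eventually_mono intro: key)
  ultimately have l: "(W \<longlongrightarrow> I (-a) + (W 0 - I 0)) (at_right (-a))"
    by (simp add: tendsto_cong)
  have "(I \<longlongrightarrow> I a) (at a within {-a..a})"
    using cont a by (simp add: continuous_on_def)
  then have "(I \<longlongrightarrow> I a) (at_left a)"
    using at_within_Icc_at_left[of "-a" a] a by simp
  then have "((\<lambda>d. I d + (W 0 - I 0)) \<longlongrightarrow> I a + (W 0 - I 0)) (at_left a)"
    by (intro tendsto_intros)
  moreover have "eventually (\<lambda>d. W d = I d + (W 0 - I 0)) (at_left a)"
    using eventually_at_left_real[of "-a" a] a by (auto elim!: eventually_mono intro: key)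
  ultimately have r: "(W \<longlongrightarrow> I a + (W 0 - I 0)) (at_left a)"
    by (simp add: tendsto_cong)
  show ?thesis by (rule that[OF l r]) (simp add: I_def)
qed

text \<open>A derivative of order 1 / (a - t) integrates to growth of at most logarithmic order,
  which the factor a - t annihilates because u * ln u tends to 0.\<close>

lemma log_growth_left:
  fixes x x' :: "real \<Rightarrow> complex"
  assumes "t0 < a" and x: "\<And>t. t \<in> {t0..<a} \<Longrightarrow> (x has_vector_derivative x' t) (at t)"
    and C: "\<And>t. t \<in> {t0..<a} \<Longrightarrow> (a - t) * cmod (x' t) \<le> C"
  shows "((\<lambda>t. of_real (a - t) * x t) \<longlongrightarrow> 0) (at_left a)"
proof -
  let ?b = "\<lambda>t. (a - t) * (cmod (x t0) + C * (ln (a - t0) - ln (a - t)))"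
  have bound: "cmod (of_real (a - t) * x t) \<le> ?b t" if t: "t \<in> {t0<..<a}" for t
  proof -
    have "norm (x t - x t0) \<le> - C * ln (a - t) - (- C * ln (a - t0))"
    proof (rule differentiable_bound_general[of t0 t x "\<lambda>s. - C * ln (a - s)" x' "\<lambda>s. C / (a - s)"])
      show "continuous_on {t0..t} x"
        using t by (intro continuous_at_imp_continuous_on ballI has_vector_derivative_continuous[OF x]) auto
      show "continuous_on {t0..t} (\<lambda>s. - C * ln (a - s))"
        using t by (intro continuous_intros) auto
      fix s assume s: "t0 < s" "s < t"
      then show "(x has_vector_derivative x' s) (at s)" using x t by auto
      show "((\<lambda>s. - C * ln (a - s)) has_vector_derivative C / (a - s)) (at s)"
        unfolding has_real_derivative_iff_has_vector_derivative[symmetric]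
        using s t by (auto intro!: derivative_eq_intros simp: field_simps)
      show "norm (x' s) \<le> C / (a - s)"
        using C[of s] s t by (simp add: field_simps)
    qed (use t in auto)
    then have "norm (x t) \<le> norm (x t0) + C * (ln (a - t0) - ln (a - t))"
      using norm_triangle_sub[of "x t" "x t0"] by (simp add: algebra_simps)
    then show ?thesis using t by (simp add: norm_mult del: of_real_diff)
  qed
  have "((\<lambda>s::real. s * ln s) \<longlongrightarrow> 0) (at_right 0)" by real_asymp
  moreover have "filterlim (\<lambda>t. a - t) (at_right 0) (at_left a)"
    by real_asymp
  ultimately have "((\<lambda>t. (a - t) * ln (a - t)) \<longlongrightarrow> 0) (at_left a)"
    by (rule filterlim_compose)
  then have "((\<lambda>t. (a - t) * (cmod (x t0) + C * ln (a - t0)) - C * ((a - t) * ln (a - t))) \<longlongrightarrow>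
      (a - a) * (cmod (x t0) + C * ln (a - t0)) - C * 0) (at_left a)"
    by (intro tendsto_intros)
  then have "(?b \<longlongrightarrow> 0) (at_left a)" by (simp add: algebra_simps)
  then show ?thesis
    by (rule Lim_null_comparison[rotated])
       (rule eventually_mono[OF eventually_at_left_real[OF assms(1)] bound])
qed

lemma log_growth_right:
  fixes x x' :: "real \<Rightarrow> complex"
  assumes "-a < t0" and x: "\<And>t. t \<in> {-a<..t0} \<Longrightarrow> (x has_vector_derivative x' t) (at t)"
    and C: "\<And>t. t \<in> {-a<..t0} \<Longrightarrow> (t + a) * cmod (x' t) \<le> C"
  shows "((\<lambda>t. of_real (t + a) * x t) \<longlongrightarrow> 0) (at_right (-a))"
proof -
  have "((\<lambda>t. of_real (a - t) * x (- t)) \<longlongrightarrow> 0) (at_left a)"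
  proof (rule log_growth_left[of "- t0" a _ "\<lambda>t. - x' (- t)" C])
    fix t assume t: "t \<in> {- t0..<a}"
    then have "(x has_vector_derivative x' (- t)) (at (- t))" using x by auto
    then have "(x \<circ> uminus has_vector_derivative (-1) *\<^sub>R x' (- t)) (at t)"
      by (intro vector_diff_chain_at) (auto intro!: derivative_eq_intros)
    then show "((\<lambda>t. x (- t)) has_vector_derivative - x' (- t)) (at t)" by (simp add: o_def)
    show "(a - t) * cmod (- x' (- t)) \<le> C" using C[of "- t"] t by simp
  qed (use assms in auto)
  then show ?thesis
    by (simp add: at_right_minus[of "-a"] filterlim_filtermap add.commute)
qed

section \<open>The boundary form of the commutator\<close>

text \<open>The quasi-derivative of Sturm-Liouville theory. It has finite limits at the ends even
  when the derivative itself blows up there.\<close>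

definition flux :: "real \<Rightarrow> (real \<Rightarrow> complex) \<Rightarrow> real \<Rightarrow> complex" where
  "flux a x t = complex_of_real (1 - t\<^sup>2 / a\<^sup>2) * derivative_at x t"

definition fourier_kernel :: "real \<Rightarrow> real \<Rightarrow> complex" where
  "fourier_kernel s \<xi> = exp (\<i> * complex_of_real (s * \<xi>))"

lemma fourier_kernel_deriv:
  "(fourier_kernel s has_vector_derivative \<i> * complex_of_real s * fourier_kernel s t) (at t within S)"
proof -
  have "((\<lambda>z. exp (\<i> * complex_of_real s * z)) has_field_derivative
      (\<i> * complex_of_real s) * exp (\<i> * complex_of_real s * of_real t)) (at (of_real t))"
    by (auto intro!: derivative_eq_intros)
  from has_vector_derivative_real_field[OF this]
  show ?thesis
    by (simp add: fourier_kernel_def[abs_def] mult.assoc has_vector_derivative_at_within)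
qed

lemma continuous_on_fourier_kernel [continuous_intros]: "continuous_on S (fourier_kernel s)"
  by (rule continuous_on_vector_derivative) (rule fourier_kernel_deriv)

lemma weight_deriv:
  "((\<lambda>t. complex_of_real (1 - t\<^sup>2 / a\<^sup>2)) has_vector_derivative complex_of_real (- 2 * t / a\<^sup>2)) (at t within S)"
proof (rule has_vector_derivative_of_real)
  have "((\<lambda>t. 1 - t\<^sup>2 * k) has_real_derivative - 2 * t * k) (at t within S)" for k
    by (auto intro!: derivative_eq_intros)
  from this[of "inverse (a\<^sup>2)"]
  show "((\<lambda>t. 1 - t\<^sup>2 / a\<^sup>2) has_real_derivative - 2 * t / a\<^sup>2) (at t within S)"
    by (simp add: divide_inverse)
qed

lemma class_A_has_derivative:
  assumes "x \<in> class_A a" "t \<in> {-a<..<a}"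
  shows "(x has_vector_derivative derivative_at x t) (at t)"
  using assms by (auto simp: class_A_def vector_derivative_works[symmetric])

lemma class_A_abs_cont:
  assumes "x \<in> class_A a" "-a < c" "c \<le> d" "d < a"
  shows "abs_cont_on c d (derivative_at x)" "abs_cont_on c d x" "abs_cont_on c d (flux a x)"
proof -
  show d: "abs_cont_on c d (derivative_at x)"
    using assms by (simp add: class_A_def absolutely_continuous_on_interval_iff)
  show "abs_cont_on c d x"
    using class_A_has_derivative[OF assms(1)] assms
    by (intro abs_cont_on_bounded_derivative[OF _ abs_cont_on_imp_continuous_on[OF d]])
       (auto intro: has_vector_derivative_at_within)
  show "abs_cont_on c d (flux a x)"
    unfolding flux_def[abs_def]
    by (intro abs_cont_on_mult d abs_cont_on_bounded_derivative[OF weight_deriv] continuous_intros)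
       (use assms in auto)
qed

lemma flux_has_derivative:
  assumes "flux a x differentiable (at t)"
  shows "(flux a x has_vector_derivative - prolate_M a x t) (at t)"
  using assms vector_derivative_works[of "flux a x" "at t"]
  by (simp add: prolate_M_def flux_def[abs_def])

text \<open>Where the flux has no derivative the value of \<open>prolate_M\<close> is arbitrary, but
  these points form a null set that the integral ignores.\<close>

lemma flux_FTC:
  assumes "x \<in> class_A a" "-a < c" "c \<le> d" "d < a"
  shows "((\<lambda>t. - prolate_M a x t) has_integral flux a x d - flux a x c) {c..d}"
  using class_A_abs_cont(3)[OF assms]
  by (intro abs_cont_on_FTC[OF _ assms(3) abs_cont_on_ae_differentiable])
     (auto intro: flux_has_derivative)

text \<open>The Lagrange bracket of \<open>x\<close> with the Fourier kernel. Its derivative contains the kernel only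
  through a multiplier that is symmetric in \<open>s\<close> and \<open>\<xi>\<close>; this symmetry is what makes the
  differential operator commute with the truncated Fourier transform up to boundary terms.\<close>

definition kernel_bracket :: "real \<Rightarrow> (real \<Rightarrow> complex) \<Rightarrow> real \<Rightarrow> real \<Rightarrow> complex" where
  "kernel_bracket a x s \<xi> =
     fourier_kernel s \<xi> * (flux a x \<xi> - \<i> * complex_of_real s * (complex_of_real (1 - \<xi>\<^sup>2 / a\<^sup>2) * x \<xi>))"

text \<open>This is what L, acting in \<xi>, produces from the kernel exp(i s \<xi>), divided by the
  kernel.\<close>

definition symbol :: "real \<Rightarrow> real \<Rightarrow> real \<Rightarrow> complex" where
  "symbol a s \<xi> = complex_of_real (\<xi>\<^sup>2 + s\<^sup>2 - s\<^sup>2 * \<xi>\<^sup>2 / a\<^sup>2) + \<i> * complex_of_real (2 * s * \<xi> / a\<^sup>2)"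

text \<open>Lagrange's identity: with weight p and kernel k the bracket is k p x' - p k' x, so in
  its derivative the terms p k' x' cancel and what remains is (M k) x - k (M x). The potential
  \<xi>^2 may be added to both terms, which turns M into L.\<close>

lemma kernel_bracket_FTC:
  assumes x: "x \<in> class_A a" and cd: "-a < c" "c \<le> d" "d < a"
  shows "((\<lambda>\<xi>. fourier_kernel s \<xi> * (symbol a s \<xi> * x \<xi>) - fourier_kernel s \<xi> * prolate_L a x \<xi>)
    has_integral kernel_bracket a x s d - kernel_bracket a x s c) {c..d}"
proof (rule abs_cont_on_FTC[OF _ cd(2) abs_cont_on_ae_differentiable[OF class_A_abs_cont(3)[OF assms]]])
  have const: "abs_cont_on c d (\<lambda>t. z)" for z :: complex
    by (rule abs_cont_on_Lipschitz[of c d _ 0]) auto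
  show "abs_cont_on c d (kernel_bracket a x s)"
    unfolding kernel_bracket_def[abs_def]
    by (intro abs_cont_on_mult abs_cont_on_diff class_A_abs_cont[OF assms] const
        abs_cont_on_bounded_derivative[OF weight_deriv]
        abs_cont_on_bounded_derivative[OF fourier_kernel_deriv] continuous_intros)
       (use cd in auto)
  fix t assume "t \<in> {c<..<d} - {t \<in> {c<..<d}. \<not> flux a x differentiable (at t)}"
  then have t: "t \<in> {-a<..<a}" and diff: "flux a x differentiable (at t)" using cd by auto
  note d = flux_has_derivative[OF diff] class_A_has_derivative[OF x t]
  show "(kernel_bracket a x s has_vector_derivative
      fourier_kernel s t * (symbol a s t * x t) - fourier_kernel s t * prolate_L a x t) (at t)"
    unfolding kernel_bracket_def[abs_def]
    by (rule has_vector_derivative_eq_rhs,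
        rule has_vector_derivative_mult[OF fourier_kernel_deriv
          has_vector_derivative_diff[OF d(1) has_vector_derivative_mult_right[OF
            has_vector_derivative_mult[OF weight_deriv d(2)]]]])
       (simp add: symbol_def prolate_L_def flux_def algebra_simps power2_eq_square)
qed

section \<open>Boundary values in the maximal domain\<close>

text \<open>The maximal domain refers to the open interval, the Fourier integral to the closed one;
  the values at the two end points are arbitrary but form a null set.\<close>

lemma L2_closed_interval:
  assumes "x \<in> L2 {c<..<d}"
  shows "x \<in> L2 {c..d}"
proof -
  have "(\<lambda>t. if t \<in> {c<..<d} then x t else 0) \<in> borel_measurable lebesgue"
    using assms by (subst borel_measurable_if) (auto simp: L2_def)
  then have "(\<lambda>t. if t \<in> {c..d} then x t else 0) \<in> borel_measurable lebesgue"
    by (rule measurable_discrete_difference[where X = "{c, d}"]) auto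
  then have m: "x \<in> borel_measurable (lebesgue_on {c..d})"
    by (subst (asm) borel_measurable_if) auto
  have "(\<lambda>t. (cmod (x t))\<^sup>2) absolutely_integrable_on {c<..<d}"
    using assms by (simp add: L2_def integrable_restrict_space set_integrable_def)
  then have "(\<lambda>t. (cmod (x t))\<^sup>2) integrable_on {c<..<d}"
    by (simp add: absolutely_integrable_on_def)
  then have "(\<lambda>t. (cmod (x t))\<^sup>2) integrable_on {c..d}"
    by (simp add: integrable_on_open_interval_real)
  then show ?thesis
    by (rule L2I_bound[OF m, rotated]) auto
qed

lemma L2_add:
  assumes "x \<in> L2 S" "y \<in> L2 S" "S \<in> sets lebesgue"
  shows "(\<lambda>t. x t + y t) \<in> L2 S"
proof -
  have int: "(\<lambda>t. (cmod (f t))\<^sup>2) integrable_on S" if "f \<in> L2 S" for f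
    using that assms(3) set_lebesgue_integral_eq_integral(1)[of S "\<lambda>t. (cmod (f t))\<^sup>2"]
    by (simp add: L2_def integrable_restrict_space set_integrable_def)
  have "(\<lambda>t. 2 * (cmod (x t))\<^sup>2 + 2 * (cmod (y t))\<^sup>2) integrable_on S"
    using int[OF assms(1)] int[OF assms(2)] by (intro integrable_add integrable_on_mult_right)
  then show ?thesis
  proof (rule L2I_bound[rotated 2])
    have "(cmod (u + v))\<^sup>2 \<le> 2 * (cmod u)\<^sup>2 + 2 * (cmod v)\<^sup>2" for u v
    proof -
      have "(cmod (u + v))\<^sup>2 \<le> (cmod u + cmod v)\<^sup>2" by (intro power_mono norm_triangle_ineq) auto
      also have "\<dots> \<le> 2 * (cmod u)\<^sup>2 + 2 * (cmod v)\<^sup>2"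
        using sum_squares_ge_zero[of "cmod u - cmod v" 0] by (simp add: power2_eq_square algebra_simps)
      finally show ?thesis .
    qed
    then show "(cmod (x t + y t))\<^sup>2 \<le> 2 * (cmod (x t))\<^sup>2 + 2 * (cmod (y t))\<^sup>2" for t .
  qed (use assms in \<open>auto simp: L2_def\<close>)
qed

lemma L2_mult_continuous:
  assumes "x \<in> L2 {c..d}" "continuous_on {c..d} k"
  shows "(\<lambda>t. k t * x t) \<in> L2 {c..d}"
proof -
  have "bounded (k ` {c..d})"
    using assms(2) by (intro compact_imp_bounded compact_continuous_image) auto
  then obtain B where B: "0 < B" "\<And>t. t \<in> {c..d} \<Longrightarrow> norm (k t) \<le> B"
    by (auto simp: bounded_pos)
  have int: "(\<lambda>t. (cmod (x t))\<^sup>2) integrable_on {c..d}"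
    using assms(1) set_lebesgue_integral_eq_integral(1)[of "{c..d}" "\<lambda>t. (cmod (x t))\<^sup>2"]
    by (simp add: L2_def integrable_restrict_space set_integrable_def)
  show ?thesis
  proof (rule L2I_bound)
    show "(\<lambda>t. k t * x t) \<in> borel_measurable (lebesgue_on {c..d})"
      using assms continuous_imp_measurable_on_sets_lebesgue[OF assms(2)]
      by (intro borel_measurable_times) (auto simp: L2_def)
    show "(\<lambda>t. B\<^sup>2 * (cmod (x t))\<^sup>2) integrable_on {c..d}"
      using int by (rule integrable_on_mult_right)
    show "(cmod (k t * x t))\<^sup>2 \<le> B\<^sup>2 * (cmod (x t))\<^sup>2" if "t \<in> {c..d}" for t
      using B(2)[OF that] by (simp add: norm_mult power_mult_distrib mult_right_mono power_mono)
  qed auto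
qed

lemma domain_max_L2:
  assumes "x \<in> domain_max a"
  shows "x \<in> L2 {-a..a}" "prolate_M a x \<in> L2 {-a..a}" "prolate_L a x \<in> L2 {-a..a}"
proof -
  show 1: "x \<in> L2 {-a..a}" and 2: "prolate_M a x \<in> L2 {-a..a}"
    using assms by (auto simp: domain_max_def intro: L2_closed_interval)
  have "(\<lambda>t. complex_of_real (t\<^sup>2) * x t) \<in> L2 {-a..a}"
    by (intro L2_mult_continuous 1 continuous_intros)
  from L2_add[OF 2 this] show "prolate_L a x \<in> L2 {-a..a}"
    by (simp add: prolate_L_def[abs_def])
qed

lemma truncated_fourier_eq_integral:
  assumes "x \<in> L2 {-a..a}"
  shows "(\<lambda>\<xi>. fourier_kernel t \<xi> * x \<xi>) integrable_on {-a..a}"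
    "truncated_fourier a x t = complex_of_real (1 / sqrt (2 * pi)) *
      integral {-a..a} (\<lambda>\<xi>. fourier_kernel t \<xi> * x \<xi>)"
proof -
  have "(\<lambda>\<xi>. fourier_kernel t \<xi> * x \<xi>) absolutely_integrable_on {-a..a}"
    by (intro L2_absolutely_integrable L2_mult_continuous assms continuous_intros) auto
  from set_lebesgue_integral_eq_integral[OF this]
  show "(\<lambda>\<xi>. fourier_kernel t \<xi> * x \<xi>) integrable_on {-a..a}"
    "truncated_fourier a x t = complex_of_real (1 / sqrt (2 * pi)) *
      integral {-a..a} (\<lambda>\<xi>. fourier_kernel t \<xi> * x \<xi>)"
    by (simp_all add: truncated_fourier_def fourier_kernel_def)
qed

text \<open>On a bounded interval M x is integrable, so the flux, a primitive of - M x, has limits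
  at both ends. Dividing by the factor of the weight that does not vanish there gives the limits b,
  so the \<open>Lim\<close> in their definitions is a genuine limit.\<close>

lemma domain_max_boundary_limits:
  assumes x: "x \<in> domain_max a" and a: "0 < a"
  shows "((\<lambda>t. complex_of_real (t + a) * derivative_at x t) \<longlongrightarrow> b_left a x) (at_right (-a))"
    "((\<lambda>t. complex_of_real (t - a) * derivative_at x t) \<longlongrightarrow> b_right a x) (at_left a)"
    "(flux a x \<longlongrightarrow> of_real (2 / a) * b_left a x) (at_right (-a))"
    "(flux a x \<longlongrightarrow> - of_real (2 / a) * b_right a x) (at_left a)"
proof -
  have xA: "x \<in> class_A a" using x by (simp add: domain_max_def)
  have "prolate_M a x absolutely_integrable_on {-a..a}"
    by (rule L2_absolutely_integrable[OF domain_max_L2(2)[OF x]]) auto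
  then have "(\<lambda>t. - prolate_M a x t) integrable_on {-a..a}"
    by (intro integrable_neg) (simp add: absolutely_integrable_on_def)
  from primitive_endpoint_limits[OF this a flux_FTC[OF xA]]
  obtain l r where lr: "(flux a x \<longlongrightarrow> l) (at_right (-a))" "(flux a x \<longlongrightarrow> r) (at_left a)" by blast
  \<comment> \<open>Since 1 - t^2/a^2 = (a - t) * (a + t) / a^2, this factor turns the weight into t
    + a; at -a it equals a / 2, whence the constant 2 / a in the conclusions.\<close>
  have "((\<lambda>t. of_real (a\<^sup>2 / (a - t)) * flux a x t) \<longlongrightarrow> of_real (a\<^sup>2 / (a - (- a))) * l) (at_right (-a))"
    using a by (intro tendsto_intros lr) auto
  moreover have "eventually (\<lambda>t. of_real (a\<^sup>2 / (a - t)) * flux a x t =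
      complex_of_real (t + a) * derivative_at x t) (at_right (-a))"
  proof -
    have "of_real (a\<^sup>2 / (a - t)) * flux a x t = complex_of_real (t + a) * derivative_at x t"
      if t: "t \<in> {-a<..<a}" for t
    proof -
      have "1 - t\<^sup>2 / a\<^sup>2 = (a - t) * (a + t) / a\<^sup>2"
        using a by (simp add: field_simps power2_eq_square)
      moreover have "a - t \<noteq> 0" "a + t \<noteq> 0" using t by auto
      ultimately have "a\<^sup>2 / (a - t) * (1 - t\<^sup>2 / a\<^sup>2) = t + a" using a by simp
      then show ?thesis by (simp only: flux_def mult.assoc[symmetric] of_real_mult[symmetric])
    qed
    then show ?thesis
      using eventually_at_right_real[of "-a" a] a by (auto elim!: eventually_mono)
  qed
  ultimately have bl: "((\<lambda>t. complex_of_real (t + a) * derivative_at x t) \<longlongrightarrow> of_real (a / 2) * l) (at_right (-a))"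
    using a by (simp add: tendsto_cong power2_eq_square)
  have "((\<lambda>t. - of_real (a\<^sup>2 / (a + t)) * flux a x t) \<longlongrightarrow> - of_real (a\<^sup>2 / (a + a)) * r) (at_left a)"
    using a by (intro tendsto_intros lr) auto
  moreover have "eventually (\<lambda>t. - of_real (a\<^sup>2 / (a + t)) * flux a x t =
      complex_of_real (t - a) * derivative_at x t) (at_left a)"
  proof -
    have "- of_real (a\<^sup>2 / (a + t)) * flux a x t = complex_of_real (t - a) * derivative_at x t"
      if t: "t \<in> {-a<..<a}" for t
    proof -
      have "1 - t\<^sup>2 / a\<^sup>2 = (a - t) * (a + t) / a\<^sup>2"
        using a by (simp add: field_simps power2_eq_square)
      moreover have "a - t \<noteq> 0" "a + t \<noteq> 0" using t by auto
      ultimately have "- (a\<^sup>2 / (a + t)) * (1 - t\<^sup>2 / a\<^sup>2) = t - a" using a by simp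
      then show ?thesis by (simp only: flux_def mult.assoc[symmetric] of_real_mult[symmetric] of_real_minus[symmetric])
    qed
    then show ?thesis
      using eventually_at_left_real[of "-a" a] a by (auto elim!: eventually_mono)
  qed
  ultimately have br: "((\<lambda>t. complex_of_real (t - a) * derivative_at x t) \<longlongrightarrow> - of_real (a / 2) * r) (at_left a)"
    using a by (simp add: tendsto_cong power2_eq_square)
  have eqs: "b_left a x = of_real (a / 2) * l" "b_right a x = - of_real (a / 2) * r"
    using tendsto_Lim[OF _ bl] tendsto_Lim[OF _ br] by (simp_all add: b_left_def b_right_def)
  show "((\<lambda>t. complex_of_real (t + a) * derivative_at x t) \<longlongrightarrow> b_left a x) (at_right (-a))"
    "((\<lambda>t. complex_of_real (t - a) * derivative_at x t) \<longlongrightarrow> b_right a x) (at_left a)"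
    using bl br by (simp_all only: eqs)
  show "(flux a x \<longlongrightarrow> of_real (2 / a) * b_left a x) (at_right (-a))"
    "(flux a x \<longlongrightarrow> - of_real (2 / a) * b_right a x) (at_left a)"
    using lr a by (simp_all add: eqs)
qed

text \<open>Existence of the limits b bounds x' by a multiple of the reciprocal distance to the end,
  so \<open>x\<close> grows at most logarithmically.\<close>

lemma domain_max_weight_vanishes:
  assumes x: "x \<in> domain_max a" and a: "0 < a"
  shows "((\<lambda>t. complex_of_real (1 - t\<^sup>2 / a\<^sup>2) * x t) \<longlongrightarrow> 0) (at_right (-a))"
    "((\<lambda>t. complex_of_real (1 - t\<^sup>2 / a\<^sup>2) * x t) \<longlongrightarrow> 0) (at_left a)"
proof -
  have xA: "x \<in> class_A a" using x by (simp add: domain_max_def)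
  note lim = domain_max_boundary_limits[OF assms]
  have "eventually (\<lambda>t. cmod (complex_of_real (t + a) * derivative_at x t) < cmod (b_left a x) + 1) (at_right (-a))"
    using order_tendstoD(2)[OF tendsto_norm[OF lim(1)]] by simp
  then obtain t1 where t1: "-a < t1" "\<And>t. -a < t \<Longrightarrow> t < t1 \<Longrightarrow>
      cmod (complex_of_real (t + a) * derivative_at x t) < cmod (b_left a x) + 1"
    by (auto simp: eventually_at_right_field)
  \<comment> \<open>The midpoint of -a and t1, capped at 0 so that the interval stays inside (-a,
    a).\<close>
  define t1' where "t1' = min 0 ((t1 - a) / 2)"
  have t1': "-a < t1'" "t1' < a" "t1' < t1" using t1(1) a by (auto simp: t1'_def min_def field_simps)
  have "((\<lambda>t. of_real (t + a) * x t) \<longlongrightarrow> 0) (at_right (-a))"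
  proof (rule log_growth_right[OF t1'(1), of x "derivative_at x" "cmod (b_left a x) + 1"])
    fix t assume t: "t \<in> {-a<..t1'}"
    show "(x has_vector_derivative derivative_at x t) (at t)"
      using t t1' by (intro class_A_has_derivative[OF xA]) auto
    have "cmod (complex_of_real (t + a)) = t + a" using t by (subst norm_of_real) auto
    then show "(t + a) * cmod (derivative_at x t) \<le> cmod (b_left a x) + 1"
      using t1(2)[of t] t t1' by (simp add: norm_mult del: of_real_add)
  qed
  then have "((\<lambda>t. of_real ((a - t) / a\<^sup>2) * (of_real (t + a) * x t)) \<longlongrightarrow> of_real ((a - (- a)) / a\<^sup>2) * 0) (at_right (-a))"
    using a by (intro tendsto_intros) auto
  moreover have *: "of_real ((a - t) / a\<^sup>2) * (of_real (t + a) * x t) = complex_of_real (1 - t\<^sup>2 / a\<^sup>2) * x t" for t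
  proof -
    have "(a - t) / a\<^sup>2 * (t + a) = 1 - t\<^sup>2 / a\<^sup>2" using a by (simp add: field_simps power2_eq_square)
    then show ?thesis by (simp only: mult.assoc[symmetric] of_real_mult[symmetric])
  qed
  ultimately show "((\<lambda>t. complex_of_real (1 - t\<^sup>2 / a\<^sup>2) * x t) \<longlongrightarrow> 0) (at_right (-a))" by simp
  have "eventually (\<lambda>t. cmod (complex_of_real (t - a) * derivative_at x t) < cmod (b_right a x) + 1) (at_left a)"
    using order_tendstoD(2)[OF tendsto_norm[OF lim(2)]] by simp
  then obtain t2 where t2: "t2 < a" "\<And>t. t2 < t \<Longrightarrow> t < a \<Longrightarrow>
      cmod (complex_of_real (t - a) * derivative_at x t) < cmod (b_right a x) + 1"
    by (auto simp: eventually_at_left_field)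
  define t2' where "t2' = max 0 ((t2 + a) / 2)"
  have t2': "-a < t2'" "t2' < a" "t2 < t2'" using t2(1) a by (auto simp: t2'_def max_def field_simps)
  have "((\<lambda>t. of_real (a - t) * x t) \<longlongrightarrow> 0) (at_left a)"
  proof (rule log_growth_left[OF t2'(2), of x "derivative_at x" "cmod (b_right a x) + 1"])
    fix t assume t: "t \<in> {t2'..<a}"
    show "(x has_vector_derivative derivative_at x t) (at t)"
      using t t2' by (intro class_A_has_derivative[OF xA]) auto
    have "cmod (complex_of_real (t - a)) = a - t" using t by (subst norm_of_real) auto
    then show "(a - t) * cmod (derivative_at x t) \<le> cmod (b_right a x) + 1"
      using t2(2)[of t] t t2' by (simp add: norm_mult del: of_real_diff)
  qed
  then have "((\<lambda>t. of_real ((t + a) / a\<^sup>2) * (of_real (a - t) * x t)) \<longlongrightarrow> of_real ((a + a) / a\<^sup>2) * 0) (at_left a)"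
    using a by (intro tendsto_intros) auto
  moreover have "of_real ((t + a) / a\<^sup>2) * (of_real (a - t) * x t) = complex_of_real (1 - t\<^sup>2 / a\<^sup>2) * x t" for t
  proof -
    have "(t + a) / a\<^sup>2 * (a - t) = 1 - t\<^sup>2 / a\<^sup>2" using a by (simp add: field_simps power2_eq_square)
    then show ?thesis by (simp only: mult.assoc[symmetric] of_real_mult[symmetric])
  qed
  ultimately show "((\<lambda>t. complex_of_real (1 - t\<^sup>2 / a\<^sup>2) * x t) \<longlongrightarrow> 0) (at_left a)" by simp
qed

text \<open>The integrated Lagrange identity over the whole interval: at the ends the part of the
  bracket containing \<open>x\<close> vanishes, and the flux leaves the b-values with factor 2 /
  a.\<close>

lemma fourier_prolate_boundary_formula:
  assumes x: "x \<in> domain_max a" and a: "0 < a"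
  shows "truncated_fourier a (prolate_L a x) s =
    truncated_fourier a (\<lambda>\<xi>. symbol a s \<xi> * x \<xi>) s +
    complex_of_real (1 / sqrt (2 * pi)) * (of_real (2 / a) *
      (fourier_kernel s a * b_right a x + fourier_kernel s (-a) * b_left a x))"
proof -
  have xA: "x \<in> class_A a" using x by (simp add: domain_max_def)
  let ?Q = "\<lambda>\<xi>. fourier_kernel s \<xi> * (symbol a s \<xi> * x \<xi>)"
  let ?L = "\<lambda>\<xi>. fourier_kernel s \<xi> * prolate_L a x \<xi>"
  have "(\<lambda>\<xi>. symbol a s \<xi> * x \<xi>) \<in> L2 {-a..a}"
    unfolding symbol_def by (intro L2_mult_continuous domain_max_L2[OF x] continuous_intros) (use a in auto)
  note Q = truncated_fourier_eq_integral[OF this, of s]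
  note L = truncated_fourier_eq_integral[OF domain_max_L2(3)[OF x], of s]
  obtain l r where lr: "(kernel_bracket a x s \<longlongrightarrow> l) (at_right (-a))"
    "(kernel_bracket a x s \<longlongrightarrow> r) (at_left a)" "integral {-a..a} (\<lambda>\<xi>. ?Q \<xi> - ?L \<xi>) = r - l"
    using primitive_endpoint_limits[OF integrable_diff[OF Q(1) L(1)] a kernel_bracket_FTC[OF xA]] by blast
  have k: "continuous_on UNIV (fourier_kernel s)" by (rule continuous_on_fourier_kernel)
  have kl: "(fourier_kernel s \<longlongrightarrow> fourier_kernel s (-a)) (at_right (-a))"
    and kr: "(fourier_kernel s \<longlongrightarrow> fourier_kernel s a) (at_left a)"
    using k by (auto simp: continuous_on_def intro: tendsto_within_subset)
  note lim = domain_max_boundary_limits(3,4)[OF assms] domain_max_weight_vanishes[OF assms]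
  have "(kernel_bracket a x s \<longlongrightarrow> fourier_kernel s (-a) *
      (of_real (2 / a) * b_left a x - \<i> * of_real s * 0)) (at_right (-a))"
    unfolding kernel_bracket_def[abs_def] by (intro tendsto_intros kl lim)
  then have l: "l = fourier_kernel s (-a) * (of_real (2 / a) * b_left a x)"
    using tendsto_unique[OF _ lr(1)] by simp
  have "(kernel_bracket a x s \<longlongrightarrow> fourier_kernel s a *
      (- of_real (2 / a) * b_right a x - \<i> * of_real s * 0)) (at_left a)"
    unfolding kernel_bracket_def[abs_def] by (intro tendsto_intros kr lim)
  then have r: "r = fourier_kernel s a * (- of_real (2 / a) * b_right a x)"
    using tendsto_unique[OF _ lr(2)] by simp
  have "r - l = integral {-a..a} ?Q - integral {-a..a} ?L"
    using lr(3) Henstock_Kurzweil_Integration.integral_diff[OF Q(1) L(1)] by simp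
  then have IL: "integral {-a..a} ?L = integral {-a..a} ?Q - (r - l)" by simp
  show ?thesis
    unfolding Q(2) L(2) IL l r by (simp add: algebra_simps del: of_real_divide)
qed

section \<open>Functions with logarithmic singularities at the end points\<close>

lemma domain_maxI:
  assumes y: "\<And>t. t \<in> {-a<..<a} \<Longrightarrow> (y has_vector_derivative y1 t) (at t)"
    and y1: "\<And>t. t \<in> {-a<..<a} \<Longrightarrow> (y1 has_vector_derivative y2 t) (at t)"
    and cont: "continuous_on {-a<..<a} y2"
    and L2: "y \<in> L2 {-a<..<a}"
      "(\<lambda>t. of_real (2 * t / a\<^sup>2) * y1 t - of_real (1 - t\<^sup>2 / a\<^sup>2) * y2 t) \<in> L2 {-a<..<a}"
  shows "y \<in> domain_max a"
    and "\<And>t. t \<in> {-a<..<a} \<Longrightarrow>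
      prolate_M a y t = of_real (2 * t / a\<^sup>2) * y1 t - of_real (1 - t\<^sup>2 / a\<^sup>2) * y2 t"
proof -
  have d: "derivative_at y t = y1 t" if "t \<in> {-a<..<a}" for t
    using y[OF that] by (rule vector_derivative_at)
  show M: "prolate_M a y t = of_real (2 * t / a\<^sup>2) * y1 t - of_real (1 - t\<^sup>2 / a\<^sup>2) * y2 t"
    if t: "t \<in> {-a<..<a}" for t
  proof -
    have "((\<lambda>t. complex_of_real (1 - t\<^sup>2 / a\<^sup>2) * y1 t) has_vector_derivative
        of_real (1 - t\<^sup>2 / a\<^sup>2) * y2 t + of_real (- 2 * t / a\<^sup>2) * y1 t) (at t)"
      by (intro has_vector_derivative_mult weight_deriv y1 t)
    then have "((\<lambda>t. complex_of_real (1 - t\<^sup>2 / a\<^sup>2) * derivative_at y t) has_vector_derivative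
        of_real (1 - t\<^sup>2 / a\<^sup>2) * y2 t + of_real (- 2 * t / a\<^sup>2) * y1 t) (at t)"
      by (rule has_vector_derivative_transform_within_open[of _ _ _ "{-a<..<a}"]) (use t d in auto)
    then show ?thesis
      unfolding prolate_M_def by (subst vector_derivative_at, assumption) simp
  qed
  have "y \<in> class_A a"
    unfolding class_A_def
  proof (intro CollectI conjI ballI allI impI)
    fix t assume "t \<in> {-a<..<a}"
    then show "y differentiable (at t)" using y by (intro differentiableI_vector) auto
  next
    fix c d' assume cd: "-a < c \<and> c \<le> d' \<and> d' < a"
    have "abs_cont_on c d' y1"
      using cd by (intro abs_cont_on_bounded_derivative[of c d' y1 y2] has_vector_derivative_at_within[OF y1]
          continuous_on_subset[OF cont]) auto
    \<comment> \<open>The two functions agree only inside (-a, a); this is enough because absolute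
      continuity evaluates them only at end points of intervals in {c..d'}.\<close>
    moreover have "abs_cont_on c d' (derivative_at y) \<longleftrightarrow> abs_cont_on c d' y1"
      unfolding abs_cont_on_def
    proof (intro iff_allI imp_cong refl ex_cong1 conj_cong iff_allI)
      fix e \<delta> :: real and D T assume D: "D division_of T \<and> T \<subseteq> {c..d'} \<and> (\<Sum>K\<in>D. Sup K - Inf K) < \<delta>"
      have "(\<Sum>K\<in>D. norm (derivative_at y (Sup K) - derivative_at y (Inf K))) =
          (\<Sum>K\<in>D. norm (y1 (Sup K) - y1 (Inf K)))"
      proof (rule sum.cong)
        fix K assume "K \<in> D"
        then have "Inf K \<in> {c..d'}" "Sup K \<in> {c..d'}" using division_of_realD(3,4)[of D T K] D by blast+
        then show "norm (derivative_at y (Sup K) - derivative_at y (Inf K)) = norm (y1 (Sup K) - y1 (Inf K))"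
          using cd by (simp add: d)
      qed simp
      then show "((\<Sum>K\<in>D. norm (derivative_at y (Sup K) - derivative_at y (Inf K))) < e) =
          ((\<Sum>K\<in>D. norm (y1 (Sup K) - y1 (Inf K))) < e)" by simp
    qed
    ultimately show "absolutely_continuous_on_interval c d' (derivative_at y)"
      by (simp add: absolutely_continuous_on_interval_iff)
  qed
  moreover have "prolate_M a y \<in> L2 {-a<..<a}"
    by (rule L2_cong[THEN iffD2, OF M L2(2)])
  ultimately show "y \<in> domain_max a" using L2(1) by (simp add: domain_max_def)
qed

text \<open>Smoothness is required on the whole line, so limits at -a and a are plain values, and
  the derivatives are carried along so that M can be written explicitly.\<close>

definition twice_cont_diff :: "(real \<Rightarrow> complex) \<Rightarrow> (real \<Rightarrow> complex) \<Rightarrow> (real \<Rightarrow> complex) \<Rightarrow> bool" where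
  "twice_cont_diff s s1 s2 \<longleftrightarrow> (\<forall>t. (s has_vector_derivative s1 t) (at t)) \<and>
     (\<forall>t. (s1 has_vector_derivative s2 t) (at t)) \<and> continuous_on UNIV s2"

lemma twice_cont_diff_continuous:
  assumes "twice_cont_diff s s1 s2"
  shows "continuous_on S s" "continuous_on S s1" "continuous_on S s2"
  using assms continuous_on_subset[of UNIV s2 S]
  by (auto simp: twice_cont_diff_def intro!: continuous_at_imp_continuous_on
      dest: has_vector_derivative_continuous)

lemma twice_cont_diff_mult:
  assumes s: "twice_cont_diff s s1 s2" and r: "twice_cont_diff r r1 r2"
  shows "twice_cont_diff (\<lambda>t. s t * r t) (\<lambda>t. s t * r1 t + s1 t * r t)
    (\<lambda>t. (s t * r2 t + s1 t * r1 t) + (s1 t * r1 t + s2 t * r t))"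
  unfolding twice_cont_diff_def
proof (intro conjI allI)
  note d = s[unfolded twice_cont_diff_def] r[unfolded twice_cont_diff_def]
  show "((\<lambda>t. s t * r t) has_vector_derivative s t * r1 t + s1 t * r t) (at t)" for t
    using d by (intro has_vector_derivative_mult) auto
  show "((\<lambda>t. s t * r1 t + s1 t * r t) has_vector_derivative
     (s t * r2 t + s1 t * r1 t) + (s1 t * r1 t + s2 t * r t)) (at t)" for t
    using d by (intro has_vector_derivative_add has_vector_derivative_mult) auto
  show "continuous_on UNIV (\<lambda>t. (s t * r2 t + s1 t * r1 t) + (s1 t * r1 t + s2 t * r t))"
    by (intro continuous_intros twice_cont_diff_continuous[OF s] twice_cont_diff_continuous[OF r])
qed

lemma twice_cont_diff_add:
  assumes s: "twice_cont_diff s s1 s2" and r: "twice_cont_diff r r1 r2"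
  shows "twice_cont_diff (\<lambda>t. s t + r t) (\<lambda>t. s1 t + r1 t) (\<lambda>t. s2 t + r2 t)"
  using assms unfolding twice_cont_diff_def
  by (auto intro!: has_vector_derivative_add continuous_intros)

lemma twice_cont_diff_const: "twice_cont_diff (\<lambda>t. z) (\<lambda>t. 0) (\<lambda>t. 0)"
  by (simp add: twice_cont_diff_def)

lemma twice_cont_diff_of_real:
  assumes "\<And>t. (f has_real_derivative f1 t) (at t)" "\<And>t. (f1 has_real_derivative f2 t) (at t)"
    and "continuous_on UNIV f2"
  shows "twice_cont_diff (\<lambda>t. of_real (f t)) (\<lambda>t. of_real (f1 t)) (\<lambda>t. of_real (f2 t))"
  using assms unfolding twice_cont_diff_def
  by (auto intro!: has_vector_derivative_of_real continuous_intros)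

text \<open>The model singularities: M maps ln (a + t) and ln (a - t) to the constant 1 / a^2, so
  the sum stays in the maximal domain although its b-values are \<beta> and \<gamma>. Together with
  the end values of \<open>s\<close> this leaves all four boundary values free.\<close>

definition log_perturbed :: "real \<Rightarrow> complex \<Rightarrow> complex \<Rightarrow> (real \<Rightarrow> complex) \<Rightarrow> real \<Rightarrow> complex" where
  "log_perturbed a \<beta> \<gamma> s t = \<beta> * of_real (ln (a + t)) + \<gamma> * of_real (ln (a - t)) + s t"

lemma ln_square_integrable:
  fixes a :: real
  assumes "0 < a"
  shows "(\<lambda>t. (ln (a + t))\<^sup>2) integrable_on {-a..a}" "(\<lambda>t. (ln (a - t))\<^sup>2) integrable_on {-a..a}"
proof -
  \<comment> \<open>A primitive of (ln u)^2 from two integrations by parts, extended continuously by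
    0.\<close>
  define h where "h = (\<lambda>u::real. if u \<le> 0 then 0 else u * (ln u)\<^sup>2 - 2 * (u * ln u) + 2 * u)"
  have lim: "((\<lambda>u::real. u * (ln u)\<^sup>2 - 2 * (u * ln u) + 2 * u) \<longlongrightarrow> 0) (at_right 0)"
    by real_asymp
  have h0: "(h \<longlongrightarrow> h 0) (at 0 within {0..2 * a})"
  proof -
    have "(h \<longlongrightarrow> 0) (at_right 0)"
      using lim by (rule Lim_transform_eventually)
        (auto simp: h_def eventually_at_right_field intro!: exI[of _ 1])
    then show ?thesis using assms by (simp add: at_within_Icc_at_right h_def)
  qed
  have deriv: "(h has_real_derivative (ln u)\<^sup>2) (at u)" if u: "0 < u" for u
  proof -
    have "((\<lambda>u::real. u * (ln u)\<^sup>2 - 2 * (u * ln u) + 2 * u) has_real_derivative (ln u)\<^sup>2) (at u)"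
      using u by (auto intro!: derivative_eq_intros simp: distrib_left)
    then show ?thesis
      by (rule DERIV_cong_ev[THEN iffD1, rotated -1])
         (use u in \<open>auto simp: h_def eventually_nhds intro!: exI[of _ "{0<..}"]\<close>)
  qed
  have cont: "continuous_on {0..2 * a} h"
    unfolding continuous_on_def
  proof
    fix u assume u: "u \<in> {0..2 * a}"
    show "(h \<longlongrightarrow> h u) (at u within {0..2 * a})"
    proof (cases "u = 0")
      case False
      then have "isCont h u" using deriv[of u] u by (auto intro: DERIV_isCont)
      then have "h \<midarrow>u\<rightarrow> h u" by (simp add: isCont_def)
      then show ?thesis by (rule tendsto_within_subset) simp
    qed (use h0 in simp)
  qed
  have "((\<lambda>t. (ln (a + t))\<^sup>2) has_integral h (a + a) - h (a + (- a))) {-a..a}"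
  proof (rule fundamental_theorem_of_calculus_interior)
    show "continuous_on {-a..a} (\<lambda>t. h (a + t))"
      by (rule continuous_on_compose2[OF cont]) (auto intro!: continuous_intros)
    show "((\<lambda>t. h (a + t)) has_vector_derivative (ln (a + t))\<^sup>2) (at t)" if "t \<in> {-a<..<a}" for t
    proof -
      have "((\<lambda>t. h (a + t)) has_real_derivative (ln (a + t))\<^sup>2 * 1) (at t)"
        using that by (intro DERIV_chain2[OF deriv]) (auto intro!: derivative_eq_intros)
      then show ?thesis by (simp add: has_real_derivative_iff_has_vector_derivative)
    qed
  qed (use assms in auto)
  then show "(\<lambda>t. (ln (a + t))\<^sup>2) integrable_on {-a..a}" by blast
  then show "(\<lambda>t. (ln (a - t))\<^sup>2) integrable_on {-a..a}"
    using Henstock_Kurzweil_Integration.integrable_reflect_real[where f = "\<lambda>t. (ln (a + t))\<^sup>2" and a = "-a" and b = a] by simp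
qed

lemma ln_L2:
  assumes "0 < a"
  shows "(\<lambda>t. complex_of_real (ln (a + t))) \<in> L2 {-a<..<a}" "(\<lambda>t. complex_of_real (ln (a - t))) \<in> L2 {-a<..<a}"
proof -
  note int = ln_square_integrable[OF assms]
  show "(\<lambda>t. complex_of_real (ln (a + t))) \<in> L2 {-a<..<a}"
  proof (rule L2I_bound[where g = "\<lambda>t. (ln (a + t))\<^sup>2"])
    show "(\<lambda>t. complex_of_real (ln (a + t))) \<in> borel_measurable (lebesgue_on {-a<..<a})"
      by (intro continuous_imp_measurable_on_sets_lebesgue continuous_intros) auto
    show "(\<lambda>t. (ln (a + t))\<^sup>2) integrable_on {-a<..<a}"
      using int by (simp add: integrable_on_open_interval_real)
  qed auto
  show "(\<lambda>t. complex_of_real (ln (a - t))) \<in> L2 {-a<..<a}"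
  proof (rule L2I_bound[where g = "\<lambda>t. (ln (a - t))\<^sup>2"])
    show "(\<lambda>t. complex_of_real (ln (a - t))) \<in> borel_measurable (lebesgue_on {-a<..<a})"
      by (intro continuous_imp_measurable_on_sets_lebesgue continuous_intros) auto
    show "(\<lambda>t. (ln (a - t))\<^sup>2) integrable_on {-a<..<a}"
      using int by (simp add: integrable_on_open_interval_real)
  qed auto
qed

lemma L2_cmult:
  assumes "x \<in> L2 S" "S \<in> sets lebesgue"
  shows "(\<lambda>t. k * x t) \<in> L2 S"
  using assms by (auto simp: L2_def norm_mult power_mult_distrib)

lemma log_perturbed_domain:
  assumes a: "0 < a" and s: "twice_cont_diff s s1 s2"
  shows "log_perturbed a \<beta> \<gamma> s \<in> domain_max a"
    and "\<And>t. t \<in> {-a<..<a} \<Longrightarrow> prolate_M a (log_perturbed a \<beta> \<gamma> s) t =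
      (\<beta> + \<gamma>) / of_real (a\<^sup>2) + of_real (2 * t / a\<^sup>2) * s1 t - of_real (1 - t\<^sup>2 / a\<^sup>2) * s2 t"
    and "b_left a (log_perturbed a \<beta> \<gamma> s) = \<beta>"
    and "b_right a (log_perturbed a \<beta> \<gamma> s) = \<gamma>"
    and "c_left a (log_perturbed a \<beta> \<gamma> s) = - \<gamma> * of_real (ln (2 * a)) - s (-a)"
    and "c_right a (log_perturbed a \<beta> \<gamma> s) = - \<beta> * of_real (ln (2 * a)) - s a"
proof -
  let ?y = "log_perturbed a \<beta> \<gamma> s"
  define y1 where "y1 t = \<beta> * of_real (1 / (a + t)) - \<gamma> * of_real (1 / (a - t)) + s1 t" for t
  define y2 where "y2 t = - \<beta> * of_real (1 / (a + t)\<^sup>2) - \<gamma> * of_real (1 / (a - t)\<^sup>2) + s2 t" for t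
  let ?m = "\<lambda>t. (\<beta> + \<gamma>) / of_real (a\<^sup>2) + of_real (2 * t / a\<^sup>2) * s1 t - of_real (1 - t\<^sup>2 / a\<^sup>2) * s2 t"
  note cont = twice_cont_diff_continuous[OF s]
  have d: "(?y has_vector_derivative y1 t) (at t)" if t: "t \<in> {-a<..<a}" for t
  proof -
    have "((\<lambda>t. ln (a + t)) has_real_derivative 1 / (a + t)) (at t)"
      using t by (auto intro!: derivative_eq_intros)
    moreover have "((\<lambda>t. ln (a - t)) has_real_derivative - (1 / (a - t))) (at t)"
      using t by (auto intro!: derivative_eq_intros simp: divide_simps)
    ultimately have "((\<lambda>t. \<beta> * of_real (ln (a + t)) + \<gamma> * of_real (ln (a - t)) + s t) has_vector_derivative
        \<beta> * of_real (1 / (a + t)) + \<gamma> * of_real (- (1 / (a - t))) + s1 t) (at t)"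
      using s unfolding twice_cont_diff_def
      by (intro has_vector_derivative_add has_vector_derivative_mult_right has_vector_derivative_of_real) auto
    then show ?thesis by (simp add: log_perturbed_def[abs_def] y1_def)
  qed
  have d1: "(y1 has_vector_derivative y2 t) (at t)" if t: "t \<in> {-a<..<a}" for t
  proof -
    have "((\<lambda>t. 1 / (a + t)) has_real_derivative - (1 / (a + t)\<^sup>2)) (at t)"
      using t by (auto intro!: derivative_eq_intros simp: power2_eq_square divide_simps)
    moreover have "((\<lambda>t. 1 / (a - t)) has_real_derivative 1 / (a - t)\<^sup>2) (at t)"
      using t by (auto intro!: derivative_eq_intros simp: power2_eq_square divide_simps)
    ultimately have "((\<lambda>t. \<beta> * of_real (1 / (a + t)) - \<gamma> * of_real (1 / (a - t)) + s1 t) has_vector_derivative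
        \<beta> * of_real (- (1 / (a + t)\<^sup>2)) - \<gamma> * of_real (1 / (a - t)\<^sup>2) + s2 t) (at t)"
      using s unfolding twice_cont_diff_def
      by (intro has_vector_derivative_add has_vector_derivative_diff has_vector_derivative_mult_right
          has_vector_derivative_of_real) auto
    then show ?thesis by (simp add: y1_def[abs_def] y2_def)
  qed
  have m: "of_real (2 * t / a\<^sup>2) * y1 t - of_real (1 - t\<^sup>2 / a\<^sup>2) * y2 t = ?m t" if t: "t \<in> {-a<..<a}" for t
  proof -
    have nz: "a + t \<noteq> 0" "a - t \<noteq> 0" using t by auto
    have p: "1 - t\<^sup>2 / a\<^sup>2 = (a - t) * (a + t) / a\<^sup>2" using a by (simp add: field_simps power2_eq_square)
    \<comment> \<open>The weight times the derivative of ln (a + t) is the linear polynomial (a - t)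
      / a^2, which explains the cancellation; likewise for ln (a - t).\<close>
    have 1: "2 * t / a\<^sup>2 * (1 / (a + t)) + (1 - t\<^sup>2 / a\<^sup>2) * (1 / (a + t)\<^sup>2) = 1 / a\<^sup>2"
      unfolding p using nz a by (simp add: divide_simps power2_eq_square)
    have 2: "- (2 * t / a\<^sup>2) * (1 / (a - t)) + (1 - t\<^sup>2 / a\<^sup>2) * (1 / (a - t)\<^sup>2) = 1 / a\<^sup>2"
      unfolding p using nz a by (simp add: divide_simps power2_eq_square)
    have "of_real (2 * t / a\<^sup>2) * y1 t - of_real (1 - t\<^sup>2 / a\<^sup>2) * y2 t =
       \<beta> * of_real (2 * t / a\<^sup>2 * (1 / (a + t)) + (1 - t\<^sup>2 / a\<^sup>2) * (1 / (a + t)\<^sup>2)) +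
       \<gamma> * of_real (- (2 * t / a\<^sup>2) * (1 / (a - t)) + (1 - t\<^sup>2 / a\<^sup>2) * (1 / (a - t)\<^sup>2)) +
       of_real (2 * t / a\<^sup>2) * s1 t - of_real (1 - t\<^sup>2 / a\<^sup>2) * s2 t"
      unfolding y1_def y2_def of_real_add of_real_mult of_real_minus by algebra
    also have "\<dots> = ?m t" unfolding 1 2 by (simp add: add_divide_distrib)
    finally show ?thesis .
  qed
  have L2y: "?y \<in> L2 {-a<..<a}"
    unfolding log_perturbed_def[abs_def]
    by (intro L2_add L2_cmult ln_L2 a continuous_on_imp_L2 cont) auto
  have "continuous_on {-a..a} ?m" using a by (intro continuous_intros cont) auto
  then have "?m \<in> L2 {-a<..<a}" by (rule continuous_on_imp_L2)
  then have L2m: "(\<lambda>t. of_real (2 * t / a\<^sup>2) * y1 t - of_real (1 - t\<^sup>2 / a\<^sup>2) * y2 t) \<in> L2 {-a<..<a}"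
    by (rule L2_cong[THEN iffD2, rotated]) (rule m)
  have conty2: "continuous_on {-a<..<a} y2"
    unfolding y2_def[abs_def] by (intro continuous_intros cont) auto
  show "?y \<in> domain_max a"
    by (rule domain_maxI(1)[OF d d1 conty2 L2y L2m])
  show "prolate_M a ?y t = ?m t" if "t \<in> {-a<..<a}" for t
    using domain_maxI(2)[OF d d1 conty2 L2y L2m that] m[OF that] by simp
  have dy: "derivative_at ?y t = y1 t" if "t \<in> {-a<..<a}" for t
    using d[OF that] by (rule vector_derivative_at)
  have ev_l: "eventually (\<lambda>t. t \<in> {-a<..<a}) (at_right (-a))"
    using eventually_at_right_real[of "-a" a] a by simp
  have ev_r: "eventually (\<lambda>t. t \<in> {-a<..<a}) (at_left a)"
    using eventually_at_left_real[of "-a" a] a by simp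
  have "((\<lambda>u::real. u * ln u) \<longlongrightarrow> 0) (at_right 0)" by real_asymp
  moreover have "filterlim (\<lambda>t. a + t) (at_right 0) (at_right (-a))"
    by (simp add: at_right_to_0[of "-a"] filterlim_filtermap filterlim_ident)
  moreover have "filterlim (\<lambda>t. a - t) (at_right 0) (at_left a)" by real_asymp
  ultimately have ln_l: "((\<lambda>t. (a + t) * ln (a + t)) \<longlongrightarrow> 0) (at_right (-a))"
    and ln_r: "((\<lambda>t. (a - t) * ln (a - t)) \<longlongrightarrow> 0) (at_left a)"
    using filterlim_compose by blast+
  have at: "(s \<longlongrightarrow> s u) (at u within S)" "(s1 \<longlongrightarrow> s1 u) (at u within S)" for u S
    using cont(1,2)[of UNIV] by (auto simp: continuous_on_def intro: tendsto_within_subset)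
  have "((\<lambda>t. \<beta> - \<gamma> * of_real ((t + a) / (a - t)) + of_real (t + a) * s1 t) \<longlongrightarrow>
      \<beta> - \<gamma> * of_real ((- a + a) / (a - (- a))) + of_real (- a + a) * s1 (- a)) (at_right (-a))"
    using a by (intro tendsto_intros at) auto
  moreover have "eventually (\<lambda>t. \<beta> - \<gamma> * of_real ((t + a) / (a - t)) + of_real (t + a) * s1 t =
      complex_of_real (t + a) * derivative_at ?y t) (at_right (-a))"
    using ev_l
  proof eventually_elim
    case (elim t)
    have "complex_of_real (t + a) * derivative_at ?y t =
       \<beta> * of_real ((t + a) * (1 / (a + t))) - \<gamma> * of_real ((t + a) * (1 / (a - t))) + of_real (t + a) * s1 t"
      unfolding dy[OF elim] y1_def of_real_mult by algebra
    moreover have "(t + a) * (1 / (a + t)) = 1" "(t + a) * (1 / (a - t)) = (t + a) / (a - t)" using elim by auto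
    ultimately show ?case by (simp only: of_real_1 mult_1_right)
  qed
  ultimately have "((\<lambda>t. complex_of_real (t + a) * derivative_at ?y t) \<longlongrightarrow> \<beta>) (at_right (-a))"
    by (simp add: tendsto_cong)
  then show "b_left a ?y = \<beta>" unfolding b_left_def by (intro tendsto_Lim) auto
  have "((\<lambda>t. \<beta> * of_real ((t - a) / (a + t)) + \<gamma> + of_real (t - a) * s1 t) \<longlongrightarrow>
      \<beta> * of_real ((a - a) / (a + a)) + \<gamma> + of_real (a - a) * s1 a) (at_left a)"
    using a by (intro tendsto_intros at) auto
  moreover have "eventually (\<lambda>t. \<beta> * of_real ((t - a) / (a + t)) + \<gamma> + of_real (t - a) * s1 t =
      complex_of_real (t - a) * derivative_at ?y t) (at_left a)"
    using ev_r
  proof eventually_elim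
    case (elim t)
    have "complex_of_real (t - a) * derivative_at ?y t =
       \<beta> * of_real ((t - a) * (1 / (a + t))) - \<gamma> * of_real ((t - a) * (1 / (a - t))) + of_real (t - a) * s1 t"
      unfolding dy[OF elim] y1_def of_real_mult by algebra
    moreover have "(t - a) * (1 / (a + t)) = (t - a) / (a + t)" "(t - a) * (1 / (a - t)) = - 1"
      using elim by (auto simp: divide_simps)
    ultimately show ?case
      by (simp only: of_real_minus of_real_1 mult_minus_right mult_1_right diff_minus_eq_add)
  qed
  ultimately have "((\<lambda>t. complex_of_real (t - a) * derivative_at ?y t) \<longlongrightarrow> \<gamma>) (at_left a)"
    by (simp add: tendsto_cong)
  then show "b_right a ?y = \<gamma>" unfolding b_right_def by (intro tendsto_Lim) auto
  have "((\<lambda>t. - \<gamma> * of_real (((a + t) * ln (a + t)) / (a - t)) + of_real ((a + t) * ln (a + t)) * s1 t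
        - \<gamma> * of_real (ln (a - t)) - s t) \<longlongrightarrow>
      - \<gamma> * of_real (0 / (a - (- a))) + of_real 0 * s1 (- a) - \<gamma> * of_real (ln (a - (- a))) - s (- a)) (at_right (-a))"
    using a by (intro tendsto_intros at ln_l) auto
  moreover have "eventually (\<lambda>t. - \<gamma> * of_real (((a + t) * ln (a + t)) / (a - t)) + of_real ((a + t) * ln (a + t)) * s1 t
        - \<gamma> * of_real (ln (a - t)) - s t =
      complex_of_real ((t + a) * ln (a + t)) * derivative_at ?y t - ?y t) (at_right (-a))"
    using ev_l
  proof eventually_elim
    case (elim t)
    have "complex_of_real ((t + a) * ln (a + t)) * derivative_at ?y t - ?y t =
       \<beta> * of_real ((t + a) * ln (a + t) * (1 / (a + t)) - ln (a + t))
       - \<gamma> * of_real ((t + a) * ln (a + t) * (1 / (a - t))) + of_real ((t + a) * ln (a + t)) * s1 t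
       - \<gamma> * of_real (ln (a - t)) - s t"
      unfolding dy[OF elim] y1_def log_perturbed_def of_real_mult of_real_diff by algebra
    \<comment> \<open>The definition of \<open>c_left\<close> is made for this cancellation of the
      logarithm singular at -a. The other logarithm is regular there and contributes its value ln (2
      * a), so \<gamma>, not \<beta>, appears in \<open>c_left\<close>.\<close>
    moreover have "(t + a) * ln (a + t) * (1 / (a + t)) - ln (a + t) = 0"
      "(t + a) * ln (a + t) * (1 / (a - t)) = ((a + t) * ln (a + t)) / (a - t)" using elim by (auto simp: add.commute)
    ultimately show ?case
      by (simp only: of_real_0 mult_zero_right diff_0 mult_minus_left add.commute[of t a])
  qed
  ultimately have "((\<lambda>t. complex_of_real ((t + a) * ln (a + t)) * derivative_at ?y t - ?y t) \<longlongrightarrow>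
      - \<gamma> * of_real (ln (2 * a)) - s (- a)) (at_right (-a))"
    by (simp add: tendsto_cong)
  then show "c_left a ?y = - \<gamma> * of_real (ln (2 * a)) - s (- a)"
    unfolding c_left_def by (intro tendsto_Lim) auto
  have "((\<lambda>t. - \<beta> * of_real (((a - t) * ln (a - t)) / (a + t)) - of_real ((a - t) * ln (a - t)) * s1 t
        - \<beta> * of_real (ln (a + t)) - s t) \<longlongrightarrow>
      - \<beta> * of_real (0 / (a + a)) - of_real 0 * s1 a - \<beta> * of_real (ln (a + a)) - s a) (at_left a)"
    using a by (intro tendsto_intros at ln_r) auto
  moreover have "eventually (\<lambda>t. - \<beta> * of_real (((a - t) * ln (a - t)) / (a + t)) - of_real ((a - t) * ln (a - t)) * s1 t
        - \<beta> * of_real (ln (a + t)) - s t =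
      complex_of_real ((t - a) * ln (a - t)) * derivative_at ?y t - ?y t) (at_left a)"
    using ev_r
  proof eventually_elim
    case (elim t)
    have "complex_of_real ((t - a) * ln (a - t)) * derivative_at ?y t - ?y t =
       \<beta> * of_real ((t - a) * ln (a - t) * (1 / (a + t)))
       - \<gamma> * of_real ((t - a) * ln (a - t) * (1 / (a - t)) + ln (a - t)) + of_real (- ((a - t) * ln (a - t))) * s1 t
       - \<beta> * of_real (ln (a + t)) - s t"
      unfolding dy[OF elim] y1_def log_perturbed_def of_real_mult of_real_add of_real_diff of_real_minus by algebra
    moreover have "(t - a) * ln (a - t) * (1 / (a - t)) + ln (a - t) = 0"
      "(t - a) * ln (a - t) * (1 / (a + t)) = - (((a - t) * ln (a - t)) / (a + t))" using elim by (auto simp: field_simps)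
    ultimately show ?case
      by (simp only: of_real_minus of_real_0 mult_zero_right mult_minus_right mult_minus_left diff_zero add_uminus_conv_diff)
  qed
  ultimately have "((\<lambda>t. complex_of_real ((t - a) * ln (a - t)) * derivative_at ?y t - ?y t) \<longlongrightarrow>
      - \<beta> * of_real (ln (2 * a)) - s a) (at_left a)"
    by (simp add: tendsto_cong)
  then show "c_right a ?y = - \<beta> * of_real (ln (2 * a)) - s a"
    unfolding c_right_def by (intro tendsto_Lim) auto
qed

section \<open>The truncated Fourier transform\<close>

lemma twice_cont_diff_domain:
  assumes a: "0 < a" and s: "twice_cont_diff s s1 s2"
  shows "s \<in> domain_max a"
    and "\<And>t. t \<in> {-a<..<a} \<Longrightarrow> prolate_M a s t =
      of_real (2 * t / a\<^sup>2) * s1 t - of_real (1 - t\<^sup>2 / a\<^sup>2) * s2 t"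
    and "b_left a s = 0" "b_right a s = 0" "c_left a s = - s (-a)" "c_right a s = - s a"
proof -
  have "log_perturbed a 0 0 s = s" by (simp add: log_perturbed_def[abs_def])
  with log_perturbed_domain[OF a s, where \<beta> = 0 and \<gamma> = 0]
  show "s \<in> domain_max a"
    and "\<And>t. t \<in> {-a<..<a} \<Longrightarrow> prolate_M a s t =
      of_real (2 * t / a\<^sup>2) * s1 t - of_real (1 - t\<^sup>2 / a\<^sup>2) * s2 t"
    and "b_left a s = 0" "b_right a s = 0" "c_left a s = - s (-a)" "c_right a s = - s a"
    by simp_all
qed

lemma fourier_kernel_commute: "fourier_kernel s t = fourier_kernel t s"
  by (simp add: fourier_kernel_def mult.commute)

lemma fourier_kernel_cos_sin:
  "fourier_kernel s t = of_real (cos (s * t)) + \<i> * of_real (sin (s * t))"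
  unfolding fourier_kernel_def cis_conv_exp[symmetric] by (simp add: complex_eq_iff)

lemma norm_fourier_kernel [simp]: "cmod (fourier_kernel s t) = 1"
  by (simp add: fourier_kernel_def)

text \<open>The second derivative in the frequency variable has modulus \<xi>^2, so the remainder is
  quadratic, uniformly for \<xi> in a bounded interval. This is the input for differentiating under
  the integral.\<close>

lemma fourier_kernel_linearization:
  "cmod (fourier_kernel v \<xi> - fourier_kernel u \<xi> - of_real (v - u) * (\<i> * of_real \<xi> * fourier_kernel u \<xi>))
    \<le> \<xi>\<^sup>2 * (v - u)\<^sup>2"
proof -
  have lip: "cmod (fourier_kernel \<xi> q - fourier_kernel \<xi> p) \<le> \<bar>\<xi>\<bar> * \<bar>q - p\<bar>" for p q
  proof -
    have "norm (fourier_kernel \<xi> q - fourier_kernel \<xi> p) \<le> \<bar>\<xi>\<bar> * norm (q - p)"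
    proof (rule differentiable_bound[of UNIV])
      show "(fourier_kernel \<xi> has_derivative (\<lambda>h. h *\<^sub>R (\<i> * of_real \<xi> * fourier_kernel \<xi> t))) (at t within UNIV)" for t
        using fourier_kernel_deriv[of \<xi> t UNIV] by (simp add: has_vector_derivative_def)
      show "onorm (\<lambda>h. h *\<^sub>R (\<i> * of_real \<xi> * fourier_kernel \<xi> t)) \<le> \<bar>\<xi>\<bar>" for t
        by (rule onorm_bound) (auto simp: norm_mult mult.commute)
    qed auto
    then show ?thesis by simp
  qed
  have "norm (fourier_kernel \<xi> v - fourier_kernel \<xi> u - (v - u) *\<^sub>R (\<i> * of_real \<xi> * fourier_kernel \<xi> u))
      \<le> norm (v - u) * (\<xi>\<^sup>2 * \<bar>v - u\<bar>)"
  proof (rule vector_differentiable_bound_linearization[where S = "closed_segment u v"])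
    fix t assume t: "t \<in> closed_segment u v"
    show "(fourier_kernel \<xi> has_vector_derivative \<i> * of_real \<xi> * fourier_kernel \<xi> t) (at t within closed_segment u v)"
      by (rule fourier_kernel_deriv)
    have "norm (\<i> * of_real \<xi> * fourier_kernel \<xi> t - \<i> * of_real \<xi> * fourier_kernel \<xi> u) =
        \<bar>\<xi>\<bar> * cmod (fourier_kernel \<xi> t - fourier_kernel \<xi> u)"
      by (simp add: right_diff_distrib[symmetric] norm_mult)
    also have "\<dots> \<le> \<bar>\<xi>\<bar> * (\<bar>\<xi>\<bar> * \<bar>t - u\<bar>)" by (intro mult_left_mono lip) auto
    also have "\<dots> \<le> \<bar>\<xi>\<bar> * (\<bar>\<xi>\<bar> * \<bar>v - u\<bar>)"
      using t by (intro mult_left_mono) (auto simp: closed_segment_eq_real_ivl split: if_splits)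
    also have "\<dots> = \<xi>\<^sup>2 * \<bar>v - u\<bar>" by (simp add: power2_eq_square flip: mult.assoc)
    finally show "norm (\<i> * of_real \<xi> * fourier_kernel \<xi> t - \<i> * of_real \<xi> * fourier_kernel \<xi> u) \<le> \<xi>\<^sup>2 * \<bar>v - u\<bar>" .
  qed auto
  then show ?thesis
    by (simp add: fourier_kernel_commute[of _ \<xi>] scaleR_conv_of_real power2_eq_square mult_ac)
qed

lemma L2_mult_freq:
  assumes "x \<in> L2 {c..d}"
  shows "(\<lambda>\<xi>. \<i> * of_real \<xi> * x \<xi>) \<in> L2 {c..d}"
  by (intro L2_mult_continuous assms continuous_intros)

text \<open>The quadratic remainder of the kernel is integrated against \<open>x\<close>: the total
  error is at most a constant times the L1 norm of \<open>x\<close> times (v - t)^2, which is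
  o(\<bar>v - t\<bar>).\<close>

lemma truncated_fourier_has_derivative:
  assumes x: "x \<in> L2 {-a..a}" and a: "0 < a"
  shows "(truncated_fourier a x has_vector_derivative truncated_fourier a (\<lambda>\<xi>. \<i> * of_real \<xi> * x \<xi>) t) (at t)"
proof -
  define \<kappa> where "\<kappa> = complex_of_real (1 / sqrt (2 * pi))"
  note F = truncated_fourier_eq_integral[OF x, folded \<kappa>_def]
  note F1 = truncated_fourier_eq_integral[OF L2_mult_freq[OF x], folded \<kappa>_def]
  have int: "(\<lambda>\<xi>. cmod (x \<xi>)) integrable_on {-a..a}"
    using L2_absolutely_integrable[OF x] by (auto simp: absolutely_integrable_on_def)
  define N where "N = integral {-a..a} (\<lambda>\<xi>. cmod (x \<xi>))"
  have N: "0 \<le> N" unfolding N_def by (intro integral_nonneg int) auto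
  have est: "cmod (truncated_fourier a x v - truncated_fourier a x t -
      (v - t) *\<^sub>R truncated_fourier a (\<lambda>\<xi>. \<i> * of_real \<xi> * x \<xi>) t) \<le> (cmod \<kappa> * a\<^sup>2 * N) * (v - t)\<^sup>2" for v
  proof -
    let ?D = "\<lambda>\<xi>. (fourier_kernel v \<xi> * x \<xi> - fourier_kernel t \<xi> * x \<xi>) -
        (v - t) *\<^sub>R (fourier_kernel t \<xi> * (\<i> * of_real \<xi> * x \<xi>))"
    have Dint: "?D integrable_on {-a..a}"
      by (intro integrable_diff integrable_cmul F F1)
    have "integral {-a..a} ?D = integral {-a..a} (\<lambda>\<xi>. fourier_kernel v \<xi> * x \<xi>)
        - integral {-a..a} (\<lambda>\<xi>. fourier_kernel t \<xi> * x \<xi>)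
        - (v - t) *\<^sub>R integral {-a..a} (\<lambda>\<xi>. fourier_kernel t \<xi> * (\<i> * of_real \<xi> * x \<xi>))"
      by (simp only: Henstock_Kurzweil_Integration.integral_diff[OF integrable_diff[OF F(1) F(1)] integrable_cmul[OF F1(1)]]
          Henstock_Kurzweil_Integration.integral_diff[OF F(1) F(1)] Henstock_Kurzweil_Integration.integral_cmul)
    then have eq: "truncated_fourier a x v - truncated_fourier a x t -
      (v - t) *\<^sub>R truncated_fourier a (\<lambda>\<xi>. \<i> * of_real \<xi> * x \<xi>) t = \<kappa> * integral {-a..a} ?D"
      unfolding F(2) F1(2) by (simp only: right_diff_distrib mult_scaleR_right)
    have "cmod (integral {-a..a} ?D) \<le> integral {-a..a} (\<lambda>\<xi>. (a\<^sup>2 * (v - t)\<^sup>2) * cmod (x \<xi>))"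
    proof (rule integral_norm_bound_integral[OF Dint integrable_on_mult_right[OF int]])
      fix \<xi> assume \<xi>: "\<xi> \<in> {-a..a}"
      have "?D \<xi> = (fourier_kernel v \<xi> - fourier_kernel t \<xi> - of_real (v - t) * (\<i> * of_real \<xi> * fourier_kernel t \<xi>)) * x \<xi>"
        by (simp add: scaleR_conv_of_real algebra_simps)
      then have "cmod (?D \<xi>) \<le> (\<xi>\<^sup>2 * (v - t)\<^sup>2) * cmod (x \<xi>)"
        using fourier_kernel_linearization[of v \<xi> t] by (simp only: norm_mult mult_right_mono norm_ge_zero)
      also have "\<dots> \<le> (a\<^sup>2 * (v - t)\<^sup>2) * cmod (x \<xi>)"
        using \<xi> by (intro mult_right_mono) (auto simp: abs_le_square_iff[symmetric])
      finally show "cmod (?D \<xi>) \<le> (a\<^sup>2 * (v - t)\<^sup>2) * cmod (x \<xi>)" .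
    qed
    also have "\<dots> = (a\<^sup>2 * (v - t)\<^sup>2) * N" by (simp add: N_def)
    finally have "cmod \<kappa> * cmod (integral {-a..a} ?D) \<le> cmod \<kappa> * ((a\<^sup>2 * (v - t)\<^sup>2) * N)"
      by (intro mult_left_mono) auto
    then show ?thesis unfolding eq norm_mult by (simp only: mult_ac)
  qed
  define C where "C = cmod \<kappa> * a\<^sup>2 * N + 1"
  have C: "0 < C" using N by (auto simp: C_def intro!: add_nonneg_pos mult_nonneg_nonneg)
  show ?thesis
    unfolding has_vector_derivative_def has_derivative_at_alt
  proof (intro conjI allI impI)
    fix e :: real assume e: "0 < e"
    show "\<exists>d>0. \<forall>v. norm (v - t) < d \<longrightarrow>
       norm (truncated_fourier a x v - truncated_fourier a x t -
         (v - t) *\<^sub>R truncated_fourier a (\<lambda>\<xi>. \<i> * of_real \<xi> * x \<xi>) t) \<le> e * norm (v - t)"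
    proof (intro exI[of _ "e / C"] conjI allI impI)
      fix v assume v: "norm (v - t) < e / C"
      have "(cmod \<kappa> * a\<^sup>2 * N) * (v - t)\<^sup>2 \<le> C * (v - t)\<^sup>2"
        by (intro mult_right_mono) (auto simp: C_def)
      also have "\<dots> = (C * \<bar>v - t\<bar>) * \<bar>v - t\<bar>" by (simp add: power2_eq_square)
      also have "\<dots> \<le> e * \<bar>v - t\<bar>"
        using v C by (intro mult_right_mono) (auto simp: field_simps)
      finally show "norm (truncated_fourier a x v - truncated_fourier a x t -
         (v - t) *\<^sub>R truncated_fourier a (\<lambda>\<xi>. \<i> * of_real \<xi> * x \<xi>) t) \<le> e * norm (v - t)"
        using est[of v] by simp
    qed (use e C in auto)
  qed (rule bounded_linear_scaleR_left)
qed

text \<open>Differentiation multiplies \<open>x\<close> by i \<xi>, which preserves L2 on a bounded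
  interval, so the derivative rule can be iterated; a third application yields continuity of the
  second derivative.\<close>

lemma truncated_fourier_twice_cont_diff:
  assumes x: "x \<in> L2 {-a..a}" and a: "0 < a"
  shows "twice_cont_diff (truncated_fourier a x) (truncated_fourier a (\<lambda>\<xi>. \<i> * of_real \<xi> * x \<xi>))
    (truncated_fourier a (\<lambda>\<xi>. \<i> * of_real \<xi> * (\<i> * of_real \<xi> * x \<xi>)))"
proof -
  note x1 = L2_mult_freq[OF x]
  note x2 = L2_mult_freq[OF x1]
  have "continuous_on UNIV (truncated_fourier a (\<lambda>\<xi>. \<i> * of_real \<xi> * (\<i> * of_real \<xi> * x \<xi>)))"
    using truncated_fourier_has_derivative[OF x2 a]
    by (intro continuous_at_imp_continuous_on ballI) (rule has_vector_derivative_continuous)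
  then show ?thesis
    unfolding twice_cont_diff_def
    using truncated_fourier_has_derivative[OF x a] truncated_fourier_has_derivative[OF x1 a] by blast
qed

lemma truncated_fourier_add:
  assumes "x \<in> L2 {-a..a}" "y \<in> L2 {-a..a}"
  shows "truncated_fourier a (\<lambda>\<xi>. x \<xi> + y \<xi>) t = truncated_fourier a x t + truncated_fourier a y t"
proof -
  note x = truncated_fourier_eq_integral[OF assms(1), of t]
  note y = truncated_fourier_eq_integral[OF assms(2), of t]
  have xy: "(\<lambda>\<xi>. x \<xi> + y \<xi>) \<in> L2 {-a..a}" using assms by (rule L2_add) auto
  show ?thesis
    unfolding truncated_fourier_eq_integral(2)[OF xy, of t] x(2) y(2)
    by (simp only: distrib_left Henstock_Kurzweil_Integration.integral_add[OF x(1) y(1)])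
qed

lemma truncated_fourier_cmult:
  assumes "x \<in> L2 {-a..a}"
  shows "truncated_fourier a (\<lambda>\<xi>. k * x \<xi>) t = k * truncated_fourier a x t"
proof -
  have kx: "(\<lambda>\<xi>. k * x \<xi>) \<in> L2 {-a..a}" using assms by (rule L2_cmult) auto
  have "fourier_kernel t \<xi> * (k * x \<xi>) = k * (fourier_kernel t \<xi> * x \<xi>)" for \<xi> by simp
  then show ?thesis
    unfolding truncated_fourier_eq_integral(2)[OF kx, of t] truncated_fourier_eq_integral(2)[OF assms, of t]
    by (simp only: Henstock_Kurzweil_Integration.integral_mult_right) (simp only: mult_ac)
qed

text \<open>Under the integral, L acting in \<open>t\<close> becomes a multiplier. By the symmetry
  of \<open>symbol\<close> it is the one that arose from L acting in \<xi>, so these terms cancel in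
  the commutator.\<close>

lemma prolate_truncated_fourier:
  assumes x: "x \<in> L2 {-a..a}" and a: "0 < a" and t: "t \<in> {-a<..<a}"
  shows "prolate_L a (truncated_fourier a x) t = truncated_fourier a (\<lambda>\<xi>. symbol a t \<xi> * x \<xi>) t"
proof -
  note x1 = L2_mult_freq[OF x]
  note x2 = L2_mult_freq[OF x1]
  define k1 k2 k3 where k: "k1 = complex_of_real (2 * t / a\<^sup>2)" "k2 = - complex_of_real (1 - t\<^sup>2 / a\<^sup>2)"
    "k3 = complex_of_real (t\<^sup>2)"
  have "(\<lambda>\<xi>. symbol a t \<xi> * x \<xi>) = (\<lambda>\<xi>. (k1 * (\<i> * of_real \<xi> * x \<xi>) +
      k2 * (\<i> * of_real \<xi> * (\<i> * of_real \<xi> * x \<xi>))) + k3 * x \<xi>)"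
    by (auto simp: fun_eq_iff k symbol_def algebra_simps power2_eq_square)
  moreover have "truncated_fourier a (\<lambda>\<xi>. (k1 * (\<i> * of_real \<xi> * x \<xi>) +
      k2 * (\<i> * of_real \<xi> * (\<i> * of_real \<xi> * x \<xi>))) + k3 * x \<xi>) t =
      k1 * truncated_fourier a (\<lambda>\<xi>. \<i> * of_real \<xi> * x \<xi>) t +
      k2 * truncated_fourier a (\<lambda>\<xi>. \<i> * of_real \<xi> * (\<i> * of_real \<xi> * x \<xi>)) t
      + k3 * truncated_fourier a x t"
  proof -
    have y: "(\<lambda>\<xi>. k1 * (\<i> * of_real \<xi> * x \<xi>)) \<in> L2 {-a..a}"
      "(\<lambda>\<xi>. k2 * (\<i> * of_real \<xi> * (\<i> * of_real \<xi> * x \<xi>))) \<in> L2 {-a..a}"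
      "(\<lambda>\<xi>. k3 * x \<xi>) \<in> L2 {-a..a}"
      by (rule L2_cmult[OF x1] L2_cmult[OF x2] L2_cmult[OF x]; simp)+
    have "(\<lambda>\<xi>. k1 * (\<i> * of_real \<xi> * x \<xi>) + k2 * (\<i> * of_real \<xi> * (\<i> * of_real \<xi> * x \<xi>))) \<in> L2 {-a..a}"
      by (rule L2_add[OF y(1,2)]) simp
    from truncated_fourier_add[OF this y(3)] truncated_fourier_add[OF y(1,2)]
    show ?thesis
      by (simp only: truncated_fourier_cmult[OF x1] truncated_fourier_cmult[OF x2] truncated_fourier_cmult[OF x])
  qed
  moreover have "prolate_M a (truncated_fourier a x) t =
      k1 * truncated_fourier a (\<lambda>\<xi>. \<i> * of_real \<xi> * x \<xi>) t +
      k2 * truncated_fourier a (\<lambda>\<xi>. \<i> * of_real \<xi> * (\<i> * of_real \<xi> * x \<xi>)) t"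
    unfolding twice_cont_diff_domain(2)[OF a truncated_fourier_twice_cont_diff[OF x a] t]
    by (simp only: k mult_minus_left add_uminus_conv_diff)
  ultimately show ?thesis
    by (simp only: prolate_L_def k(3))
qed

text \<open>With b = 0 and c equal to minus the end values, the boundary condition becomes i (I - U)
  applied to the vector of end values.\<close>

lemma truncated_fourier_domain_U_iff:
  assumes x: "x \<in> L2 {-a..a}" and a: "0 < a"
  shows "truncated_fourier a x \<in> domain_U a U \<longleftrightarrow>
    (1 - U$1$1) * truncated_fourier a x (-a) - U$1$2 * truncated_fourier a x a = 0 \<and>
    (1 - U$2$2) * truncated_fourier a x a - U$2$1 * truncated_fourier a x (-a) = 0"
proof -
  note d = twice_cont_diff_domain[OF a truncated_fourier_twice_cont_diff[OF x a]]
  let ?l = "truncated_fourier a x (-a)" and ?r = "truncated_fourier a x a"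
  have "(1 + U$1$1) * 0 - \<i> * (1 - U$1$1) * (- ?l) + U$1$2 * 0 + \<i> * U$1$2 * (- ?r) =
      \<i> * ((1 - U$1$1) * ?l - U$1$2 * ?r)"
    and "U$2$1 * 0 + \<i> * U$2$1 * (- ?l) + (1 + U$2$2) * 0 - \<i> * (1 - U$2$2) * (- ?r) =
      \<i> * ((1 - U$2$2) * ?r - U$2$1 * ?l)"
    by (simp_all add: algebra_simps)
  then show ?thesis
    unfolding domain_U_def mem_Collect_eq d(3-6) by (simp only: d(1) mult_eq_0_iff complex_i_not_zero) simp
qed

lemma twice_cont_diff_L2:
  assumes "twice_cont_diff s s1 s2"
  shows "s \<in> L2 {c..d}"
  by (intro continuous_on_imp_L2 twice_cont_diff_continuous[OF assms])

section \<open>Prescribed end point values and the boundary term\<close>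

text \<open>The factor \<open>w\<close> forces zero end values, and cos (a t), sin (a t) match the
  kernels for the frequencies -a and a. By parity the even function has equal transforms at the two
  ends and the odd one opposite transforms, so solving for p and q is a diagonal problem. Its
  coefficients \<open>A\<close> and \<open>B\<close> are integrals of nonnegative continuous
  functions that are not identically zero.\<close>

lemma test_function:
  assumes a: "0 < a"
  obtains s s1 s2 where "twice_cont_diff s s1 s2" "s (-a) = 0" "s a = 0"
    "truncated_fourier a s (-a) = p" "truncated_fourier a s a = q"
proof -
  define w :: "real \<Rightarrow> real" where "w t = a\<^sup>2 - t\<^sup>2" for t
  have W: "\<exists>f1 f2. twice_cont_diff (\<lambda>t. of_real (w t)) f1 f2"
    by (rule exI, rule exI, rule twice_cont_diff_of_real[where ?f1.0 = "\<lambda>t. - 2 * t" and ?f2.0 = "\<lambda>t. - 2"])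
       (auto simp: w_def[abs_def] intro!: derivative_eq_intros)
  have C: "\<exists>f1 f2. twice_cont_diff (\<lambda>t. of_real (cos (a * t))) f1 f2"
    by (rule exI, rule exI, rule twice_cont_diff_of_real[where ?f1.0 = "\<lambda>t. - (a * sin (a * t))"
          and ?f2.0 = "\<lambda>t. - (a * (a * cos (a * t)))"])
       (auto intro!: derivative_eq_intros continuous_intros)
  have S: "\<exists>f1 f2. twice_cont_diff (\<lambda>t. of_real (sin (a * t))) f1 f2"
    by (rule exI, rule exI, rule twice_cont_diff_of_real[where ?f1.0 = "\<lambda>t. a * cos (a * t)"
          and ?f2.0 = "\<lambda>t. - (a * (a * sin (a * t)))"])
       (auto intro!: derivative_eq_intros continuous_intros)
  let ?u = "\<lambda>t. complex_of_real (w t) * of_real (cos (a * t))"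
  let ?v = "\<lambda>t. complex_of_real (w t) * of_real (sin (a * t))"
  have uv: "\<exists>f1 f2. twice_cont_diff ?u f1 f2" "\<exists>f1 f2. twice_cont_diff ?v f1 f2"
    using W C S twice_cont_diff_mult by blast+
  have L2: "?u \<in> L2 {-a..a}" "?v \<in> L2 {-a..a}" using uv twice_cont_diff_L2 by blast+
  define A where "A = integral {-a..a} (\<lambda>t. w t * (cos (a * t))\<^sup>2)"
  define B where "B = integral {-a..a} (\<lambda>t. w t * (sin (a * t))\<^sup>2)"
  define J where "J = integral {-a..a} (\<lambda>t. w t * (cos (a * t) * sin (a * t)))"
  have iA: "(\<lambda>t. w t * (cos (a * t))\<^sup>2) integrable_on {-a..a}"
    and iB: "(\<lambda>t. w t * (sin (a * t))\<^sup>2) integrable_on {-a..a}"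
    and iJ: "(\<lambda>t. w t * (cos (a * t) * sin (a * t))) integrable_on {-a..a}"
    unfolding w_def by (intro integrable_continuous_real continuous_intros)+
  have wnn: "0 \<le> w t" if "t \<in> {-a..a}" for t
    using that by (auto simp: w_def abs_le_square_iff[symmetric])
  have "J = - J"
  proof -
    have "J = integral {-a..a} (\<lambda>t. w (- t) * (cos (a * (- t)) * sin (a * (- t))))"
      using Henstock_Kurzweil_Integration.integral_reflect_real[where a = "-a" and b = a
          and f = "\<lambda>t. w t * (cos (a * t) * sin (a * t))"] by (simp add: J_def)
    also have "\<dots> = integral {-a..a} (\<lambda>t. - (w t * (cos (a * t) * sin (a * t))))" by (simp add: w_def)
    also have "\<dots> = - J" by (simp add: J_def)
    finally show ?thesis .
  qed
  then have J: "J = 0" by simp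
  have A: "A \<noteq> 0"
  proof
    assume "A = 0"
    moreover have "continuous_on {-a..a} (\<lambda>t. w t * (cos (a * t))\<^sup>2)"
      unfolding w_def by (intro continuous_intros)
    ultimately have "\<forall>t\<in>{-a..a}. w t * (cos (a * t))\<^sup>2 = 0"
      using a wnn by (subst (asm) A_def, subst (asm) integral_eq_0_iff) auto
    then have "w 0 * (cos (a * 0))\<^sup>2 = 0" using a by (auto dest: bspec[of _ _ 0])
    then show False using a by (simp add: w_def)
  qed
  have B: "B \<noteq> 0"
  proof
    assume "B = 0"
    moreover have "continuous_on {-a..a} (\<lambda>t. w t * (sin (a * t))\<^sup>2)"
      unfolding w_def by (intro continuous_intros)
    ultimately have *: "\<forall>t\<in>{-a..a}. w t * (sin (a * t))\<^sup>2 = 0"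
      using a wnn by (subst (asm) B_def, subst (asm) integral_eq_0_iff) auto
    \<comment> \<open>A point of (0, a) with 0 < a * t \<le> 1 < pi, where the sine is positive for
      every size of \<open>a\<close>.\<close>
    define t where "t = min (a / 2) (1 / a)"
    have t: "0 < t" "t < a" "a * t \<le> 1" using a by (auto simp: t_def min_def field_simps)
    then have "0 < sin (a * t)" using a pi_gt3 by (intro sin_gt_zero) auto
    moreover have "w t \<noteq> 0" using t by (auto simp: w_def power2_eq_iff)
    ultimately show False using bspec[OF *, of t] t by auto
  qed
  define \<kappa> where "\<kappa> = complex_of_real (1 / sqrt (2 * pi))"
  have \<kappa>: "\<kappa> \<noteq> 0" by (simp add: \<kappa>_def)
  have ker: "fourier_kernel a t = of_real (cos (a * t)) + \<i> * of_real (sin (a * t))"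
    "fourier_kernel (-a) t = of_real (cos (a * t)) - \<i> * of_real (sin (a * t))" for t
    by (simp_all add: fourier_kernel_cos_sin)
  have hA: "((\<lambda>t. complex_of_real (w t * (cos (a * t))\<^sup>2)) has_integral of_real A) {-a..a}"
    and hB: "((\<lambda>t. complex_of_real (w t * (sin (a * t))\<^sup>2)) has_integral of_real B) {-a..a}"
    and hJ: "((\<lambda>t. complex_of_real (w t * (cos (a * t) * sin (a * t)))) has_integral of_real 0) {-a..a}"
    by (rule has_integral_of_real[OF integrable_integral[OF iA], folded A_def]
        has_integral_of_real[OF integrable_integral[OF iB], folded B_def]
        has_integral_of_real[OF integrable_integral[OF iJ], folded J_def, unfolded J])+
  have "((\<lambda>t. fourier_kernel a t * ?u t) has_integral of_real A + \<i> * of_real 0) {-a..a}"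
    by (rule has_integral_eq[OF _ has_integral_add[OF hA has_integral_mult_right[OF hJ]]])
       (simp add: ker algebra_simps power2_eq_square)
  then have Fu1: "truncated_fourier a ?u a = \<kappa> * of_real A"
    unfolding truncated_fourier_eq_integral(2)[OF L2(1)] \<kappa>_def by (simp add: integral_unique)
  have "((\<lambda>t. fourier_kernel (-a) t * ?u t) has_integral of_real A - \<i> * of_real 0) {-a..a}"
    by (rule has_integral_eq[OF _ has_integral_diff[OF hA has_integral_mult_right[OF hJ]]])
       (simp add: ker algebra_simps power2_eq_square)
  then have Fu2: "truncated_fourier a ?u (-a) = \<kappa> * of_real A"
    unfolding truncated_fourier_eq_integral(2)[OF L2(1)] \<kappa>_def by (simp add: integral_unique)
  have "((\<lambda>t. fourier_kernel a t * ?v t) has_integral of_real 0 + \<i> * of_real B) {-a..a}"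
    by (rule has_integral_eq[OF _ has_integral_add[OF hJ has_integral_mult_right[OF hB]]])
       (simp add: ker algebra_simps power2_eq_square)
  then have Fv1: "truncated_fourier a ?v a = \<kappa> * (\<i> * of_real B)"
    unfolding truncated_fourier_eq_integral(2)[OF L2(2)] \<kappa>_def by (simp add: integral_unique)
  have "((\<lambda>t. fourier_kernel (-a) t * ?v t) has_integral of_real 0 - \<i> * of_real B) {-a..a}"
    by (rule has_integral_eq[OF _ has_integral_diff[OF hJ has_integral_mult_right[OF hB]]])
       (simp add: ker algebra_simps power2_eq_square)
  then have Fv2: "truncated_fourier a ?v (-a) = - (\<kappa> * (\<i> * of_real B))"
    unfolding truncated_fourier_eq_integral(2)[OF L2(2)] \<kappa>_def by (simp add: integral_unique)
  \<comment> \<open>The even part (p + q) / 2 and the odd part (q - p) / 2 of the prescribed values,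
    divided by the corresponding transforms at \<open>a\<close>.\<close>
  define \<alpha> where "\<alpha> = (p + q) / (2 * (\<kappa> * of_real A))"
  define \<beta> where "\<beta> = (q - p) / (2 * (\<kappa> * (\<i> * of_real B)))"
  define s where "s = (\<lambda>t. \<alpha> * ?u t + \<beta> * ?v t)"
  have "\<exists>f1 f2. twice_cont_diff s f1 f2"
    unfolding s_def using uv twice_cont_diff_mult[OF twice_cont_diff_const] twice_cont_diff_add by blast
  then obtain s1 s2 where s: "twice_cont_diff s s1 s2" by blast
  have Fs: "truncated_fourier a s t = \<alpha> * truncated_fourier a ?u t + \<beta> * truncated_fourier a ?v t" for t
    unfolding s_def
    by (subst truncated_fourier_add) (auto intro!: L2_cmult L2 simp: truncated_fourier_cmult[OF L2(1)] truncated_fourier_cmult[OF L2(2)])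
  have \<alpha>: "\<alpha> * (\<kappa> * of_real A) = (p + q) / 2" and \<beta>: "\<beta> * (\<kappa> * (\<i> * of_real B)) = (q - p) / 2"
    using \<kappa> A B by (simp_all add: \<alpha>_def \<beta>_def)
  show ?thesis
  proof (rule that[OF s])
    show "s (-a) = 0" "s a = 0" by (simp_all add: s_def w_def)
    show "truncated_fourier a s (-a) = p" "truncated_fourier a s a = q"
      unfolding Fs Fu1 Fu2 Fv1 Fv2 mult_minus_right \<alpha> \<beta> by (simp_all add: field_simps)
  qed
qed

text \<open>The exponentials exp(i a t) and exp(-i a t) are linearly independent on (-a, a). A
  continuous function that vanishes almost everywhere vanishes at every interior point; the point 0
  gives \<beta> + \<gamma> = 0, and a point where sin (a t) is nonzero gives \<beta> = 0.\<close>

lemma boundary_term_not_ae_zero: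
  assumes a: "0 < a" and ae: "AE t in lebesgue_on {-a..a}. fourier_kernel t a * \<beta> + fourier_kernel t (-a) * \<gamma> = 0"
  shows "\<beta> = 0 \<and> \<gamma> = 0"
proof -
  \<comment> \<open>The arguments of the kernel are exchanged because continuity is available in its
    second argument.\<close>
  define g where "g t = fourier_kernel a t * \<beta> + fourier_kernel (-a) t * \<gamma>" for t
  have gc: "continuous_on S g" for S unfolding g_def[abs_def] by (intro continuous_intros)
  have "AE t in lebesgue. t \<in> {-a..a} \<longrightarrow> g t = 0"
    using ae by (simp add: AE_restrict_space_iff g_def fourier_kernel_commute[of _ a] fourier_kernel_commute[of _ "-a"])
  then obtain N where "N \<in> null_sets lebesgue" and "{t. \<not> (t \<in> {-a..a} \<longrightarrow> g t = 0)} \<subseteq> N"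
    by (auto simp: eventually_ae_filter)
  then have neg: "negligible {t. \<not> (t \<in> {-a..a} \<longrightarrow> g t = 0)}"
    by (meson negligible_iff_null_sets negligible_subset)
  have zero: "g t = 0" if t: "t \<in> {-a<..<a}" for t
  proof (rule ccontr)
    assume "g t \<noteq> 0"
    have "open ({-a<..<a} \<inter> g -` (- {0}))"
      by (intro continuous_open_preimage gc) auto
    moreover have "negligible ({-a<..<a} \<inter> g -` (- {0}))"
      by (rule negligible_subset[OF neg]) auto
    ultimately have "{-a<..<a} \<inter> g -` (- {0}) = {}" using open_not_negligible by blast
    with t \<open>g t \<noteq> 0\<close> show False by auto
  qed
  have "\<beta> + \<gamma> = 0" using zero[of 0] a by (simp add: g_def fourier_kernel_def)
  then have \<gamma>: "\<gamma> = - \<beta>" by (simp add: add_eq_0_iff)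
  define t where "t = min (a / 2) (1 / a)"
  have t: "0 < t" "t < a" "a * t \<le> 1" using a by (auto simp: t_def min_def field_simps)
  then have "0 < sin (a * t)" using a pi_gt3 by (intro sin_gt_zero) auto
  moreover have "fourier_kernel a t - fourier_kernel (-a) t = 2 * \<i> * of_real (sin (a * t))"
    by (simp add: fourier_kernel_cos_sin)
  moreover have "(fourier_kernel a t - fourier_kernel (-a) t) * \<beta> = 0"
    using zero[of t] t by (simp add: g_def \<gamma> algebra_simps)
  ultimately have "\<beta> = 0" by simp
  with \<gamma> show ?thesis by simp
qed

section \<open>Commutation\<close>

lemma fourier_commutator:
  assumes x: "x \<in> domain_max a" and a: "0 < a" and t: "t \<in> {-a<..<a}"
  shows "truncated_fourier a (prolate_L a x) t = prolate_L a (truncated_fourier a x) t +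
    complex_of_real (1 / sqrt (2 * pi)) * (of_real (2 / a) *
      (fourier_kernel t a * b_right a x + fourier_kernel t (-a) * b_left a x))"
  using fourier_prolate_boundary_formula[OF x a, of t]
    prolate_truncated_fourier[OF domain_max_L2(1)[OF x] a t] by simp

lemma AE_lebesgue_on_open_interval: "AE t in lebesgue_on {c..d}. t \<in> {c<..<d}" for c d :: real
proof -
  have "{c, d} \<in> null_sets lebesgue" by (metis finite.intros negligible_finite negligible_iff_null_sets)
  then have "AE t in lebesgue. t \<notin> {c, d}" by (rule AE_not_in)
  then have "AE t in lebesgue. t \<in> {c..d} \<longrightarrow> t \<in> {c<..<d}"
    by eventually_elim auto
  then show ?thesis by (subst AE_restrict_space_iff) auto
qed

lemma eq_L2_commutator_iff:
  assumes x: "x \<in> domain_max a" and a: "0 < a"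
  shows "eq_L2 {-a..a} (truncated_fourier a (prolate_L a x)) (prolate_L a (truncated_fourier a x)) \<longleftrightarrow>
    b_left a x = 0 \<and> b_right a x = 0"
proof
  assume "eq_L2 {-a..a} (truncated_fourier a (prolate_L a x)) (prolate_L a (truncated_fourier a x))"
  then have "AE t in lebesgue_on {-a..a}. truncated_fourier a (prolate_L a x) t = prolate_L a (truncated_fourier a x) t"
    by (simp add: eq_L2_def)
  then have "AE t in lebesgue_on {-a..a}. fourier_kernel t a * b_right a x + fourier_kernel t (-a) * b_left a x = 0"
    using AE_lebesgue_on_open_interval
  proof eventually_elim
    case (elim t)
    then have "complex_of_real (1 / sqrt (2 * pi)) * (of_real (2 / a) *
      (fourier_kernel t a * b_right a x + fourier_kernel t (-a) * b_left a x)) = 0"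
      using fourier_commutator[OF x a elim(2)] by simp
    then show ?case using a by (simp only: mult_eq_0_iff of_real_eq_0_iff) auto
  qed
  from boundary_term_not_ae_zero[OF a this] show "b_left a x = 0 \<and> b_right a x = 0" by simp
next
  assume "b_left a x = 0 \<and> b_right a x = 0"
  then have "truncated_fourier a (prolate_L a x) t = prolate_L a (truncated_fourier a x) t" if "t \<in> {-a<..<a}" for t
    using fourier_commutator[OF x a that] by simp
  then show "eq_L2 {-a..a} (truncated_fourier a (prolate_L a x)) (prolate_L a (truncated_fourier a x))"
    unfolding eq_L2_def by (intro eventually_mono[OF AE_lebesgue_on_open_interval])
qed

lemma commutes_with_fourier_identity:
  assumes a: "0 < a"
  shows "commutes_with_fourier a (mat 1)"
  unfolding commutes_with_fourier_def
proof (intro ballI conjI)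
  fix x assume x: "x \<in> domain_U a (mat 1)"
  \<comment> \<open>For the identity matrix the coefficients of the c-values vanish and the
    conditions read 2 b = 0 at each end.\<close>
  have dom: "x \<in> domain_max a" and "b_left a x = 0" "b_right a x = 0"
    using x by (auto simp: domain_U_def mat_def)
  then show "eq_L2 {-a..a} (truncated_fourier a (prolate_L a x)) (prolate_L a (truncated_fourier a x))"
    using eq_L2_commutator_iff[OF dom a] by simp
  show "prolate_L a x \<in> L2 {-a..a}" by (rule domain_max_L2(3)[OF dom])
  show "truncated_fourier a x \<in> domain_U a (mat 1)"
    by (subst truncated_fourier_domain_U_iff[OF domain_max_L2(1)[OF dom] a]) (simp add: mat_def)
qed

text \<open>One of the two basis vectors lies outside the kernel of I - U. The witness is used once
  as the end values of a transform and once as the parameter of boundary data with nonzero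
  b.\<close>

lemma matrix_2_not_identity_witness:
  fixes U :: "complex^2^2"
  assumes "U \<noteq> mat 1"
  obtains w1 w2 where "\<not> ((1 - U$1$1) * w1 - U$1$2 * w2 = 0 \<and> (1 - U$2$2) * w2 - U$2$1 * w1 = 0)"
proof -
  have "U$1$1 \<noteq> 1 \<or> U$1$2 \<noteq> 0 \<or> U$2$1 \<noteq> 0 \<or> U$2$2 \<noteq> 1"
    using assms by (auto simp: vec_eq_iff forall_2 mat_def)
  then show ?thesis using that[of 1 0] that[of 0 1] by auto
qed

text \<open>A smooth function vanishing at both ends has all boundary data 0 and satisfies every
  boundary condition, while the end values of its transform can be chosen outside the kernel of I -
  U.\<close>

lemma fourier_leaves_domain_U:
  fixes U :: "complex^2^2"
  assumes a: "0 < a" and U: "U \<noteq> mat 1"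
  shows "\<exists>x\<in>domain_U a U. truncated_fourier a x \<notin> domain_U a U"
proof -
  obtain w1 w2 where w: "\<not> ((1 - U$1$1) * w1 - U$1$2 * w2 = 0 \<and> (1 - U$2$2) * w2 - U$2$1 * w1 = 0)"
    by (rule matrix_2_not_identity_witness[OF U])
  obtain s s1 s2 where s: "twice_cont_diff s s1 s2" "s (-a) = 0" "s a = 0"
    "truncated_fourier a s (-a) = w1" "truncated_fourier a s a = w2"
    by (rule test_function[OF a])
  have "s \<in> domain_U a U"
    using twice_cont_diff_domain[OF a s(1)] s(2,3) by (simp add: domain_U_def)
  moreover have "truncated_fourier a s \<notin> domain_U a U"
    using w by (simp add: truncated_fourier_domain_U_iff[OF twice_cont_diff_L2[OF s(1)] a] s(4,5))
  ultimately show ?thesis by blast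
qed

text \<open>The boundary condition \<open>(I + U) b = i (I - U) c\<close> is solved by \<open>b = i (I - U) w\<close>,
  \<open>c = (I + U) w\<close>, and \<open>b\<close> does not vanish for a suitable \<open>w\<close> unless \<open>U = I\<close>.\<close>

lemma noncommuting_element:
  fixes U :: "complex^2^2"
  assumes a: "0 < a" and U: "U \<noteq> mat 1"
  shows "\<exists>x\<in>domain_U a U. truncated_fourier a x \<in> domain_U a U \<and>
    \<not> eq_L2 {-a..a} (truncated_fourier a (prolate_L a x)) (prolate_L a (truncated_fourier a x))"
proof -
  obtain w1 w2 where w: "\<not> ((1 - U$1$1) * w1 - U$1$2 * w2 = 0 \<and> (1 - U$2$2) * w2 - U$2$1 * w1 = 0)"
    by (rule matrix_2_not_identity_witness[OF U])
  define b1 where "b1 = \<i> * ((1 - U$1$1) * w1 - U$1$2 * w2)"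
  define b2 where "b2 = \<i> * ((1 - U$2$2) * w2 - U$2$1 * w1)"
  define c1 where "c1 = (1 + U$1$1) * w1 + U$1$2 * w2"
  define c2 where "c2 = U$2$1 * w1 + (1 + U$2$2) * w2"
  have b: "\<not> (b1 = 0 \<and> b2 = 0)" using w by (simp add: b1_def b2_def)
  \<comment> \<open>End values of the regular part that produce c-values c1 and c2; the terms with
    ln (2 * a) compensate the logarithm of the opposite end.\<close>
  define p where "p = - b2 * of_real (ln (2 * a)) - c1"
  define q where "q = - b1 * of_real (ln (2 * a)) - c2"
  \<comment> \<open>Coefficients of the linear interpolation between p at -a and q at
    \<open>a\<close>.\<close>
  define k0 where "k0 = (p + q) / 2"
  define k1 where "k1 = (q - p) / (2 * of_real a)"
  define l where "l = (\<lambda>t. k0 + k1 * complex_of_real t)"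
  have "\<exists>f1 f2. twice_cont_diff l f1 f2"
  proof -
    have "twice_cont_diff (\<lambda>t. of_real t) (\<lambda>t. of_real 1) (\<lambda>t. of_real 0)"
      by (rule twice_cont_diff_of_real) (auto intro!: derivative_eq_intros)
    then show ?thesis
      unfolding l_def using twice_cont_diff_add[OF twice_cont_diff_const twice_cont_diff_mult[OF twice_cont_diff_const]]
      by blast
  qed
  then obtain l1 l2 where l: "twice_cont_diff l l1 l2" by blast
  have l_ends: "l (-a) = p" "l a = q"
    using a by (simp_all add: l_def k0_def k1_def field_simps)
  define x0 where "x0 = log_perturbed a b1 b2 l"
  have x0: "x0 \<in> L2 {-a..a}"
    unfolding x0_def by (rule domain_max_L2(1)[OF log_perturbed_domain(1)[OF a l]])
  \<comment> \<open>This correction cancels the transform of \<open>x0\<close> at both ends; being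
    smooth and zero there, it leaves b and c unchanged.\<close>
  obtain s s1 s2 where s: "twice_cont_diff s s1 s2" "s (-a) = 0" "s a = 0"
    "truncated_fourier a s (-a) = - truncated_fourier a x0 (-a)" "truncated_fourier a s a = - truncated_fourier a x0 a"
    by (rule test_function[OF a])
  define x where "x = log_perturbed a b1 b2 (\<lambda>t. l t + s t)"
  note x_dom = log_perturbed_domain[OF a twice_cont_diff_add[OF l s(1)], where \<beta> = b1 and \<gamma> = b2, folded x_def]
  have "x = (\<lambda>t. x0 t + s t)" by (simp add: x_def x0_def log_perturbed_def fun_eq_iff)
  then have Fx: "truncated_fourier a x (-a) = 0" "truncated_fourier a x a = 0"
    using truncated_fourier_add[OF x0 twice_cont_diff_L2[OF s(1)]] s(4,5) by simp_all
  have c: "c_left a x = c1" "c_right a x = c2"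
    using x_dom(5,6) by (simp_all add: s l_ends p_def q_def)
  \<comment> \<open>The condition becomes i (I + U) (I - U) w = i (I - U) (I + U) w, which holds
    because I + U and I - U commute.\<close>
  have "x \<in> domain_U a U"
    unfolding domain_U_def mem_Collect_eq x_dom(3,4) c
    using x_dom(1) by (simp add: b1_def b2_def c1_def c2_def algebra_simps)
  moreover have "truncated_fourier a x \<in> domain_U a U"
    using Fx by (simp add: truncated_fourier_domain_U_iff[OF domain_max_L2(1)[OF x_dom(1)] a])
  moreover have "\<not> eq_L2 {-a..a} (truncated_fourier a (prolate_L a x)) (prolate_L a (truncated_fourier a x))"
    using b by (simp add: eq_L2_commutator_iff[OF x_dom(1) a] x_dom(3,4))
  ultimately show ?thesis by blast
qed

theorem theorem10p2:
  fixes a :: real and U :: "complex^2^2"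
  assumes "a > 0" and "unitary_matrix U"
  shows "(U = mat 1 \<longrightarrow> commutes_with_fourier a U) \<and>
    (U \<noteq> mat 1 \<longrightarrow>
       \<not> commutes_with_fourier a U \<and>
       (\<exists>x\<in>domain_U a U. truncated_fourier a x \<in> domain_U a U \<and>
          \<not> eq_L2 {-a..a} (truncated_fourier a (prolate_L a x))
                            (prolate_L a (truncated_fourier a x))) \<and>
       (\<exists>x\<in>domain_U a U. truncated_fourier a x \<notin> domain_U a U))"
proof (intro conjI impI)
  show "commutes_with_fourier a U" if "U = mat 1"
    using that commutes_with_fourier_identity[OF assms(1)] by simp
  assume U: "U \<noteq> mat 1"
  show "\<exists>x\<in>domain_U a U. truncated_fourier a x \<in> domain_U a U \<and>
          \<not> eq_L2 {-a..a} (truncated_fourier a (prolate_L a x)) (prolate_L a (truncated_fourier a x))"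
    by (rule noncommuting_element[OF assms(1) U])
  show "\<exists>x\<in>domain_U a U. truncated_fourier a x \<notin> domain_U a U"
    by (rule fourier_leaves_domain_U[OF assms(1) U])
  \<comment> \<open>Commutation includes that the transform stays in the domain, so an element whose
    transform leaves it refutes commutation.\<close>
  show "\<not> commutes_with_fourier a U"
    using fourier_leaves_domain_U[OF assms(1) U] by (auto simp: commutes_with_fourier_def)
qed

end
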